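(* Let $X$ be a space. The following statements are equivalent: (1) $X$ is metrizable by a Bourbaki-complete metric; (2) $X$ is metrizable by a complete metric $d$ such that $\mu_d=s_f\mu_d$; (3) $X$ is homeomorphic to a closed subspace of $D^{\omega_0}\times\mathbb R^{\omega_0}$, where $D$ is a discrete space whose cardinal is the cellularity of $X$; (4) $X$ is homeomorphic to a closed subspace of a countable product of locally compact metric spaces; (5) $X$ is Čech-complete and strongly metrizable; (6) $X$ is metrizable by a complete metric $d$ such that $\mu_d=s_c\mu_d$.
   Context: All spaces are Tychonoff. For a metric space $(X,d)$, the metric uniformity $\mu_d$ is the family of covers of $X$ (uniform covers) refined by $\{B_d(x,\varepsilon):x\in X\}$ for some $\varepsilon>0$. For a cover $\mathcal U$ of $X$ and $A\subset X$: $St(A,\mathcal U)=\bigcup\{U\in\mathcal U: U\cap A\neq\emptyset\}$, $St^0(A,\mathcal U)=A$, $St^m(A,\mathcal U)=St(St^{m-1}(A,\mathcal U),\mathcal U)$ for $m\ge1$. A filter $\mathcal F$ on $X$ is Bourbaki-Cauchy if for every $\mathcal U\in\mu_d$ there are $m\in\mathbb N$, $U\in\mathcal U$ and $F\in\mathcal F$ with $F\subset St^m(U,\mathcal U)$. A metric $d$ is Bourbaki-complete if every Bourbaki-Cauchy filter of $(X,d)$ has a cluster point. "Metrizable by a metric $d$" means that $d$ induces the topology of $X$. A cover is star-finite (star-countable) if each of its members meets at most finitely (countably) many of its members. $\mu_d=s_f\mu_d$ means that the star-finite open covers belonging to $\mu_d$ form a base of $\mu_d$; $\mu_d=s_c\mu_d$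 means that the star-countable covers belonging to $\mu_d$ form a base of $\mu_d$ (every uniform cover is refined by a star-countable uniform cover). The cellularity of $X$ is here the supremum of the cardinals of all partitions of $X$ by open sets. $X$ is Čech-complete if it is the intersection of countably many open subsets of its Stone–Čech compactification $\beta X$. $X$ is strongly metrizable if it has a base for the topology which is the union of countably many star-finite open covers of $X$. *)

theory Defs
  imports "HOL-Analysis.Analysis" "HOL-Library.Disjoint_Sets" "HOL-Library.Equipollence"
begin

definition all_equivalent :: "bool list \<Rightarrow> bool"
  where "all_equivalent Ps \<longleftrightarrow> (\<forall>P\<in>set Ps. \<forall>Q\<in>set Ps. P \<longleftrightarrow> Q)"


section \<open>Covers\<close>

definition cover_of :: "'a set \<Rightarrow> 'a set set \<Rightarrow> bool"
  where "cover_of M \<U> \<longleftrightarrow> \<Union>\<U> = M"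

definition refines :: "'a set set \<Rightarrow> 'a set set \<Rightarrow> bool"
  where "refines \<V> \<U> \<longleftrightarrow> (\<forall>V\<in>\<V>. \<exists>U\<in>\<U>. V \<subseteq> U)"

definition star :: "'a set set \<Rightarrow> 'a set \<Rightarrow> 'a set"
  where "star \<U> A = \<Union>{U\<in>\<U>. U \<inter> A \<noteq> {}}"

definition star_finite :: "'a set set \<Rightarrow> bool"
  where "star_finite \<U> \<longleftrightarrow> (\<forall>U\<in>\<U>. finite {V\<in>\<U>. V \<inter> U \<noteq> {}})"

definition star_countable :: "'a set set \<Rightarrow> bool"
  where "star_countable \<U> \<longleftrightarrow> (\<forall>U\<in>\<U>. countable {V\<in>\<U>. V \<inter> U \<noteq> {}})"


section \<open>The metric uniformity and Bourbaki-completeness\<close>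

definition metric_uniformity :: "'a metric \<Rightarrow> 'a set set set"
  where "metric_uniformity m =
    {\<U>. cover_of (mspace m) \<U> \<and> (\<exists>\<epsilon>>0. refines ((\<lambda>x. mball_of m x \<epsilon>) ` mspace m) \<U>)}"

definition uniformity_base :: "'a metric \<Rightarrow> 'a set set set \<Rightarrow> bool"
  where "uniformity_base m \<BB> \<longleftrightarrow>
    \<BB> \<subseteq> metric_uniformity m \<and> (\<forall>\<U>\<in>metric_uniformity m. \<exists>\<V>\<in>\<BB>. refines \<V> \<U>)"

definition star_finite_base :: "'a metric \<Rightarrow> bool"
  where "star_finite_base m \<longleftrightarrow>
    uniformity_base m {\<V>\<in>metric_uniformity m. star_finite \<V> \<and> (\<forall>V\<in>\<V>. openin (mtopology_of m) V)}"

definition star_countable_base :: "'a metric \<Rightarrow> bool"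
  where "star_countable_base m \<longleftrightarrow> uniformity_base m {\<V>\<in>metric_uniformity m. star_countable \<V>}"

text \<open>The library type \<^typ>\<open>'a filter\<close> contains the improper filter \<^term>\<open>bot\<close> and its filters live
  on the whole type, so filters in the usual sense on a set \<open>M\<close> are singled out here. A set \<open>F\<close>
  is a member of the filter when the filter eventually satisfies membership in \<open>F\<close>.\<close>

definition filter_on :: "'a set \<Rightarrow> 'a filter \<Rightarrow> bool"
  where "filter_on M \<F> \<longleftrightarrow> \<F> \<noteq> bot \<and> eventually (\<lambda>x. x \<in> M) \<F>"

definition cluster_point :: "'a topology \<Rightarrow> 'a filter \<Rightarrow> 'a \<Rightarrow> bool"
  where "cluster_point X \<F> x \<longleftrightarrow>
    x \<in> topspace X \<and> (\<forall>F. eventually (\<lambda>y. y \<in> F) \<F> \<longrightarrow> x \<in> X closure_of F)"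

definition Bourbaki_Cauchy :: "'a metric \<Rightarrow> 'a filter \<Rightarrow> bool"
  where "Bourbaki_Cauchy m \<F> \<longleftrightarrow>
    (\<forall>\<U>\<in>metric_uniformity m. \<exists>n::nat. \<exists>U\<in>\<U>. \<exists>F.
       eventually (\<lambda>x. x \<in> F) \<F> \<and> F \<subseteq> (star \<U> ^^ n) U)"

definition Bourbaki_complete :: "'a metric \<Rightarrow> bool"
  where "Bourbaki_complete m \<longleftrightarrow>
    (\<forall>\<F>. filter_on (mspace m) \<F> \<and> Bourbaki_Cauchy m \<F> \<longrightarrow> (\<exists>x. cluster_point (mtopology_of m) \<F> x))"


section \<open>Cellularity\<close>

definition open_partition :: "'a topology \<Rightarrow> 'a set set \<Rightarrow> bool"
  where "open_partition X P \<longleftrightarrow> partition_on (topspace X) P \<and> (\<forall>U\<in>P. openin X U)"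

text \<open>The cardinal of \<open>D\<close> is the supremum (least upper bound) of the cardinals of the open partitions
  of \<open>X\<close>. It is enough to compare with sets \<open>E\<close> of the same type as \<open>D\<close>: every cardinal below
  that of \<open>D\<close> is attained by a subset of \<open>D\<close>. Choosing a point in each member shows that every
  open partition is dominated by \<^term>\<open>topspace X\<close>, so such a \<open>D\<close> exists inside the type of points
  of \<open>X\<close>.\<close>

definition has_cellularity :: "'a topology \<Rightarrow> 'd set \<Rightarrow> bool"
  where "has_cellularity X D \<longleftrightarrow>
    (\<forall>P. open_partition X P \<longrightarrow> P \<lesssim> D) \<and>
    (\<forall>E :: 'd set. (\<forall>P. open_partition X P \<longrightarrow> P \<lesssim> E) \<longrightarrow> D \<lesssim> E)"


section \<open>Stone--Cech compactification\<close>

text \<open>\<open>\<beta>X\<close> is realised as the closure of the image of \<open>X\<close> under evaluation in the cube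
  $[0,1]^{C(X,[0,1])}$. Functions on \<^term>\<open>topspace X\<close> are represented by extensional ones.\<close>

definition unit_functions :: "'a topology \<Rightarrow> ('a \<Rightarrow> real) set"
  where "unit_functions X =
    {f \<in> extensional (topspace X). continuous_map X (top_of_set {0..1}) f}"

definition Stone_Cech_map :: "'a topology \<Rightarrow> 'a \<Rightarrow> ('a \<Rightarrow> real) \<Rightarrow> real"
  where "Stone_Cech_map X x = (\<lambda>f\<in>unit_functions X. f x)"

definition Stone_Cech :: "'a topology \<Rightarrow> (('a \<Rightarrow> real) \<Rightarrow> real) topology"
  where "Stone_Cech X =
    (let cube = product_topology (\<lambda>f. top_of_set {0..1}) (unit_functions X)
     in subtopology cube (cube closure_of (Stone_Cech_map X ` topspace X)))"

definition Cech_complete :: "'a topology \<Rightarrow> bool"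
  where "Cech_complete X \<longleftrightarrow> gdelta_in (Stone_Cech X) (Stone_Cech_map X ` topspace X)"


section \<open>Strongly metrizable spaces\<close>

definition strongly_metrizable :: "'a topology \<Rightarrow> bool"
  where "strongly_metrizable X \<longleftrightarrow>
    (\<exists>\<U> :: nat \<Rightarrow> 'a set set.
       (\<forall>n. star_finite (\<U> n) \<and> cover_of (topspace X) (\<U> n) \<and> (\<forall>U\<in>\<U> n. openin X U)) \<and>
       openin X = arbitrary union_of (\<lambda>U. U \<in> (\<Union>n. \<U> n)))"


section \<open>Basic facts\<close>

lemma ex_has_cellularity: "\<exists>D. D \<subseteq> topspace X \<and> has_cellularity X D"
proof -
  define Q where "Q = {r. \<exists>E :: 'a set. (\<forall>P. open_partition X P \<longrightarrow> P \<lesssim> E) \<and> r = card_of E}"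
  have top: "P \<lesssim> topspace X" if "open_partition X P" for P
  proof -
    have P: "\<Union>P = topspace X" "disjoint P" "{} \<notin> P"
      using that by (auto simp: open_partition_def partition_on_def)
    define c where "c = (\<lambda>U :: 'a set. SOME x. x \<in> U)"
    have c: "c U \<in> U" if "U \<in> P" for U
      using that P(3) unfolding c_def by (metis some_in_eq)
    have "inj_on c P"
    proof (rule inj_onI)
      fix U V assume UV: "U \<in> P" "V \<in> P" "c U = c V"
      then have "c U \<in> U \<inter> V" using c[of U] c[of V] by simp
      then show "U = V" using disjointD[OF P(2) UV(1,2)] by blast
    qed
    moreover have "c ` P \<subseteq> topspace X"
      using c P(1) by blast
    ultimately show ?thesis unfolding lepoll_def by blast
  qed
  then have "card_of (topspace X) \<in> Q" by (auto simp: Q_def)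
  then obtain r where r: "r \<in> Q" and min: "\<And>s. (s, r) \<in> ordLess \<Longrightarrow> s \<notin> Q"
    by (rule wfE_min[OF wf_ordLess]) blast
  from r obtain D where D: "\<And>P. open_partition X P \<Longrightarrow> P \<lesssim> D" and rD: "r = card_of D"
    by (auto simp: Q_def)
  have le: "D \<lesssim> E" if E: "\<forall>P. open_partition X P \<longrightarrow> P \<lesssim> E" for E :: "'a set"
  proof -
    have "card_of E \<in> Q" using E by (auto simp: Q_def)
    then have "(card_of E, card_of D) \<notin> ordLess" using min rD by blast
    then have "(card_of D, card_of E) \<in> ordLeq"
      using ordLess_or_ordLeq[OF card_of_Well_order card_of_Well_order] by blast
    then show ?thesis unfolding lepoll_def by (rule card_of_ordLeq[THEN iffD2])
  qed
  have "D \<lesssim> topspace X" using le top by blast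
  then obtain f where f: "inj_on f D" "f ` D \<subseteq> topspace X" unfolding lepoll_def by blast
  have e: "f ` D \<approx> D" by (simp add: f(1) inj_on_image_eqpoll_self)
  have "has_cellularity X (f ` D)"
    unfolding has_cellularity_def
  proof (intro conjI allI impI)
    show "P \<lesssim> f ` D" if "open_partition X P" for P
      using lepoll_trans[OF D[OF that] eqpoll_imp_lepoll[OF eqpoll_sym[OF e]]] .
    show "f ` D \<lesssim> E" if "\<forall>P. open_partition X P \<longrightarrow> P \<lesssim> E" for E :: "'a set"
      using lepoll_trans[OF eqpoll_imp_lepoll[OF e] le[OF that]] .
  qed
  with f(2) show ?thesis by blast
qed

lemma unit_functions_eq:
  "unit_functions X = mspace (submetric (cfunspace X euclidean_metric) {f. f \<in> topspace X \<rightarrow> {0..1}})"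
proof -
  have "bounded (f ` topspace X)" if "f \<in> topspace X \<rightarrow> {0..1::real}" for f
    by (meson bounded_closed_interval bounded_subset image_subset_iff_funcset that)
  then show ?thesis
    by (auto simp: unit_functions_def continuous_map_in_subtopology image_subset_iff_funcset)
qed

lemma compact_Hausdorff_Stone_Cech:
  "compact_space (Stone_Cech X)" "Hausdorff_space (Stone_Cech X)"
proof -
  let ?cube = "product_topology (\<lambda>f. top_of_set {0..1::real}) (unit_functions X)"
  have "compact_space ?cube"
    by (simp add: compact_space_product_topology compact_space_subtopology)
  then show "compact_space (Stone_Cech X)"
    by (simp add: Stone_Cech_def Let_def closedin_compact_space compact_space_subtopology)
  have "Hausdorff_space ?cube"
    by (simp add: Hausdorff_space_product_topology Hausdorff_space_subtopology)
  then show "Hausdorff_space (Stone_Cech X)"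
    by (simp add: Stone_Cech_def Let_def Hausdorff_space_subtopology)
qed

lemma Stone_Cech_map_in_cube:
  "Stone_Cech_map X ` topspace X \<subseteq>
   topspace (product_topology (\<lambda>f. top_of_set {0..1::real}) (unit_functions X))"
proof -
  have "f x \<in> {0..1}" if "f \<in> unit_functions X" "x \<in> topspace X" for f x
  proof -
    have "f ` topspace X \<subseteq> {0..1}"
      using that(1) unfolding unit_functions_def continuous_map_in_subtopology
      by (simp add: image_subset_iff_funcset)
    with that(2) show ?thesis by blast
  qed
  then show ?thesis
    unfolding topspace_product_topology Stone_Cech_map_def
    by (simp add: image_subset_iff PiE_iff)
qed

lemma embedding_map_Stone_Cech:
  assumes "completely_regular_space X" "Hausdorff_space X"
  shows "embedding_map X (Stone_Cech X) (Stone_Cech_map X)"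
proof -
  let ?cube = "product_topology (\<lambda>f. top_of_set {0..1::real}) (unit_functions X)"
  have "Stone_Cech_map X = (\<lambda>x. \<lambda>f\<in>unit_functions X. f x)"
    by (simp add: Stone_Cech_map_def fun_eq_iff)
  then have "embedding_map X ?cube (Stone_Cech_map X)"
    using completely_regular_space_cube_embedding_explicit[OF assms]
    by (simp only: unit_functions_eq)
  moreover have "Stone_Cech_map X ` topspace X \<subseteq> ?cube closure_of (Stone_Cech_map X ` topspace X)"
    by (rule closure_of_subset[OF Stone_Cech_map_in_cube])
  ultimately show ?thesis
    by (simp add: Stone_Cech_def Let_def embedding_map_def subtopology_subtopology Int_absorb1)
qed

lemma dense_Stone_Cech:
  "Stone_Cech X closure_of (Stone_Cech_map X ` topspace X) = topspace (Stone_Cech X)"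
proof -
  let ?cube = "product_topology (\<lambda>f. top_of_set {0..1::real}) (unit_functions X)"
  let ?S = "Stone_Cech_map X ` topspace X"
  have "?S \<subseteq> ?cube closure_of ?S"
    by (rule closure_of_subset[OF Stone_Cech_map_in_cube])
  moreover have "?cube closure_of ?S \<subseteq> topspace ?cube"
    by (rule closure_of_subset_topspace)
  ultimately show ?thesis
    by (simp only: Stone_Cech_def Let_def closure_of_subtopology topspace_subtopology)
       (simp only: Int_absorb1 Int_absorb2 Int_absorb)
qed

end

theory Submission
  imports Defs
begin

text \<open>The argument passes through one intermediate notion: a base of the topology that is the union
  of countably many star-\<^emph>\<open>countable\<close> open covers.

  Such a base yields an embedding into \<open>D\<^sup>\<omega> \<times> \<real>\<^sup>\<omega>\<close>, provided the space is normal and its open sets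
  are \<open>F\<^sub>\<sigma>\<close> (\<open>embedding_into_Baire_cube\<close>): the chain components of a star-countable open cover form an open
  partition, which maps into \<open>D\<close> because \<open>D\<close> has the cellularity of \<open>X\<close> as cardinal, and every
  component consists of countably many members, so that the whole cover is recovered from the
  components and from countably many open sets; Urysohn functions for the latter give the real
  coordinates. If the image is a \<open>G\<^sub>\<delta>\<close> set, the graph of the reciprocal distances to the complements
  makes it closed in \<open>D\<^sup>\<omega> \<times> \<real>\<^sup>\<omega> \<times> \<real>\<^sup>\<omega>\<close>, and the last factor is absorbed. The image is \<open>G\<^sub>\<delta>\<close> when \<open>X\<close> is
  completely metrizable, and also when \<open>X\<close> is only Cech-complete
  (\<open>gdelta_in_embedding_Cech_complete\<close>).

  The existence of a complete metric with star-finite uniform covers plainly implies the existence of one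
  with star-countable uniform covers. It remains to find the base under the other conditions.
  \<^item> A Bourbaki-complete metric is complete. The sets between consecutive stars of the cover by balls of
    radius \<open>1/i\<close> form star-finite open covers \<open>\<T>\<^sub>i\<close> whose members lie in finite iterated stars. If no
    finite meet of members of the \<open>\<T>\<^sub>i\<close> around a point could be covered by finitely many balls of a
    given radius, what remains of these meets outside finite unions of such balls would generate a Bourbaki-Cauchy
    filter without cluster points. Splitting the finitely covered members by the balls yields the base.
  \<^item> A locally compact metric space is locally separable, and then it is a disjoint union of separable
    open chain components, which gives the base directly; bases of the factors lift to products and subspaces.
  \<^item> For a metric with a base of star-countable uniform covers one takes interiors.
  \<^item> A strongly metrizable space has such a base by definition, and the local finiteness of star-finite
    open covers gives normality and the \<open>F\<^sub>\<sigma>\<close> property.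

  Conversely, a closed subspace of \<open>D\<^sup>\<omega> \<times> \<real>\<^sup>\<omega>\<close> inherits a complete metric whose uniform covers are
  refined by the star-finite meets of coordinate partitions and coordinate grids, so that the space
  is Cech-complete and strongly metrizable. Such a metric is Bourbaki-complete because each iterated star of a
  star-finite cover lies in a finite union of members, and a Cantor intersection argument applies. The condition
  about locally compact factors is immediate, as \<open>D\<close> and \<open>\<real>\<close> are locally compact.\<close>

section \<open>Star-finite and star-countable open covers\<close>

text \<open>The covers \<open>\<U> n\<close> are open and their members together form a base of the topology.\<close>

definition open_cover_base :: "'a topology \<Rightarrow> (nat \<Rightarrow> 'a set set) \<Rightarrow> bool"
  where "open_cover_base X \<U> \<longleftrightarrow>
    (\<forall>n. cover_of (topspace X) (\<U> n) \<and> (\<forall>U\<in>\<U> n. openin X U)) \<and>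
    (\<forall>W x. openin X W \<and> x \<in> W \<longrightarrow> (\<exists>n. \<exists>U\<in>\<U> n. x \<in> U \<and> U \<subseteq> W))"

lemma strongly_metrizable_iff:
  "strongly_metrizable X \<longleftrightarrow> (\<exists>\<U>. open_cover_base X \<U> \<and> (\<forall>n. star_finite (\<U> n)))"
proof -
  have "(\<forall>n. star_finite (\<U> n) \<and> cover_of (topspace X) (\<U> n) \<and> (\<forall>U\<in>\<U> n. openin X U)) \<and>
      openin X = arbitrary union_of (\<lambda>U. U \<in> (\<Union>n. \<U> n))
    \<longleftrightarrow> open_cover_base X \<U> \<and> (\<forall>n. star_finite (\<U> n))" for \<U>
  proof -
    have "(\<exists>V. V \<in> (\<Union>n. \<U> n) \<and> x \<in> V \<and> V \<subseteq> W) \<longleftrightarrow> (\<exists>n. \<exists>U\<in>\<U> n. x \<in> U \<and> U \<subseteq> W)" for x W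
      by blast
    then show ?thesis
      unfolding open_cover_base_def openin_topology_base_unique by auto
  qed
  then show ?thesis unfolding strongly_metrizable_def by simp
qed

text \<open>The common refinement of the covers \<open>\<W> 0, \<dots>, \<W> N\<close>, consisting of the intersections of one
  member from each.\<close>

definition cover_meet :: "(nat \<Rightarrow> 'a set set) \<Rightarrow> nat \<Rightarrow> 'a set set"
  where "cover_meet \<W> N = (\<lambda>V. \<Inter>k\<le>N. V k) ` (\<Pi>\<^sub>E k\<in>{..N}. \<W> k)"

lemma cover_meetI:
  assumes "\<And>k. k \<le> N \<Longrightarrow> V k \<in> \<W> k"
  shows "(\<Inter>k\<le>N. V k) \<in> cover_meet \<W> N"
  unfolding cover_meet_def
  by (rule image_eqI[of _ _ "restrict V {..N}"]) (use assms in auto)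

lemma cover_of_cover_meet:
  assumes "\<And>k. cover_of T (\<W> k)"
  shows "cover_of T (cover_meet \<W> N)"
  unfolding cover_of_def
proof (intro equalityI subsetI)
  fix x assume "x \<in> \<Union>(cover_meet \<W> N)"
  then obtain V where V: "V \<in> (\<Pi>\<^sub>E k\<in>{..N}. \<W> k)" "x \<in> (\<Inter>k\<le>N. V k)"
    unfolding cover_meet_def by blast
  then have "x \<in> V 0" "V 0 \<in> \<W> 0" by (auto simp: PiE_iff)
  then show "x \<in> T" using assms unfolding cover_of_def by blast
next
  fix x assume "x \<in> T"
  then have "\<exists>V. V \<in> \<W> k \<and> x \<in> V" for k
    using assms[of k] unfolding cover_of_def by blast
  then obtain V where V: "\<And>k. V k \<in> \<W> k \<and> x \<in> V k" by metis
  then have "(\<Inter>k\<le>N. V k) \<in> cover_meet \<W> N" by (intro cover_meetI) simp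
  moreover have "x \<in> (\<Inter>k\<le>N. V k)" using V by simp
  ultimately show "x \<in> \<Union>(cover_meet \<W> N)" by blast
qed

lemma openin_cover_meet:
  assumes "\<And>k U. U \<in> \<W> k \<Longrightarrow> openin X U" and "V \<in> cover_meet \<W> N"
  shows "openin X V"
proof -
  obtain F where "F \<in> (\<Pi>\<^sub>E k\<in>{..N}. \<W> k)" "V = (\<Inter>k\<le>N. F k)"
    using assms(2) unfolding cover_meet_def by blast
  then have "V = \<Inter>(F ` {..N})" "\<And>k. k \<le> N \<Longrightarrow> openin X (F k)"
    using assms(1) by (auto simp: PiE_iff)
  then show ?thesis
    by (auto intro!: openin_Inter)
qed

lemma star_members_cover_meet:
  "{V\<in>cover_meet \<W> N. V \<inter> (\<Inter>k\<le>N. F k) \<noteq> {}} \<subseteq>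
   (\<lambda>V. \<Inter>k\<le>N. V k) ` (\<Pi>\<^sub>E k\<in>{..N}. {V\<in>\<W> k. V \<inter> F k \<noteq> {}})"
proof
  fix V assume "V \<in> {V\<in>cover_meet \<W> N. V \<inter> (\<Inter>k\<le>N. F k) \<noteq> {}}"
  then have V: "V \<in> cover_meet \<W> N" "V \<inter> (\<Inter>k\<le>N. F k) \<noteq> {}" by simp_all
  from V(1) obtain G where G: "G \<in> (\<Pi>\<^sub>E k\<in>{..N}. \<W> k)" "V = (\<Inter>k\<le>N. G k)"
    unfolding cover_meet_def by blast
  from V(2) obtain x where x: "x \<in> (\<Inter>k\<le>N. G k)" "x \<in> (\<Inter>k\<le>N. F k)"
    unfolding G(2) by blast
  have "G k \<inter> F k \<noteq> {}" if "k \<le> N" for k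
    using x that by blast
  then have "G \<in> (\<Pi>\<^sub>E k\<in>{..N}. {V\<in>\<W> k. V \<inter> F k \<noteq> {}})"
    using G(1) by (auto simp: PiE_iff)
  then show "V \<in> (\<lambda>V. \<Inter>k\<le>N. V k) ` (\<Pi>\<^sub>E k\<in>{..N}. {V\<in>\<W> k. V \<inter> F k \<noteq> {}})"
    using G(2) by blast
qed

lemma star_finite_cover_meet:
  assumes "\<And>k. star_finite (\<W> k)"
  shows "star_finite (cover_meet \<W> N)"
  unfolding star_finite_def
proof
  fix U assume "U \<in> cover_meet \<W> N"
  then obtain F where F: "F \<in> (\<Pi>\<^sub>E k\<in>{..N}. \<W> k)" "U = (\<Inter>k\<le>N. F k)"
    unfolding cover_meet_def by blast
  have "finite (\<Pi>\<^sub>E k\<in>{..N}. {V\<in>\<W> k. V \<inter> F k \<noteq> {}})"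
    using F(1) assms by (intro finite_PiE) (auto simp: star_finite_def PiE_iff)
  then show "finite {V\<in>cover_meet \<W> N. V \<inter> U \<noteq> {}}"
    unfolding F(2) by (rule finite_surj[OF _ star_members_cover_meet])
qed

lemma star_countable_cover_meet:
  assumes "\<And>k. star_countable (\<W> k)"
  shows "star_countable (cover_meet \<W> N)"
  unfolding star_countable_def
proof
  fix U assume "U \<in> cover_meet \<W> N"
  then obtain F where F: "F \<in> (\<Pi>\<^sub>E k\<in>{..N}. \<W> k)" "U = (\<Inter>k\<le>N. F k)"
    unfolding cover_meet_def by blast
  have "countable (\<Pi>\<^sub>E k\<in>{..N}. {V\<in>\<W> k. V \<inter> F k \<noteq> {}})"
    using F(1) assms by (intro countable_PiE) (auto simp: star_countable_def PiE_iff)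
  then show "countable {V\<in>cover_meet \<W> N. V \<inter> U \<noteq> {}}"
    unfolding F(2) by (rule countable_subset[OF star_members_cover_meet countable_image])
qed

lemma star_finite_imp_star_countable: "star_finite \<U> \<Longrightarrow> star_countable \<U>"
  by (auto simp: star_finite_def star_countable_def intro: countable_finite)

text \<open>The set \<open>p x\<close> is the chain component of \<open>x\<close>. A component contains only countably many members
  of the cover; \<open>G k\<close> collects the \<open>k\<close>-th member of every component, in some enumeration.\<close>

lemma star_countable_components:
  assumes sc: "star_countable \<U>" and cov: "cover_of (topspace X) \<U>" 
    and op: "\<And>U. U \<in> \<U> \<Longrightarrow> openin X U"
  obtains p :: "'a \<Rightarrow> 'a set" and G :: "nat \<Rightarrow> 'a set" where
    "\<And>x. x \<in> topspace X \<Longrightarrow> x \<in> p x"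
    "\<And>x y. x \<in> topspace X \<Longrightarrow> y \<in> p x \<Longrightarrow> p y = p x"
    "\<And>x. openin X (p x)"
    "\<And>k. openin X (G k)"
    "\<And>x U. U \<in> \<U> \<Longrightarrow> x \<in> U \<Longrightarrow> \<exists>k. x \<in> G k \<and> G k \<inter> p x \<subseteq> U"
proof -
  define R where "R = {(V, W). V \<in> \<U> \<and> W \<in> \<U> \<and> V \<inter> W \<noteq> {}}"
  have symR: "sym (R\<^sup>*)"
    by (rule sym_rtrancl) (auto simp: R_def sym_def)
  define c where "c x = R\<^sup>* `` {V\<in>\<U>. x \<in> V}" for x
  define p where "p x = \<Union>(c x)" for x
  have cU: "c x \<subseteq> \<U>" for x
  proof
    fix V assume "V \<in> c x"
    then obtain W where "(W, V) \<in> R\<^sup>*" "W \<in> \<U>" unfolding c_def by blast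
    then show "V \<in> \<U>" by (induction rule: rtrancl_induct) (auto simp: R_def)
  qed
  have px: "x \<in> p x" if "x \<in> topspace X" for x
    using that cov unfolding p_def c_def cover_of_def by blast
  have clink: "V \<in> c x \<longleftrightarrow> (W, V) \<in> R\<^sup>*" if W: "W \<in> \<U>" "x \<in> W" for V W x
  proof
    assume "V \<in> c x"
    then obtain W' where W': "(W', V) \<in> R\<^sup>*" "W' \<in> \<U>" "x \<in> W'" unfolding c_def by blast
    then have "(W, W') \<in> R" using W by (auto simp: R_def)
    then show "(W, V) \<in> R\<^sup>*" using W'(1) by (rule converse_rtrancl_into_rtrancl)
  qed (use W in \<open>auto simp: c_def\<close>)
  have peq: "c y = c x" if x: "x \<in> topspace X" and y: "y \<in> p x" for x y
  proof -
    obtain W where W: "W \<in> c x" "y \<in> W" using y unfolding p_def by blast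
    obtain V where V: "V \<in> \<U>" "x \<in> V" using x cov unfolding cover_of_def by blast
    have "W \<in> \<U>" using W cU by blast
    have VW: "(V, W) \<in> R\<^sup>*" using W clink[OF V] by blast
    then have WV: "(W, V) \<in> R\<^sup>*" using symR by (meson symD)
    show ?thesis
    proof (intro set_eqI)
      show "Z \<in> c y \<longleftrightarrow> Z \<in> c x" for Z
        unfolding clink[OF V] clink[OF \<open>W \<in> \<U>\<close> W(2)]
        using rtrancl_trans[OF VW] rtrancl_trans[OF WV] by blast
    qed
  qed
  have ccount: "countable (c x)" if x: "x \<in> topspace X" for x
  proof -
    obtain V where V: "V \<in> \<U>" "x \<in> V" using x cov unfolding cover_of_def by blast
    have 1: "countable (R `` {W})" for W
    proof (cases "W \<in> \<U>")
      case True
      have "R `` {W} \<subseteq> {V\<in>\<U>. V \<inter> W \<noteq> {}}" by (auto simp: R_def)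
      then show ?thesis using sc True unfolding star_countable_def by (meson countable_subset)
    qed (auto simp: R_def Image_def)
    have 2: "countable (R `` Y)" if "countable Y" for Y
    proof -
      have "R `` Y = (\<Union>W\<in>Y. R `` {W})" by blast
      then show ?thesis using 1 that by simp
    qed
    have "countable (R\<^sup>* `` {V})"
      by (rule countable_rtrancl) (use 2 in auto)
    moreover have "c x = R\<^sup>* `` {V}" using clink[OF V] by blast
    ultimately show ?thesis by simp
  qed
  define G where "G k = (\<Union>x\<in>topspace X. from_nat_into (c x) k)" for k :: nat
  have cne: "c x \<noteq> {}" if "x \<in> topspace X" for x
    using px[OF that] unfolding p_def by blast
  have opc: "openin X V" if "V \<in> c x" for V x
    using that cU op by blast
  show thesis
  proof (rule that[of p G])
    show "openin X (p x)" for x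
      unfolding p_def using opc by blast
    show "openin X (G k)" for k
      unfolding G_def using opc from_nat_into[OF cne] by (intro openin_Union) auto
    show "\<exists>k. x \<in> G k \<and> G k \<inter> p x \<subseteq> U" if U: "U \<in> \<U>" "x \<in> U" for x U
    proof -
      have x: "x \<in> topspace X" using U cov unfolding cover_of_def by blast
      have "U \<in> c x" using U unfolding c_def by blast
      then obtain k where k: "from_nat_into (c x) k = U"
        using from_nat_into_surj[OF ccount[OF x]] by blast
      have "x \<in> G k" unfolding G_def using k U x by blast
      moreover have "G k \<inter> p x \<subseteq> U"
      proof
        fix z assume z: "z \<in> G k \<inter> p x"
        then obtain y where y: "y \<in> topspace X" "z \<in> from_nat_into (c y) k" unfolding G_def by blast
        then have "z \<in> p y" using from_nat_into[OF cne[OF y(1)]] unfolding p_def by blast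
        then have "c z = c y" "c z = c x" using peq y(1) x z by blast+
        then show "z \<in> U" using k y(2) by simp
      qed
      ultimately show ?thesis by blast
    qed
    show "p y = p x" if "x \<in> topspace X" "y \<in> p x" for x y
      using peq[OF that] by (simp add: p_def)
  qed (use px in auto)
qed

section \<open>Embedding into the product of countably many discrete spaces and real lines\<close>

lemma embedding_map_if_preimages_base:
  assumes cont: "continuous_map X Y f" and H: "Hausdorff_space X"
    and base: "\<And>W x. openin X W \<Longrightarrow> x \<in> W \<Longrightarrow>
      \<exists>V. openin Y V \<and> f x \<in> V \<and> (\<forall>y\<in>topspace X. f y \<in> V \<longrightarrow> y \<in> W)"
  shows "embedding_map X Y f"
proof -
  have inj: "inj_on f (topspace X)"
  proof (rule inj_onI, rule ccontr)
    fix x y assume xy: "x \<in> topspace X" "y \<in> topspace X" "f x = f y" "x \<noteq> y"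
    then obtain U V where "openin X U" "x \<in> U" "y \<in> V" "disjnt U V"
      using H unfolding Hausdorff_space_def by metis
    with base[of U x] xy show False by (auto simp: disjnt_iff)
  qed
  have open': "open_map X (subtopology Y (f ` topspace X)) f"
    unfolding open_map_def
  proof (intro allI impI)
    fix W assume W: "openin X W"
    define V where "V = \<Union>{V. openin Y V \<and> (\<forall>y\<in>topspace X. f y \<in> V \<longrightarrow> y \<in> W)}"
    have "openin Y V" unfolding V_def by (rule openin_Union) simp
    moreover have "f ` W = f ` topspace X \<inter> V"
    proof
      show "f ` W \<subseteq> f ` topspace X \<inter> V"
      proof
        fix z assume "z \<in> f ` W"
        then obtain x where x: "x \<in> W" "z = f x" by blast
        then have "x \<in> topspace X" using W openin_subset by blast
        then show "z \<in> f ` topspace X \<inter> V" using base[OF W x(1)] x unfolding V_def by blast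
      qed
      show "f ` topspace X \<inter> V \<subseteq> f ` W" unfolding V_def by blast
    qed
    ultimately show "openin (subtopology Y (f ` topspace X)) (f ` W)"
      by (metis openin_subtopology_Int2)
  qed
  have "continuous_map X (subtopology Y (f ` topspace X)) f"
    using cont by (simp add: continuous_map_in_subtopology)
  moreover have "f ` topspace X = topspace (subtopology Y (f ` topspace X))"
    using cont by (auto simp: continuous_map_def)
  ultimately show ?thesis
    unfolding embedding_map_def using inj open' by (metis bijective_open_imp_homeomorphic_map)
qed

text \<open>The space \<open>D\<^sup>\<omega> \<times> \<real>\<^sup>\<omega>\<close>.\<close>

abbreviation Baire_cube :: "'d set \<Rightarrow> ((nat \<Rightarrow> 'd) \<times> (nat \<Rightarrow> real)) topology"
  where "Baire_cube D \<equiv> prod_topology (product_topology (\<lambda>_. discrete_topology D) UNIV)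
                                     (product_topology (\<lambda>_. euclideanreal) UNIV)"

lemma embedding_into_Baire_cube:
  assumes H: "Hausdorff_space X" and normal: "normal_space X"
    and fsig: "\<And>U. openin X U \<Longrightarrow> fsigma_in X U"
    and base: "open_cover_base X \<U>" and sc: "\<And>n. star_countable (\<U> n)"
    and D: "\<And>P. open_partition X P \<Longrightarrow> P \<lesssim> D"
  obtains e where "embedding_map X (Baire_cube D) e"
proof -
  have "\<forall>n. \<exists>p G. (\<forall>x\<in>topspace X. x \<in> p x) \<and> (\<forall>x\<in>topspace X. \<forall>y\<in>p x. p y = p x)
      \<and> (\<forall>x. openin X (p x)) \<and> (\<forall>k::nat. openin X (G k))
      \<and> (\<forall>U\<in>\<U> n. \<forall>x\<in>U. \<exists>k. x \<in> G k \<and> G k \<inter> p x \<subseteq> U)"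
    (is "\<forall>n. \<exists>p G. ?Q n p G")
  proof
    fix n
    have 1: "cover_of (topspace X) (\<U> n)" "\<And>U. U \<in> \<U> n \<Longrightarrow> openin X U"
      using base unfolding open_cover_base_def by blast+
    show "\<exists>p G. ?Q n p G"
    proof (rule star_countable_components[OF sc 1])
      show "V \<in> \<U> n \<Longrightarrow> V \<in> \<U> n" for V .
      fix p :: "'a \<Rightarrow> 'a set" and G :: "nat \<Rightarrow> 'a set"
      assume "\<And>x. x \<in> topspace X \<Longrightarrow> x \<in> p x"
        "\<And>x y. x \<in> topspace X \<Longrightarrow> y \<in> p x \<Longrightarrow> p y = p x"
        "\<And>x. openin X (p x)" "\<And>k. openin X (G k)"
        "\<And>x U. U \<in> \<U> n \<Longrightarrow> x \<in> U \<Longrightarrow> \<exists>k. x \<in> G k \<and> G k \<inter> p x \<subseteq> U"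
      then have "?Q n p G" by blast
      then show ?thesis by (intro exI)
    qed
  qed
  from choice[OF this] obtain p where "\<forall>n. \<exists>G. ?Q n (p n) G" ..
  from choice[OF this] obtain G where "\<forall>n. ?Q n (p n) (G n)" ..
  then have p: "\<And>n x. x \<in> topspace X \<Longrightarrow> x \<in> p n x"
    "\<And>n x y. x \<in> topspace X \<Longrightarrow> y \<in> p n x \<Longrightarrow> p n y = p n x"
    "\<And>n x. openin X (p n x)" "\<And>n k. openin X (G n k)"
    "\<And>n U x. U \<in> \<U> n \<Longrightarrow> x \<in> U \<Longrightarrow> \<exists>k. x \<in> G n k \<and> G n k \<inter> p n x \<subseteq> U"
    by blast+
  have part: "open_partition X (p n ` topspace X)" for n
  proof -
    have "\<Union>(p n ` topspace X) = topspace X"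
      using p(1)[where n = n] openin_subset[OF p(3)[where n = n]] by blast
    moreover have "disjoint (p n ` topspace X)"
    proof (rule disjointI)
      fix A B assume "A \<in> p n ` topspace X" "B \<in> p n ` topspace X" "A \<noteq> B"
      then obtain x y where xy: "x \<in> topspace X" "y \<in> topspace X" "A = p n x" "B = p n y"
        by blast
      show "A \<inter> B = {}"
      proof (rule ccontr)
        assume "A \<inter> B \<noteq> {}"
        then obtain z where "z \<in> p n x" "z \<in> p n y" using xy by blast
        then have "p n z = p n x" "p n z = p n y" using p(2) xy by blast+
        then show False using xy \<open>A \<noteq> B\<close> by simp
      qed
    qed
    moreover have "{} \<notin> p n ` topspace X" using p(1)[where n = n] by auto
    ultimately show ?thesis
      unfolding open_partition_def partition_on_def using p(3) by auto
  qed
  then have "\<forall>n. \<exists>i. inj_on i (p n ` topspace X) \<and> i ` (p n ` topspace X) \<subseteq> D"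
    using D[OF part] unfolding lepoll_def by simp
  from choice[OF this] obtain i where
    "\<forall>n. inj_on (i n) (p n ` topspace X) \<and> i n ` (p n ` topspace X) \<subseteq> D" ..
  then have i: "\<And>n. inj_on (i n) (p n ` topspace X)" "\<And>n x. x \<in> topspace X \<Longrightarrow> i n (p n x) \<in> D"
    by (simp_all add: image_subset_iff)
  have "\<forall>n k. \<exists>C. (\<forall>j::nat. closedin X (C j)) \<and> \<Union>(range C) = G n k"
  proof (intro allI)
    show "\<exists>C. (\<forall>j::nat. closedin X (C j)) \<and> \<Union>(range C) = G n k" for n k
      using fsig[OF p(4)[of n k]] unfolding fsigma_in_ascending by blast
  qed
  from this[unfolded choice_iff] obtain C where
    "\<forall>n k. (\<forall>j::nat. closedin X (C n k j)) \<and> \<Union>(range (C n k)) = G n k" ..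
  then have C: "\<And>n k j::nat. closedin X (C n k j)" "\<And>n k. \<Union>(range (C n k)) = G n k"
    by simp_all
  \<comment> \<open>The closed sets \<open>C n k j\<close> exhaust \<open>G n k\<close>, so \<open>G n k\<close> is the union over \<open>j\<close> of the sets where
    the function separating \<open>C n k j\<close> from the complement of \<open>G n k\<close> is positive.\<close>
  have "\<forall>n k j. \<exists>g. continuous_map X euclideanreal g \<and> g ` (topspace X - G n k) \<subseteq> {0} \<and> g ` C n k j \<subseteq> {1}"
  proof (intro allI)
    fix n k j
    have "disjnt (topspace X - G n k) (C n k j)" using C(2)[of n k] by (auto simp: disjnt_iff)
    then show "\<exists>g. continuous_map X euclideanreal g \<and> g ` (topspace X - G n k) \<subseteq> {0} \<and> g ` C n k j \<subseteq> {1}"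
      using Urysohn_lemma_alt[OF normal _ C(1), of "topspace X - G n k" n k j 0 1]
        closedin_diff[OF closedin_topspace p(4)] by metis
  qed
  from this[unfolded choice_iff] obtain g where
    "\<forall>n k j. continuous_map X euclideanreal (g n k j) \<and>
      g n k j ` (topspace X - G n k) \<subseteq> {0} \<and> g n k j ` C n k j \<subseteq> {1}" ..
  then have g: "\<And>n k j. continuous_map X euclideanreal (g n k j)"
     "\<And>n k j. g n k j ` (topspace X - G n k) \<subseteq> {0}" "\<And>n k j. g n k j ` C n k j \<subseteq> {1}"
    by simp_all
  \<comment> \<open>All the functions \<open>g n k j\<close> are arranged in one sequence, the real coordinates.\<close>
  define h where "h t = g (fst (prod_decode t)) (fst (prod_decode (snd (prod_decode t))))
      (snd (prod_decode (snd (prod_decode t))))" for t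
  define e where "e x = (\<lambda>n. i n (p n x), \<lambda>t. h t x)" for x
  have pc: "continuous_map X (discrete_topology D) (\<lambda>x. i n (p n x))" for n
    unfolding continuous_map_def
  proof (intro conjI allI impI)
    fix U assume "openin (discrete_topology D) U"
    show "openin X {x \<in> topspace X. i n (p n x) \<in> U}"
    proof (subst openin_subopen, intro ballI)
      fix x assume x: "x \<in> {x \<in> topspace X. i n (p n x) \<in> U}"
      have "p n x \<subseteq> {x \<in> topspace X. i n (p n x) \<in> U}"
      proof
        fix y assume y: "y \<in> p n x"
        then have "p n y = p n x" using p(2) x by blast
        moreover have "y \<in> topspace X" using y openin_subset[OF p(3)] by blast
        ultimately show "y \<in> {x \<in> topspace X. i n (p n x) \<in> U}" using x by simp
      qed
      moreover have "x \<in> p n x" using x p(1) by blast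
      ultimately show "\<exists>T. openin X T \<and> x \<in> T \<and> T \<subseteq> {x \<in> topspace X. i n (p n x) \<in> U}"
        using p(3) by blast
    qed
  qed (use i in auto)
  have hc: "continuous_map X euclideanreal (h t)" for t
    unfolding h_def by (rule g)
  have cont: "continuous_map X (Baire_cube D) e"
    unfolding e_def using pc hc
    by (auto simp: continuous_map_pairwise o_def continuous_map_componentwise_UNIV)
  have "embedding_map X (Baire_cube D) e"
  proof (rule embedding_map_if_preimages_base[OF cont H])
    fix W x assume W: "openin X W" "x \<in> W"
    then have "\<exists>n. \<exists>U\<in>\<U> n. x \<in> U \<and> U \<subseteq> W"
      using base unfolding open_cover_base_def by simp
    then obtain n U where U: "U \<in> \<U> n" "x \<in> U" "U \<subseteq> W" by blast
    obtain k where k: "x \<in> G n k" "G n k \<inter> p n x \<subseteq> U" using p(5)[OF U(1,2)] by blast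
    obtain j where j: "x \<in> C n k j" using k(1) C(2) by blast
    define t where "t = prod_encode (n, prod_encode (k, j))"
    have ht: "h t = g n k j" by (simp add: h_def t_def)
    have x: "x \<in> topspace X" using W openin_subset[OF W(1)] by blast
    let ?V = "{z \<in> topspace (Baire_cube D). fst z n \<in> {i n (p n x)} \<and> snd z t \<in> {0<..}}"
    have "openin (Baire_cube D) ?V"
    proof -
      have 1: "continuous_map (Baire_cube D) (discrete_topology D) (\<lambda>z. fst z n)"
        using continuous_map_compose[OF continuous_map_fst continuous_map_product_projection[of n UNIV]]
        by (simp add: o_def)
      have 2: "continuous_map (Baire_cube D) euclideanreal (\<lambda>z. snd z t)"
        using continuous_map_compose[OF continuous_map_snd continuous_map_product_projection[of t UNIV]]
        by (simp add: o_def)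
      have "openin (Baire_cube D) {z \<in> topspace (Baire_cube D). fst z n \<in> {i n (p n x)}}"
        by (rule openin_continuous_map_preimage[OF 1]) (use i x in auto)
      moreover have "openin (Baire_cube D) {z \<in> topspace (Baire_cube D). snd z t \<in> {0<..}}"
        by (rule openin_continuous_map_preimage[OF 2]) auto
      ultimately have "openin (Baire_cube D) ({z \<in> topspace (Baire_cube D). fst z n \<in> {i n (p n x)}} \<inter>
          {z \<in> topspace (Baire_cube D). snd z t \<in> {0<..}})"
        by (rule openin_Int)
      then show ?thesis by (rule back_subst[of "openin (Baire_cube D)"]) blast
    qed
    moreover have "e x \<in> ?V"
    proof -
      have "e x \<in> topspace (Baire_cube D)"
        using cont x by (auto simp: continuous_map_def)
      moreover have "h t x = 1" using g(3)[of n k j] j ht by auto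
      ultimately show ?thesis by (simp add: e_def)
    qed
    moreover have "y \<in> W" if y: "y \<in> topspace X" "e y \<in> ?V" for y
    proof -
      have "i n (p n y) = i n (p n x)" "h t y > 0" using y by (auto simp: e_def)
      then have "p n y = p n x" "y \<in> G n k"
        using inj_onD[OF i(1)] x y(1) g(2)[of n k j] ht by (blast, fastforce)
      then have "y \<in> G n k \<inter> p n x" using p(1)[OF y(1), of n] by simp
      then show "y \<in> W" using k U by blast
    qed
    ultimately show "\<exists>V. openin (Baire_cube D) V \<and> e x \<in> V \<and> (\<forall>y\<in>topspace X. e y \<in> V \<longrightarrow> y \<in> W)"
      by (intro exI[of _ ?V] conjI ballI impI)
  qed
  then show thesis by (rule that)
qed

section \<open>Completeness, normality and Cech-completeness\<close>

lemma openin_mtopology_of: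
  "openin (mtopology_of m) U \<longleftrightarrow> U \<subseteq> mspace m \<and> (\<forall>x\<in>U. \<exists>r>0. mball_of m x r \<subseteq> U)"
  unfolding mtopology_of_def mball_of_def
  by (subst Metric_space.openin_mtopology) auto

lemma openin_mball_of: "openin (mtopology_of m) (mball_of m x r)"
  unfolding mtopology_of_def mball_of_def by (rule Metric_space.openin_mball) auto

lemma metrizable_space_mtopology_of: "metrizable_space (mtopology_of m)"
  unfolding mtopology_of_def by (rule Metric_space.metrizable_space_mtopology) auto

lemma mdist_refl: "x \<in> mspace m \<Longrightarrow> mdist m x x = 0"
  by simp

lemma embedding_map_imp_continuous_map: "embedding_map X Y f \<Longrightarrow> continuous_map X Y f"
  by (metis continuous_map_in_subtopology embedding_map_def homeomorphic_imp_continuous_map)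

lemma mcomplete_of_limit:
  assumes "mcomplete_of m" and x: "\<And>n::nat. x n \<in> mspace m"
    and cauchy: "\<And>\<epsilon>. \<epsilon> > 0 \<Longrightarrow> \<exists>N. \<forall>k\<ge>N. \<forall>l\<ge>N. mdist m (x k) (x l) < \<epsilon>"
  shows "\<exists>l\<in>mspace m. \<forall>\<epsilon>>0. \<exists>N. \<forall>k\<ge>N. mdist m (x k) l < \<epsilon>"
proof -
  interpret Metric_space "mspace m" "mdist m" by simp
  have "MCauchy x" unfolding MCauchy_def using x cauchy by blast
  then obtain l where "limitin mtopology x l sequentially"
    using assms(1) unfolding mcomplete_of_def mcomplete_def by blast
  then show ?thesis
    unfolding limitin_metric eventually_sequentially by meson
qed

lemma embedding_map_openin:
  assumes e: "embedding_map X Y f" and U: "openin X U"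
  obtains W where "openin Y W" "\<And>x. x \<in> topspace X \<Longrightarrow> f x \<in> W \<longleftrightarrow> x \<in> U"
proof -
  have h: "homeomorphic_map X (subtopology Y (f ` topspace X)) f"
    using e by (simp add: embedding_map_def)
  have "openin (subtopology Y (f ` topspace X)) (f ` U)"
    using homeomorphic_map_openness_eq[OF h] U by blast
  then obtain W where W: "openin Y W" "f ` U = W \<inter> f ` topspace X"
    unfolding openin_subtopology by blast
  have inj: "inj_on f (topspace X)" using h by (simp add: homeomorphic_map_def)
  have "f x \<in> W \<longleftrightarrow> x \<in> U" if x: "x \<in> topspace X" for x
  proof
    assume "f x \<in> W"
    then obtain y where "y \<in> U" "f x = f y" using W(2) x by blast
    then show "x \<in> U" using inj_onD[OF inj _ x, of y] openin_subset[OF U] by blast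
  qed (use W(2) in blast)
  with W(1) show thesis by (rule that)
qed

text \<open>A star-finite open cover is locally finite, so the closure of a union of members is the union of
  their closures.\<close>

lemma closure_subset_openin_of_star_finite:
  assumes op: "\<And>U. U \<in> \<U> \<Longrightarrow> openin X U" and cov: "cover_of (topspace X) \<U>" and sf: "star_finite \<U>"
  shows "X closure_of \<Union>{U\<in>\<U>. X closure_of U \<subseteq> T} \<subseteq> T"
proof
  fix x assume x: "x \<in> X closure_of \<Union>{U\<in>\<U>. X closure_of U \<subseteq> T}"
  then have "x \<in> topspace X" by (simp add: in_closure_of)
  then obtain U0 where U0: "U0 \<in> \<U>" "x \<in> U0" using cov unfolding cover_of_def by blast
  define F where "F = {U\<in>\<U>. U \<inter> U0 \<noteq> {} \<and> X closure_of U \<subseteq> T}"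
  have "finite {U\<in>\<U>. U \<inter> U0 \<noteq> {}}" using sf U0(1) unfolding star_finite_def by simp
  then have "finite F" unfolding F_def by (rule rev_finite_subset) blast
  have "x \<in> X closure_of (\<Union>F)"
    unfolding in_closure_of
  proof (intro conjI allI impI)
    fix W assume W: "x \<in> W \<and> openin X W"
    then have "openin X (W \<inter> U0)" "x \<in> W \<inter> U0" using op U0 by auto
    then obtain z where z: "z \<in> W \<inter> U0" "z \<in> \<Union>{U\<in>\<U>. X closure_of U \<subseteq> T}"
      using x unfolding in_closure_of by blast
    then show "\<exists>y. y \<in> \<Union>F \<and> y \<in> W" unfolding F_def by blast
  qed fact
  then have "x \<in> (\<Union>U\<in>F. X closure_of U)" by (simp add: closure_of_Union \<open>finite F\<close>)
  then show "x \<in> T" unfolding F_def by blast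
qed

lemma regular_star_finite_base_open_sigma_closure:
  assumes "regular_space X" and base: "open_cover_base X \<U>" and sf: "\<And>n. star_finite (\<U> n)"
    and T: "openin X T"
  shows "\<exists>W. (\<forall>n::nat. openin X (W n) \<and> X closure_of W n \<subseteq> T) \<and> \<Union>(range W) = T"
proof -
  define W where "W n = \<Union>{U\<in>\<U> n. X closure_of U \<subseteq> T}" for n
  have op: "openin X U" if "U \<in> \<U> n" for n U using base that by (simp add: open_cover_base_def)
  have cov: "cover_of (topspace X) (\<U> n)" for n using base by (simp add: open_cover_base_def)
  have W: "openin X (W n)" for n unfolding W_def using op by auto
  moreover have cl: "X closure_of W n \<subseteq> T" for n
    unfolding W_def by (rule closure_subset_openin_of_star_finite[OF op cov sf])
  moreover have "\<Union>(range W) = T"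
  proof
    show "\<Union>(range W) \<subseteq> T" using cl closure_of_subset[OF openin_subset[OF W]] by blast
    show "T \<subseteq> \<Union>(range W)"
    proof
      fix x assume x: "x \<in> T"
      then obtain O' C where O: "openin X O'" "closedin X C" "x \<in> O'" "O' \<subseteq> C" "C \<subseteq> T"
        using assms(1) T unfolding neighbourhood_base_of_closedin[symmetric] neighbourhood_base_of by metis
      then obtain n U where U: "U \<in> \<U> n" "x \<in> U" "U \<subseteq> O'"
        using base unfolding open_cover_base_def by meson
      have "X closure_of U \<subseteq> T"
        using closure_of_minimal[OF _ O(2)] U(3) O(4,5) by blast
      then show "x \<in> \<Union>(range W)" unfolding W_def using U by blast
    qed
  qed
  ultimately show ?thesis by (intro exI[of _ W]) simp
qed

text \<open>This is the argument showing that regular Lindelof spaces are normal.\<close>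

lemma normal_space_if_open_sigma_closure:
  assumes sig: "\<And>T. openin X T \<Longrightarrow>
    \<exists>W. (\<forall>n::nat. openin X (W n) \<and> X closure_of W n \<subseteq> T) \<and> \<Union>(range W) = T"
  shows "normal_space X"
  unfolding normal_space_def
proof (intro allI impI)
  fix S T assume ST: "closedin X S \<and> closedin X T \<and> disjnt S T"
  have "openin X (topspace X - T)" "openin X (topspace X - S)" using ST by auto
  from sig[OF this(1)] sig[OF this(2)] obtain W V where
    "(\<forall>n::nat. openin X (W n) \<and> X closure_of W n \<subseteq> topspace X - T) \<and> \<Union>(range W) = topspace X - T"
    "(\<forall>n::nat. openin X (V n) \<and> X closure_of V n \<subseteq> topspace X - S) \<and> \<Union>(range V) = topspace X - S"
    by (elim exE)
  then have W: "\<And>n. openin X (W n)" "\<And>n. X closure_of W n \<subseteq> topspace X - T"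
      "\<Union>(range W) = topspace X - T"
    and V: "\<And>n. openin X (V n)" "\<And>n. X closure_of V n \<subseteq> topspace X - S"
      "\<Union>(range V) = topspace X - S"
    by simp_all
  define A where "A n = W n - (\<Union>k\<le>n. X closure_of V k)" for n
  define B where "B n = V n - (\<Union>k\<le>n. X closure_of W k)" for n
  have "closedin X (\<Union>k\<le>n. X closure_of V k)" "closedin X (\<Union>k\<le>n. X closure_of W k)" for n
    by (auto intro!: closedin_Union)
  then have "openin X (A n)" "openin X (B n)" for n
    unfolding A_def B_def using W(1) V(1) by (auto intro: openin_diff)
  then have 1: "openin X (\<Union>n. A n)" "openin X (\<Union>n. B n)" by auto
  have 2: "S \<subseteq> (\<Union>n. A n)"
  proof
    fix x assume x: "x \<in> S"
    then have "x \<in> topspace X - T" using ST closedin_subset[of X S] by (auto simp: disjnt_iff)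
    then obtain n where "x \<in> W n" using W(3) by blast
    then show "x \<in> (\<Union>n. A n)" using V(2) x unfolding A_def by blast
  qed
  have 3: "T \<subseteq> (\<Union>n. B n)"
  proof
    fix x assume x: "x \<in> T"
    then have "x \<in> topspace X - S" using ST closedin_subset[of X T] by (auto simp: disjnt_iff)
    then obtain n where "x \<in> V n" using V(3) by blast
    then show "x \<in> (\<Union>n. B n)" using W(2) x unfolding B_def by blast
  qed
  have "A m \<inter> B n = {}" for m n
  proof (rule ccontr)
    assume "A m \<inter> B n \<noteq> {}"
    then obtain x where x: "x \<in> W m" "x \<in> V n" "\<And>k. k \<le> m \<Longrightarrow> x \<notin> X closure_of V k"
      "\<And>k. k \<le> n \<Longrightarrow> x \<notin> X closure_of W k"
      unfolding A_def B_def by blast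
    have "x \<in> X closure_of V n" "x \<in> X closure_of W m"
      using x(1,2) closure_of_subset[OF openin_subset[OF V(1)]] closure_of_subset[OF openin_subset[OF W(1)]]
      by blast+
    then show False using x(3)[of n] x(4)[of m] by linarith
  qed
  then have "disjnt (\<Union>n. A n) (\<Union>n. B n)" by (auto simp: disjnt_def)
  then show "\<exists>U V. openin X U \<and> openin X V \<and> S \<subseteq> U \<and> T \<subseteq> V \<and> disjnt U V"
    using 1 2 3 by blast
qed

lemma fsigma_in_if_open_sigma_closure:
  assumes "\<exists>W. (\<forall>n::nat. openin X (W n) \<and> X closure_of W n \<subseteq> T) \<and> \<Union>(range W) = T"
  shows "fsigma_in X T"
proof -
  from assms obtain W where
    "(\<forall>n::nat. openin X (W n) \<and> X closure_of W n \<subseteq> T) \<and> \<Union>(range W) = T" ..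
  then have W: "\<And>n. openin X (W n)" "\<And>n. X closure_of W n \<subseteq> T" "\<Union>(range W) = T"
    by simp_all
  have "T = (\<Union>n. X closure_of W n)"
    using W(2,3) closure_of_subset[OF openin_subset[OF W(1)]] by blast
  moreover have "fsigma_in X (\<Union>n. X closure_of W n)"
    by (rule fsigma_in_Union) (auto intro: closed_imp_fsigma_in)
  ultimately show ?thesis by simp
qed

text \<open>Write \<open>X\<close> as the intersection of open sets \<open>H n\<close> of the Stone--Cech compactification. A point \<open>p\<close> of the
  closure of \<open>X\<close> in \<open>P\<close> belongs to \<open>X\<close> as soon as, for every \<open>n\<close>, some neighbourhood of \<open>p\<close> has a trace
  on \<open>X\<close> whose closure in the compactification lies in \<open>H n\<close>: by compactness the closures of all the traces
  have a common point, which lies in \<open>X\<close> and cannot differ from \<open>p\<close>.\<close>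

lemma gdelta_in_embedding_Cech_complete:
  assumes X: "completely_regular_space X" "Hausdorff_space X" and "Cech_complete X"
    and P: "metrizable_space P" and e: "embedding_map X P e"
  shows "gdelta_in P (e ` topspace X)"
proof -
  define K where "K = Stone_Cech X"
  define s where "s = Stone_Cech_map X"
  have K: "compact_space K" "Hausdorff_space K"
    unfolding K_def by (rule compact_Hausdorff_Stone_Cech)+
  have s: "embedding_map X K s"
    unfolding K_def s_def by (rule embedding_map_Stone_Cech[OF X])
  have scont: "continuous_map X K s" and econt: "continuous_map X P e"
    using s e by (simp_all add: embedding_map_imp_continuous_map)
  obtain H where H: "\<And>n::nat. openin K (H n)" "\<Inter>(range H) = s ` topspace X"
    using assms(3) unfolding Cech_complete_def gdelta_in_descending K_def s_def by blast
  define T where "T W = K closure_of (s ` {x\<in>topspace X. e x \<in> W})" for W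
  define G where "G n = \<Union>{W. openin P W \<and> T W \<subseteq> H n}" for n
  have Gop: "openin P (G n)" for n unfolding G_def by (rule openin_Union) simp
  have sub: "e ` topspace X \<subseteq> topspace P"
    using econt by (auto simp: continuous_map_def)
  have "e ` topspace X = P closure_of (e ` topspace X) \<inter> \<Inter>(range G)"
  proof
    have "e x \<in> G n" if x: "x \<in> topspace X" for x n
    proof -
      have "s x \<in> H n" using H(2) x by blast
      then obtain V C where V: "openin K V" "closedin K C" "s x \<in> V" "V \<subseteq> C" "C \<subseteq> H n"
        using compact_Hausdorff_imp_regular_space[OF K] H(1)
        unfolding neighbourhood_base_of_closedin[symmetric] neighbourhood_base_of by metis
      have "openin X {y\<in>topspace X. s y \<in> V}"
        by (rule openin_continuous_map_preimage[OF scont V(1)])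
      then obtain W where W: "openin P W" "\<And>y. y \<in> topspace X \<Longrightarrow> e y \<in> W \<longleftrightarrow> y \<in> {y\<in>topspace X. s y \<in> V}"
        using embedding_map_openin[OF e] by blast
      have "s ` {y\<in>topspace X. e y \<in> W} \<subseteq> C"
        using W(2) V(4) by blast
      then have "T W \<subseteq> H n"
        unfolding T_def using closure_of_minimal[OF _ V(2)] V(5) by blast
      then show ?thesis unfolding G_def using W x V(3) by blast
    qed
    then show "e ` topspace X \<subseteq> P closure_of (e ` topspace X) \<inter> \<Inter>(range G)"
      using closure_of_subset[OF sub] by blast
  next
    show "P closure_of (e ` topspace X) \<inter> \<Inter>(range G) \<subseteq> e ` topspace X"
    proof
      fix p assume p: "p \<in> P closure_of (e ` topspace X) \<inter> \<Inter>(range G)"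
      define \<C> where "\<C> = T ` {W. openin P W \<and> p \<in> W}"
      have "\<Inter>\<C> \<noteq> {}"
      proof -
        have "\<Inter>\<F> \<noteq> {}" if F: "finite \<F> \<and> \<F> \<subseteq> \<C>" for \<F>
        proof -
          obtain \<W> where \<W>: "finite \<W>" "\<W> \<subseteq> {W. openin P W \<and> p \<in> W}" "\<F> = T ` \<W>"
            using F unfolding \<C>_def by (meson finite_subset_image)
          define W where "W = topspace P \<inter> \<Inter>\<W>"
          have "openin P W" unfolding W_def using \<W>(1,2) by (intro openin_Int_Inter) auto
          moreover have "p \<in> W"
            unfolding W_def using \<W>(2) p by (auto simp: in_closure_of)
          ultimately have "\<exists>y. y \<in> e ` topspace X \<and> y \<in> W"
            using p by (simp add: in_closure_of)
          then obtain x where x: "x \<in> topspace X" "e x \<in> W" by blast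
          have "s x \<in> T V" if "V \<in> \<W>" for V
          proof -
            have "s ` {x\<in>topspace X. e x \<in> V} \<subseteq> topspace K"
              using scont by (auto simp: continuous_map_def)
            from closure_of_subset[OF this] show ?thesis
              unfolding T_def using x that W_def by blast
          qed
          then show ?thesis using \<W>(3) by blast
        qed
        moreover have "\<forall>C\<in>\<C>. closedin K C" unfolding \<C>_def T_def by simp
        ultimately show ?thesis using K(1)[unfolded compact_space_fip, rule_format, of \<C>] by simp
      qed
      then obtain q where "q \<in> \<Inter>\<C>" by (auto simp del: Inter_iff)
      then have q: "\<And>W. openin P W \<Longrightarrow> p \<in> W \<Longrightarrow> q \<in> T W" unfolding \<C>_def by simp
      have "q \<in> H n" for n
      proof -
        have "p \<in> G n" using p by blast
        then obtain W where "openin P W" "T W \<subseteq> H n" "p \<in> W" unfolding G_def by blast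
        then show ?thesis using q by blast
      qed
      then have "q \<in> \<Inter>(range H)" by blast
      then obtain x where x: "x \<in> topspace X" "q = s x" unfolding H(2) by blast
      have "p = e x"
      proof (rule ccontr)
        assume "p \<noteq> e x"
        moreover have "p \<in> topspace P" "e x \<in> topspace P"
          using p sub x by (auto simp: in_closure_of)
        ultimately obtain U V where UV: "openin P U" "openin P V" "p \<in> U" "e x \<in> V" "disjnt U V"
          using metrizable_imp_Hausdorff_space[OF P] unfolding Hausdorff_space_def by metis
        have "openin X {y\<in>topspace X. e y \<in> V}"
          by (rule openin_continuous_map_preimage[OF econt UV(2)])
        then obtain W where W: "openin K W" "\<And>y. y \<in> topspace X \<Longrightarrow> s y \<in> W \<longleftrightarrow> y \<in> {y\<in>topspace X. e y \<in> V}"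
          using embedding_map_openin[OF s] by blast
        have "s x \<in> W" using W(2) x UV(4) by blast
        moreover have "s x \<in> K closure_of (s ` {y\<in>topspace X. e y \<in> U})"
          using q[OF UV(1,3)] x unfolding T_def by simp
        ultimately obtain y where "y \<in> topspace X" "e y \<in> U" "s y \<in> W"
          using W(1) unfolding in_closure_of by blast
        then show False using W(2) UV(5) by (auto simp: disjnt_iff)
      qed
      then show "p \<in> e ` topspace X" using x by blast
    qed
  qed
  moreover have "gdelta_in P (P closure_of (e ` topspace X) \<inter> \<Inter>(range G))"
  proof (rule gdelta_in_Int)
    show "gdelta_in P (P closure_of (e ` topspace X))" by (rule closed_imp_gdelta_in[OF P]) simp
    show "gdelta_in P (\<Inter>(range G))"
      by (rule gdelta_in_Inter) (use Gop in \<open>auto intro: open_imp_gdelta_in\<close>)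
  qed
  ultimately show ?thesis by simp
qed

text \<open>The set \<open>G n\<close> consists of the points of the compactification with a neighbourhood in whose trace on
  \<open>X\<close> any two points have distance less than \<open>1 / Suc n\<close>. A point of all the \<open>G n\<close> determines a Cauchy
  sequence in \<open>X\<close>, and coincides with its limit.\<close>

lemma Cech_complete_if_mcomplete_of:
  assumes m: "mtopology_of m = X" and compl: "mcomplete_of m"
    and X: "completely_regular_space X" "Hausdorff_space X"
  shows "Cech_complete X"
proof -
  define K where "K = Stone_Cech X"
  define s where "s = Stone_Cech_map X"
  have K: "Hausdorff_space K"
    unfolding K_def by (rule compact_Hausdorff_Stone_Cech)
  have s: "embedding_map X K s"
    unfolding K_def s_def by (rule embedding_map_Stone_Cech[OF X])
  have scont: "continuous_map X K s"
    using s by (rule embedding_map_imp_continuous_map)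
  have dense: "K closure_of (s ` topspace X) = topspace K"
    unfolding K_def s_def by (rule dense_Stone_Cech)
  have top: "topspace X = mspace m" using m by auto
  define G where "G n = \<Union>{W. openin K W \<and>
      (\<forall>x\<in>mspace m. \<forall>y\<in>mspace m. s x \<in> W \<longrightarrow> s y \<in> W \<longrightarrow> mdist m x y < 1 / Suc n)}" for n :: nat
  have Gop: "openin K (G n)" for n unfolding G_def by (rule openin_Union) simp
  have "s ` topspace X = \<Inter>(range G)"
  proof
    have "s x \<in> G n" if x: "x \<in> mspace m" for x n
    proof -
      let ?r = "1 / (2 * real (Suc n))"
      have "openin X (mball_of m x ?r)" using openin_mball_of m by metis
      then obtain W where W: "openin K W" "\<And>y. y \<in> topspace X \<Longrightarrow> s y \<in> W \<longleftrightarrow> y \<in> mball_of m x ?r"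
        using embedding_map_openin[OF s] by blast
      have "mdist m y z < 1 / Suc n" if "y \<in> mspace m" "z \<in> mspace m" "s y \<in> W" "s z \<in> W" for y z
      proof -
        have "mdist m x y < ?r" "mdist m x z < ?r" using that W(2) top by auto
        moreover have "mdist m y z \<le> mdist m y x + mdist m x z" using that x by (intro mdist_triangle)
        moreover have "1 / Suc n = ?r + ?r" by (simp add: field_simps)
        ultimately show ?thesis by (simp only: mdist_commute[of m y x])
      qed
      moreover have "s x \<in> W" using W(2)[of x] x top by (simp add: mdist_refl)
      ultimately show ?thesis unfolding G_def using W(1) by blast
    qed
    then show "s ` topspace X \<subseteq> \<Inter>(range G)" using top by blast
  next
    show "\<Inter>(range G) \<subseteq> s ` topspace X"
    proof
      fix p assume p: "p \<in> \<Inter>(range G)"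
      then have "\<forall>n. \<exists>W. openin K W \<and> p \<in> W \<and>
         (\<forall>x\<in>mspace m. \<forall>y\<in>mspace m. s x \<in> W \<longrightarrow> s y \<in> W \<longrightarrow> mdist m x y < 1 / Suc n)"
        unfolding G_def by blast
      from choice[OF this] obtain W where W: "\<And>n::nat. openin K (W n)" "\<And>n. p \<in> W n"
        "\<And>n x y. x \<in> mspace m \<Longrightarrow> y \<in> mspace m \<Longrightarrow> s x \<in> W n \<Longrightarrow> s y \<in> W n \<Longrightarrow> mdist m x y < 1 / Suc n"
        by auto
      have pK: "p \<in> topspace K" using W(2)[of 0] openin_subset[OF W(1)] by blast
      have meets: "\<exists>x\<in>mspace m. s x \<in> V" if "openin K V" "p \<in> V" for V
      proof -
        have "p \<in> K closure_of (s ` mspace m)" using pK dense top by simp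
        then show ?thesis using that unfolding in_closure_of by blast
      qed
      have "\<exists>x\<in>mspace m. s x \<in> (\<Inter>k\<le>n. W k)" for n
        by (rule meets) (use W(1,2) in auto)
      then obtain x where x: "\<And>n. x n \<in> mspace m" "\<And>n k. k \<le> n \<Longrightarrow> s (x n) \<in> W k"
        by (metis INT_E atMost_iff)
      have close: "mdist m (x k) y < 1 / Suc n" if "n \<le> k" "y \<in> mspace m" "s y \<in> W n" for n k y
        using W(3) x that by blast
      have cauchy: "\<exists>N. \<forall>k\<ge>N. \<forall>l\<ge>N. mdist m (x k) (x l) < \<epsilon>" if \<epsilon>: "\<epsilon> > 0" for \<epsilon> :: real
      proof -
        obtain N where N: "1 / Suc N < \<epsilon>" using nat_approx_posE[OF \<epsilon>] by blast
        then have "mdist m (x k) (x l) < \<epsilon>" if "k \<ge> N" "l \<ge> N" for k l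
          using close[OF that(1) x(1) x(2)[OF that(2)]] by linarith
        then show ?thesis by blast
      qed
      obtain l where l: "l \<in> mspace m" "\<And>\<epsilon>. \<epsilon> > 0 \<Longrightarrow> \<exists>N. \<forall>k\<ge>N. mdist m (x k) l < \<epsilon>"
        using mcomplete_of_limit[OF compl x(1) cauchy] by blast
      have "p = s l"
      proof (rule ccontr)
        assume "p \<noteq> s l"
        moreover have "s l \<in> topspace K" using scont l(1) top by (auto simp: continuous_map_def)
        ultimately obtain U V where UV: "openin K U" "openin K V" "p \<in> U" "s l \<in> V" "disjnt U V"
          using K pK unfolding Hausdorff_space_def by metis
        have "openin X {y\<in>topspace X. s y \<in> V}"
          by (rule openin_continuous_map_preimage[OF scont UV(2)])
        then obtain r where r: "r > 0" "mball_of m l r \<subseteq> {y\<in>topspace X. s y \<in> V}"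
          using UV(4) l(1) top unfolding m[symmetric] openin_mtopology_of by auto
        obtain n where n: "1 / Suc n < r / 2" using nat_approx_posE[of "r/2"] r(1) by auto
        obtain N where N: "\<And>k. k \<ge> N \<Longrightarrow> mdist m (x k) l < r / 2" using l(2)[of "r/2"] r(1) by auto
        obtain y where y: "y \<in> mspace m" "s y \<in> U \<inter> W n"
          using meets[of "U \<inter> W n"] UV(1,3) W(1,2) by auto
        have "mdist m l y \<le> mdist m l (x (max n N)) + mdist m (x (max n N)) y"
          using l(1) x(1) y(1) by (intro mdist_triangle)
        moreover have "mdist m (x (max n N)) y < r / 2"
          using close[of n "max n N" y] y n by auto
        moreover have "mdist m l (x (max n N)) < r / 2"
          using N[of "max n N"] by (simp add: mdist_commute)
        ultimately have "y \<in> mball_of m l r" using l(1) y(1) by simp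
        then have "s y \<in> V" using r(2) by blast
        then show False using y UV(5) by (auto simp: disjnt_iff)
      qed
      then show "p \<in> s ` topspace X" using l(1) top by blast
    qed
  qed
  moreover have "gdelta_in K (\<Inter>(range G))"
    by (rule gdelta_in_Inter) (use Gop in \<open>auto intro: open_imp_gdelta_in\<close>)
  ultimately show ?thesis unfolding Cech_complete_def K_def s_def by simp
qed

section \<open>Closed subspaces of the product\<close>

lemma closedin_transport:
  assumes h: "homeomorphic_map Y Z h" and S: "closedin Y S" and X: "X homeomorphic_space subtopology Y S"
  shows "\<exists>T. closedin Z T \<and> X homeomorphic_space subtopology Z T"
proof (intro exI conjI)
  show "closedin Z (h ` S)"
    using homeomorphic_map_closedness_eq[OF h] S by blast
  have "h ` (topspace Y \<inter> S) = topspace Z \<inter> h ` S"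
    using homeomorphic_imp_surjective_map[OF h] closedin_subset[OF S] by blast
  then have "subtopology Y S homeomorphic_space subtopology Z (h ` S)"
    by (rule homeomorphic_map_imp_homeomorphic_space[OF homeomorphic_map_subtopologies[OF h]])
  then show "X homeomorphic_space subtopology Z (h ` S)"
    by (rule homeomorphic_space_trans[OF X])
qed

lemma continuous_map_Baire_cube:
  "continuous_map X (Baire_cube D) f \<longleftrightarrow>
    (\<forall>n. continuous_map X (discrete_topology D) (\<lambda>x. fst (f x) n)) \<and>
    (\<forall>n. continuous_map X euclideanreal (\<lambda>x. snd (f x) n))"
  by (simp add: continuous_map_pairwise continuous_map_componentwise_UNIV o_def)

lemma continuous_map_Baire_cube_coords:
  "continuous_map (Baire_cube D) (discrete_topology D) (\<lambda>z. fst z n)"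
  "continuous_map (Baire_cube D) euclideanreal (\<lambda>z. snd z n)"
  using continuous_map_id[of "Baire_cube D"] unfolding continuous_map_Baire_cube by simp_all

text \<open>The real coordinates of the two factors are interleaved.\<close>

lemma Baire_cube_absorbs_reals:
  "\<exists>h. homeomorphic_map (prod_topology (Baire_cube D) (powertop_real (UNIV :: nat set))) (Baire_cube D) h"
proof -
  let ?P = "prod_topology (Baire_cube D) (powertop_real (UNIV :: nat set))"
  define f :: "((nat \<Rightarrow> 'a) \<times> (nat \<Rightarrow> real)) \<times> (nat \<Rightarrow> real) \<Rightarrow> (nat \<Rightarrow> 'a) \<times> (nat \<Rightarrow> real)"
    where "f z = (fst (fst z), \<lambda>n. if even n then snd (fst z) (n div 2) else snd z (n div 2))" for z
  define g :: "(nat \<Rightarrow> 'a) \<times> (nat \<Rightarrow> real) \<Rightarrow> ((nat \<Rightarrow> 'a) \<times> (nat \<Rightarrow> real)) \<times> (nat \<Rightarrow> real)"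
    where "g z = ((fst z, \<lambda>n. snd z (2 * n)), \<lambda>n. snd z (2 * n + 1))" for z
  note coords = continuous_map_Baire_cube_coords[of D]
  have "continuous_map ?P (discrete_topology D) (\<lambda>z. fst (fst z) n)"
    "continuous_map ?P euclideanreal (\<lambda>z. snd (fst z) n)" for n
    using continuous_map_compose[OF continuous_map_fst coords(1)]
      continuous_map_compose[OF continuous_map_fst coords(2)] by (simp_all add: o_def)
  moreover have "continuous_map ?P euclideanreal (\<lambda>z. snd z n)" for n
    using continuous_map_compose[OF continuous_map_snd continuous_map_product_projection[of n UNIV]]
    by (simp add: o_def)
  ultimately have "continuous_map ?P (Baire_cube D) f"
    unfolding continuous_map_Baire_cube f_def by simp
  moreover have "continuous_map (Baire_cube D) ?P g"
    unfolding g_def using coords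
    by (simp add: continuous_map_pairwise[of _ "Baire_cube D"] continuous_map_Baire_cube
        continuous_map_componentwise_UNIV o_def)
  ultimately have "homeomorphic_maps ?P (Baire_cube D) f g"
    unfolding homeomorphic_maps_def f_def g_def by (auto simp: fun_eq_iff)
  then show ?thesis unfolding homeomorphic_map_maps by blast
qed

lemma metrizable_Baire_cube: "metrizable_space (Baire_cube D)"
  by (auto simp: metrizable_space_prod_topology metrizable_space_product_topology
      metrizable_space_discrete_topology metrizable_space_euclidean)

lemma closed_in_Baire_cube_if_gdelta_in:
  assumes e: "embedding_map X (Baire_cube D) e" and G: "gdelta_in (Baire_cube D) (e ` topspace X)"
  shows "\<exists>S. closedin (Baire_cube D) S \<and> X homeomorphic_space subtopology (Baire_cube D) S"
proof -
  from G[unfolded gdelta_in_descending] obtain C where "(\<forall>n::nat. openin (Baire_cube D) (C n)) \<and>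
     (\<forall>n. C (Suc n) \<subseteq> C n) \<and> \<Inter>(range C) = e ` topspace X" ..
  then have C: "\<And>n. openin (Baire_cube D) (C n)" "\<Inter>(range C) = e ` topspace X" by simp_all
  obtain T where T: "closedin (prod_topology (Baire_cube D) (powertop_real (UNIV :: nat set))) T"
    "subtopology (Baire_cube D) (\<Inter>(range C)) homeomorphic_space
     subtopology (prod_topology (Baire_cube D) (powertop_real (UNIV :: nat set))) T"
    by (rule gdelta_homeomorphic_space_closedin_product[OF metrizable_Baire_cube C(1), of UNIV])
  have X: "X homeomorphic_space subtopology (prod_topology (Baire_cube D) (powertop_real (UNIV :: nat set))) T"
    by (rule homeomorphic_space_trans[OF embedding_map_imp_homeomorphic_space[OF e] T(2)[unfolded C(2)]])
  from Baire_cube_absorbs_reals obtain h where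
    "homeomorphic_map (prod_topology (Baire_cube D) (powertop_real (UNIV :: nat set))) (Baire_cube D) h" ..
  then show ?thesis by (rule closedin_transport[OF _ T(1) X])
qed

lemma closed_in_Baire_cube_if_completely_metrizable:
  assumes X: "completely_metrizable_space X"
    and base: "open_cover_base X \<U>" and sc: "\<And>n. star_countable (\<U> n)"
    and D: "\<And>P. open_partition X P \<Longrightarrow> P \<lesssim> D"
  shows "\<exists>S. closedin (Baire_cube D) S \<and> X homeomorphic_space subtopology (Baire_cube D) S"
proof -
  have m: "metrizable_space X" by (rule completely_metrizable_imp_metrizable_space[OF X])
  obtain e where e: "embedding_map X (Baire_cube D) e"
    using embedding_into_Baire_cube[OF metrizable_imp_Hausdorff_space[OF m]
      metrizable_imp_normal_space[OF m] open_imp_fsigma_in[OF m] base sc D] by blast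
  have "gdelta_in (Baire_cube D) (e ` topspace X)"
  proof (rule completely_metrizable_space_imp_gdelta_in[OF metrizable_Baire_cube])
    show "e ` topspace X \<subseteq> topspace (Baire_cube D)"
      by (rule continuous_map_image_subset_topspace[OF embedding_map_imp_continuous_map[OF e]])
    show "completely_metrizable_space (subtopology (Baire_cube D) (e ` topspace X))"
      using homeomorphic_completely_metrizable_space[OF embedding_map_imp_homeomorphic_space[OF e]] X
      by simp
  qed
  then show ?thesis by (rule closed_in_Baire_cube_if_gdelta_in[OF e])
qed

lemma closed_in_Baire_cube_if_Cech_complete:
  assumes X: "completely_regular_space X" "Hausdorff_space X"
    and C: "Cech_complete X" and sm: "strongly_metrizable X"
    and D: "\<And>P. open_partition X P \<Longrightarrow> P \<lesssim> D"
  shows "\<exists>S. closedin (Baire_cube D) S \<and> X homeomorphic_space subtopology (Baire_cube D) S"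
proof -
  from sm[unfolded strongly_metrizable_iff] obtain \<U> where
    "open_cover_base X \<U> \<and> (\<forall>n. star_finite (\<U> n))" ..
  then have base: "open_cover_base X \<U>" and sf: "\<And>n. star_finite (\<U> n)" by simp_all
  note sig = regular_star_finite_base_open_sigma_closure[OF completely_regular_imp_regular_space[OF X(1)] base sf]
  have normal: "normal_space X" by (rule normal_space_if_open_sigma_closure[OF sig])
  have fsig: "fsigma_in X T" if "openin X T" for T
    by (rule fsigma_in_if_open_sigma_closure[OF sig[OF that]])
  obtain e where e: "embedding_map X (Baire_cube D) e"
    using embedding_into_Baire_cube[OF X(2) normal fsig base star_finite_imp_star_countable[OF sf] D]
    by blast
  have "gdelta_in (Baire_cube D) (e ` topspace X)"
    by (rule gdelta_in_embedding_Cech_complete[OF X C metrizable_Baire_cube e])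
  then show ?thesis by (rule closed_in_Baire_cube_if_gdelta_in[OF e])
qed

section \<open>Locally separable and locally compact metric spaces\<close>

text \<open>Separability of a subset; the countable set \<open>Q\<close> need not be contained in \<open>S\<close>, so that subsets
  inherit the property trivially.\<close>

definition separable_in :: "'a metric \<Rightarrow> 'a set \<Rightarrow> bool"
  where "separable_in m S \<longleftrightarrow>
    (\<exists>Q. countable Q \<and> Q \<subseteq> mspace m \<and> (\<forall>x\<in>S. \<forall>\<epsilon>>0. \<exists>q\<in>Q. mdist m x q < \<epsilon>))"

lemma separable_in_subset: "separable_in m T \<Longrightarrow> S \<subseteq> T \<Longrightarrow> separable_in m S"
  unfolding separable_in_def by (meson subsetD)

lemma separable_in_UN:
  assumes "countable I" and sep: "\<And>i. i \<in> I \<Longrightarrow> separable_in m (S i)"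
  shows "separable_in m (\<Union>i\<in>I. S i)"
proof -
  have "\<forall>i\<in>I. \<exists>Q. countable Q \<and> Q \<subseteq> mspace m \<and> (\<forall>x\<in>S i. \<forall>\<epsilon>>0. \<exists>q\<in>Q. mdist m x q < \<epsilon>)"
    using sep unfolding separable_in_def by simp
  from bchoice[OF this] obtain Q where
    Q: "\<forall>i\<in>I. countable (Q i) \<and> Q i \<subseteq> mspace m \<and> (\<forall>x\<in>S i. \<forall>\<epsilon>>0. \<exists>q\<in>Q i. mdist m x q < \<epsilon>)" ..
  show ?thesis
    unfolding separable_in_def
  proof (intro exI[of _ "\<Union>i\<in>I. Q i"] conjI ballI allI impI)
    show "countable (\<Union>i\<in>I. Q i)" using Q assms(1) by simp
    show "(\<Union>i\<in>I. Q i) \<subseteq> mspace m" using Q by blast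
    fix x and \<epsilon> :: real assume "x \<in> (\<Union>i\<in>I. S i)" "\<epsilon> > 0"
    then obtain i where i: "i \<in> I" "x \<in> S i" by blast
    then have "\<exists>q\<in>Q i. mdist m x q < \<epsilon>"
      using Q \<open>\<epsilon> > 0\<close> by simp
    then show "\<exists>q\<in>\<Union>i\<in>I. Q i. mdist m x q < \<epsilon>" using i(1) by blast
  qed
qed

lemma separable_in_compactin:
  assumes "compactin (mtopology_of m) K"
  shows "separable_in m K"
proof -
  interpret Metric_space "mspace m" "mdist m" by simp
  have tb: "mtotally_bounded K"
    using assms compactin_imp_mtotally_bounded by (simp add: mtopology_of_def)
  have "\<forall>n. \<exists>F. finite F \<and> F \<subseteq> K \<and> K \<subseteq> (\<Union>x\<in>F. mball x (1 / Suc n))"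
    using tb unfolding mtotally_bounded_def by simp
  from choice[OF this] obtain F where
    F: "\<forall>n. finite (F n) \<and> F n \<subseteq> K \<and> K \<subseteq> (\<Union>x\<in>F n. mball x (1 / Suc n))" ..
  show ?thesis
    unfolding separable_in_def
  proof (intro exI[of _ "\<Union>n. F n"] conjI ballI allI impI)
    show "countable (\<Union>n. F n)" using F by (simp add: countable_finite)
    show "(\<Union>n. F n) \<subseteq> mspace m" using F mtotally_bounded_imp_subset[OF tb] by blast
    fix x and \<epsilon> :: real assume x: "x \<in> K" and \<epsilon>: "\<epsilon> > 0"
    obtain n where n: "1 / Suc n < \<epsilon>" using nat_approx_posE[OF \<epsilon>] by blast
    obtain q where q: "q \<in> F n" "x \<in> mball q (1 / Suc n)" using F x by blast
    then have "mdist m x q < \<epsilon>" using n by (auto simp: commute)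
    then show "\<exists>q\<in>\<Union>n. F n. mdist m x q < \<epsilon>" using q(1) by blast
  qed
qed

lemma mball_of_subset:
  assumes "mdist m x y + s \<le> r" "x \<in> mspace m"
  shows "mball_of m y s \<subseteq> mball_of m x r"
proof
  fix z assume z: "z \<in> mball_of m y s"
  then have "mdist m x z \<le> mdist m x y + mdist m y z" using assms by (intro mdist_triangle) auto
  then show "z \<in> mball_of m x r" using z assms by auto
qed

text \<open>Points \<open>x\<close> and \<open>y\<close> are linked if \<open>d x y < s\<close> for some \<open>s\<close> such that the balls of radius \<open>2 s\<close> around
  both are separable. The points linked to a separable set with countable dense set \<open>Q\<close> lie in the union of the
  countably many separable balls with centre in \<open>Q\<close> and rational radius. Hence the chain components are separable;
  they are also open, and in every one of them countably many balls of radius \<open>1 / Suc n\<close> suffice for a cover.\<close>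

lemma star_countable_open_base_if_locally_separable:
  fixes m :: "'a metric"
  assumes loc: "\<And>x. x \<in> mspace m \<Longrightarrow> \<exists>r>0. separable_in m (mball_of m x r)"
  shows "\<exists>\<U>. open_cover_base (mtopology_of m) \<U> \<and> (\<forall>n. star_countable (\<U> n))"
proof -
  define R where "R = {(x, y). x \<in> mspace m \<and> y \<in> mspace m \<and>
    (\<exists>s. mdist m x y < s \<and> separable_in m (mball_of m x (2 * s)) \<and> separable_in m (mball_of m y (2 * s)))}"
  have "sym R" unfolding R_def by (auto simp: sym_def mdist_commute)
  then have symR: "sym (R\<^sup>*)" by (rule sym_rtrancl)
  have sepR: "separable_in m (R `` S)" if "separable_in m S" for S
  proof -
    obtain Q where Q: "countable Q" "Q \<subseteq> mspace m" "\<forall>x\<in>S. \<forall>\<epsilon>>0. \<exists>q\<in>Q. mdist m x q < \<epsilon>"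
      using \<open>separable_in m S\<close> unfolding separable_in_def by blast
    define I where "I = {(q, t). q \<in> Q \<and> t \<in> \<rat> \<and> separable_in m (mball_of m q t)}"
    have "I \<subseteq> Q \<times> \<rat>" unfolding I_def by blast
    then have "countable I" using Q(1) countable_rat by (meson countable_SIGMA countable_subset)
    then have "separable_in m (\<Union>i\<in>I. mball_of m (fst i) (snd i))"
      by (rule separable_in_UN) (auto simp: I_def)
    moreover have "R `` S \<subseteq> (\<Union>i\<in>I. mball_of m (fst i) (snd i))"
    proof
      fix y assume "y \<in> R `` S"
      then obtain x s where x: "x \<in> S" "x \<in> mspace m" "y \<in> mspace m" "mdist m x y < s"
        "separable_in m (mball_of m x (2 * s))"
        unfolding R_def by blast
      define \<delta> where "\<delta> = (s - mdist m x y) / 2"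
      have "\<delta> > 0" using x by (simp add: \<delta>_def)
      then obtain q where q: "q \<in> Q" "mdist m x q < \<delta>" using Q(3) x(1) by blast
      have "mdist m x y + \<delta> < s" using x by (simp add: \<delta>_def field_simps)
      then obtain t where t: "t \<in> \<rat>" "mdist m x y + \<delta> < t" "t < s"
        using Rats_dense_in_real by blast
      have "q \<in> mspace m" using q Q(2) by blast
      have "\<delta> + \<delta> = s - mdist m x y" by (simp add: \<delta>_def field_simps)
      then have "\<delta> \<le> s" using \<open>\<delta> > 0\<close> mdist_nonneg[of m x y] by linarith
      then have "mdist m x q + t \<le> 2 * s" using q t by linarith
      then have "mball_of m q t \<subseteq> mball_of m x (2 * s)" using x(2) by (rule mball_of_subset)
      then have "(q, t) \<in> I" unfolding I_def using separable_in_subset x(5) q(1) t(1) by blast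
      moreover have "mdist m q y \<le> mdist m q x + mdist m x y"
        using x \<open>q \<in> mspace m\<close> by (intro mdist_triangle)
      then have "y \<in> mball_of m q t" using q(2) t(2) x \<open>q \<in> mspace m\<close> by (simp add: mdist_commute)
      ultimately show "y \<in> (\<Union>i\<in>I. mball_of m (fst i) (snd i))" by force
    qed
    ultimately show ?thesis by (rule separable_in_subset)
  qed
  define C where "C x = R\<^sup>* `` {x}" for x
  have sub: "C x \<subseteq> mspace m" if "x \<in> mspace m" for x
  proof
    fix y assume "y \<in> C x"
    then have "(x, y) \<in> R\<^sup>*" by (simp add: C_def)
    then show "y \<in> mspace m" by (induction rule: rtrancl_induct) (use \<open>x \<in> mspace m\<close> in \<open>auto simp: R_def\<close>)
  qed
  have self: "x \<in> C x" for x unfolding C_def by simp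
  have Ceq: "C y = C x" if "y \<in> C x" for x y
  proof -
    have 1: "(x, y) \<in> R\<^sup>*" using that by (simp add: C_def)
    then have 2: "(y, x) \<in> R\<^sup>*" using symR by (meson symD)
    show ?thesis unfolding C_def using rtrancl_trans[OF 1] rtrancl_trans[OF 2] by blast
  qed
  have sepC: "separable_in m (C x)" if x: "x \<in> mspace m" for x
  proof -
    have "separable_in m ((R ^^ n) `` {x})" for n
    proof (induction n)
      case 0
      show ?case unfolding separable_in_def by (rule exI[of _ "{x}"]) (use x in \<open>auto simp: mdist_refl\<close>)
    next
      case (Suc n)
      have "(R ^^ Suc n) `` {x} = R `` ((R ^^ n) `` {x})" by auto
      then show ?case using sepR[OF Suc] by simp
    qed
    then have "separable_in m (\<Union>n. (R ^^ n) `` {x})" by (intro separable_in_UN) auto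
    moreover have "C x = (\<Union>n. (R ^^ n) `` {x})" unfolding C_def rtrancl_is_UN_relpow by blast
    ultimately show ?thesis by simp
  qed
  have opC: "openin (mtopology_of m) (C x)" if x: "x \<in> mspace m" for x
    unfolding openin_mtopology_of
  proof (intro conjI ballI)
    fix y assume y: "y \<in> C x"
    then have ym: "y \<in> mspace m" using sub[OF x] by blast
    obtain r where r: "r > 0" "separable_in m (mball_of m y r)" using loc[OF ym] by blast
    have "mball_of m y (r / 4) \<subseteq> C x"
    proof
      fix z assume z: "z \<in> mball_of m y (r / 4)"
      have "mball_of m z (2 * (r / 4)) \<subseteq> mball_of m y r" "mball_of m y (2 * (r / 4)) \<subseteq> mball_of m y r"
        using z ym r(1) by (intro mball_of_subset; simp add: mdist_refl)+
      then have "separable_in m (mball_of m y (2 * (r / 4)))" "separable_in m (mball_of m z (2 * (r / 4)))"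
        using separable_in_subset[OF r(2)] by blast+
      moreover have "mdist m y z < r / 4" using z by simp
      ultimately have "\<exists>s. mdist m y z < s \<and> separable_in m (mball_of m y (2 * s)) \<and>
          separable_in m (mball_of m z (2 * s))" by blast
      then have "(y, z) \<in> R" unfolding R_def using z by simp
      then show "z \<in> C x" using y unfolding C_def by (auto intro: rtrancl_into_rtrancl)
    qed
    then show "\<exists>r>0. mball_of m y r \<subseteq> C x" using r(1) by (intro exI[of _ "r / 4"]) simp
  qed (rule sub[OF x])
  define Q where "Q S = (SOME Q. countable Q \<and> Q \<subseteq> mspace m \<and> (\<forall>x\<in>S. \<forall>\<epsilon>>0. \<exists>q\<in>Q. mdist m x q < \<epsilon>))" for S
  have Q: "countable (Q (C x)) \<and> Q (C x) \<subseteq> mspace m \<and> (\<forall>y\<in>C x. \<forall>\<epsilon>>0. \<exists>q\<in>Q (C x). mdist m y q < \<epsilon>)"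
    if "x \<in> mspace m" for x
    unfolding Q_def by (rule someI_ex) (use sepC[OF that] in \<open>simp add: separable_in_def\<close>)
  define \<U> where "\<U> n = (\<Union>x\<in>mspace m. (\<lambda>q. mball_of m q (1 / Suc n) \<inter> C x) ` Q (C x))" for n :: nat
  have cov: "\<exists>q\<in>Q (C x). x \<in> mball_of m q (1 / Suc n)" if x: "x \<in> mspace m" for x n
  proof -
    have "0 < 1 / real (Suc n)" by simp
    then obtain q where "q \<in> Q (C x)" "mdist m x q < 1 / Suc n" using Q[OF x] self by meson
    moreover have "q \<in> mspace m" using Q[OF x] \<open>q \<in> Q (C x)\<close> by blast
    ultimately show ?thesis using x by (auto simp: mdist_commute)
  qed
  have "open_cover_base (mtopology_of m) \<U>"
    unfolding open_cover_base_def
  proof (intro conjI allI impI ballI)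
    fix n
    show "cover_of (topspace (mtopology_of m)) (\<U> n)"
      unfolding cover_of_def
    proof
      show "\<Union>(\<U> n) \<subseteq> topspace (mtopology_of m)" unfolding \<U>_def by auto
      show "topspace (mtopology_of m) \<subseteq> \<Union>(\<U> n)" unfolding \<U>_def using cov[of _ n] self by fastforce
    qed
    show "openin (mtopology_of m) U" if "U \<in> \<U> n" for U
      using that unfolding \<U>_def by (auto intro!: openin_Int opC openin_mball_of)
  next
    fix W x assume W: "openin (mtopology_of m) W \<and> x \<in> W"
    then have "W \<subseteq> mspace m" "\<exists>r>0. mball_of m x r \<subseteq> W" by (simp_all add: openin_mtopology_of)
    then obtain r where r: "r > 0" "mball_of m x r \<subseteq> W" by blast
    have x: "x \<in> mspace m" using W \<open>W \<subseteq> mspace m\<close> by blast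
    have "r / 2 > 0" using r by simp
    then obtain n where n: "1 / Suc n < r / 2" using nat_approx_posE by blast
    obtain q where q: "q \<in> Q (C x)" "x \<in> mball_of m q (1 / Suc n)" using cov[OF x] by blast
    have "mball_of m q (1 / Suc n) \<subseteq> mball_of m x r"
      using q(2) x n by (intro mball_of_subset) (auto simp: mdist_commute)
    then have "x \<in> mball_of m q (1 / Suc n) \<inter> C x" "mball_of m q (1 / Suc n) \<inter> C x \<subseteq> W"
      using q(2) self r(2) by blast+
    moreover have "mball_of m q (1 / Suc n) \<inter> C x \<in> \<U> n" unfolding \<U>_def using q(1) x by blast
    ultimately show "\<exists>n. \<exists>U\<in>\<U> n. x \<in> U \<and> U \<subseteq> W" by blast
  qed
  moreover have "star_countable (\<U> n)" for n
    unfolding star_countable_def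
  proof
    fix U assume "U \<in> \<U> n"
    then obtain x q where U: "x \<in> mspace m" "U = mball_of m q (1 / Suc n) \<inter> C x" unfolding \<U>_def by blast
    have "{V \<in> \<U> n. V \<inter> U \<noteq> {}} \<subseteq> (\<lambda>q. mball_of m q (1 / Suc n) \<inter> C x) ` Q (C x)"
    proof
      fix V assume "V \<in> {V \<in> \<U> n. V \<inter> U \<noteq> {}}"
      then obtain y p z where V: "p \<in> Q (C y)" "V = mball_of m p (1 / Suc n) \<inter> C y"
        "z \<in> V" "z \<in> U" unfolding \<U>_def by blast
      have "C y = C x" using Ceq[of z y] Ceq[of z x] V U by simp
      then show "V \<in> (\<lambda>q. mball_of m q (1 / Suc n) \<inter> C x) ` Q (C x)"
        using V(1,2) by (intro image_eqI[of _ _ p]) simp_all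
    qed
    then show "countable {V \<in> \<U> n. V \<inter> U \<noteq> {}}"
      using Q[OF U(1)] by (meson countable_image countable_subset)
  qed
  ultimately show ?thesis by blast
qed

lemma star_countable_open_base_if_locally_compact:
  fixes m :: "'a metric"
  assumes "locally_compact_space (mtopology_of m)"
  shows "\<exists>\<U>. open_cover_base (mtopology_of m) \<U> \<and> (\<forall>n. star_countable (\<U> n))"
proof (rule star_countable_open_base_if_locally_separable)
  fix x assume "x \<in> mspace m"
  then obtain U K where U: "openin (mtopology_of m) U" "compactin (mtopology_of m) K" "x \<in> U" "U \<subseteq> K"
    using assms unfolding locally_compact_space_def by auto
  have "\<exists>r>0. mball_of m x r \<subseteq> U" using U(1,3) by (simp add: openin_mtopology_of)
  then obtain r where "r > 0" "mball_of m x r \<subseteq> U" by blast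
  then show "\<exists>r>0. separable_in m (mball_of m x r)"
    using separable_in_subset[OF separable_in_compactin[OF U(2)]] U(4) by blast
qed

section \<open>Bourbaki-complete metrics\<close>

lemma star_mono:
  assumes "refines \<V> \<U>" "A \<subseteq> B"
  shows "star \<V> A \<subseteq> star \<U> B"
proof
  fix x assume "x \<in> star \<V> A"
  then obtain V where V: "V \<in> \<V>" "V \<inter> A \<noteq> {}" "x \<in> V" unfolding star_def by blast
  then obtain U where "U \<in> \<U>" "V \<subseteq> U" using assms(1) unfolding refines_def by blast
  then show "x \<in> star \<U> B" unfolding star_def using V assms(2) by blast
qed

lemma star_pow_mono:
  assumes "refines \<V> \<U>" "A \<subseteq> B"
  shows "(star \<V> ^^ n) A \<subseteq> (star \<U> ^^ n) B"
  by (induction n) (use assms(2) star_mono[OF assms(1)] in auto)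

lemma refines_refl: "refines \<U> \<U>"
  unfolding refines_def by blast

text \<open>Every chain component \<open>C U\<close> of the cover is exhausted by the stars \<open>S n U\<close> of one of its members \<open>U\<close>,
  and the closure of \<open>S n U\<close> is contained in \<open>S (n + 1) U\<close>. The layers \<open>S (m + 1) U - closure (S (m - 1) U)\<close>
  form the cover; layers of the same component meet only if their indices differ by at most one.\<close>

lemma star_finite_star_layers:
  assumes cov: "cover_of (topspace X) \<U>" and op: "\<And>U. U \<in> \<U> \<Longrightarrow> openin X U"
  shows "\<exists>\<T>. cover_of (topspace X) \<T> \<and> (\<forall>T\<in>\<T>. openin X T) \<and> star_finite \<T> \<and>
    (\<forall>T\<in>\<T>. \<exists>n. \<exists>U\<in>\<U>. T \<subseteq> (star \<U> ^^ n) U)"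
proof -
  define S where "S n U = (star \<U> ^^ n) U" for n U
  have S0: "S 0 U = U" and SS: "S (Suc n) U = star \<U> (S n U)" for n U
    by (simp_all add: S_def)
  have opS: "openin X (S n U)" if "U \<in> \<U>" for n U
    by (cases n) (use op that in \<open>auto simp: S0 SS star_def\<close>)
  have point: "\<exists>U\<in>\<U>. x \<in> U" if "x \<in> topspace X" for x
    using cov that unfolding cover_of_def by blast
  have clS: "X closure_of S n U \<subseteq> S (Suc n) U" for n U
  proof
    fix x assume x: "x \<in> X closure_of S n U"
    then obtain V where V: "V \<in> \<U>" "x \<in> V" using point by (auto simp: in_closure_of)
    then have "V \<inter> S n U \<noteq> {}" using x op[OF V(1)] unfolding in_closure_of by blast
    then show "x \<in> S (Suc n) U" unfolding SS star_def using V by blast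
  qed
  have Ssuc: "S n U \<subseteq> S (Suc n) U" if "U \<in> \<U>" for n U
    using clS closure_of_subset[OF openin_subset[OF opS[OF that]]] by blast
  have Smono: "S k U \<subseteq> S n U" if "U \<in> \<U>" "k \<le> n" for k n U
    using lift_Suc_mono_le[of "\<lambda>n. S n U", OF Ssuc[OF that(1)] that(2)] .
  define C where "C U = (\<Union>n. S n U)" for U
  have SC: "S n U \<subseteq> C U" for n U unfolding C_def by blast
  have Cstar: "star \<U> A \<subseteq> C U" if A: "A \<subseteq> C U" for A U
  proof
    fix x assume "x \<in> star \<U> A"
    then obtain V y where V: "V \<in> \<U>" "x \<in> V" "y \<in> V" "y \<in> A" unfolding star_def by blast
    then obtain n where "y \<in> S n U" using A unfolding C_def by blast
    then have "x \<in> S (Suc n) U" unfolding SS star_def using V by blast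
    then show "x \<in> C U" using SC by blast
  qed
  have Csub: "C V \<subseteq> C U" if "V \<subseteq> C U" for U V
  proof -
    have "S n V \<subseteq> C U" for n
    proof (induction n)
      case 0 show ?case using that by (simp add: S0)
    next
      case (Suc n) then show ?case unfolding SS by (rule Cstar)
    qed
    then show ?thesis unfolding C_def[of V] by blast
  qed
  have reach: "U \<subseteq> C W" if "W \<in> \<U>" "W \<inter> S n U \<noteq> {}" "U \<in> \<U>" for n U W
    using that
  proof (induction n arbitrary: W)
    case 0
    then have "U \<subseteq> S (Suc 0) W" by (auto simp: S0 SS star_def)
    then show ?case using SC by blast
  next
    case (Suc n)
    then obtain V where V: "V \<in> \<U>" "V \<inter> S n U \<noteq> {}" "V \<inter> W \<noteq> {}"
      unfolding SS star_def by blast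
    have "V \<subseteq> S (Suc 0) W" unfolding S0 SS star_def using V by blast
    then have "C V \<subseteq> C W" using SC Csub by blast
    then show ?case using Suc.IH[OF V(1,2) Suc.prems(3)] by blast
  qed
  have Ceq1: "C W = C U" if W: "W \<in> \<U>" "W \<inter> C U \<noteq> {}" and U: "U \<in> \<U>" for U W
  proof
    obtain n where n: "W \<inter> S n U \<noteq> {}" using W(2) unfolding C_def by blast
    then have "W \<subseteq> S (Suc n) U" unfolding SS star_def using W(1) by blast
    then show "C W \<subseteq> C U" using SC Csub by blast
    show "C U \<subseteq> C W" by (rule Csub[OF reach[OF W(1) n U]])
  qed
  have Ctop: "C U \<subseteq> topspace X" if "U \<in> \<U>" for U
    unfolding C_def using openin_subset[OF opS[OF that]] by blast
  have Ceq: "C U = C V" if UV: "U \<in> \<U>" "V \<in> \<U>" and x: "x \<in> C U" "x \<in> C V" for U V x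
  proof -
    obtain W where W: "W \<in> \<U>" "x \<in> W" using point Ctop UV x by blast
    then have "C W = C U" "C W = C V" using Ceq1 UV x by blast+
    then show ?thesis by simp
  qed
  \<comment> \<open>One member is chosen for each component, so that the layers of different components are disjoint.\<close>
  define rep where "rep c = (SOME U. U \<in> \<U> \<and> C U = c)" for c
  have rep: "rep (C U) \<in> \<U> \<and> C (rep (C U)) = C U" if "U \<in> \<U>" for U
    unfolding rep_def by (rule someI[of _ U]) (use that in simp)
  define L where "L U m = S (Suc m) U - (if m = 0 then {} else X closure_of S (m - 1) U)" for U m
  have LC: "L U m \<subseteq> C U" for U m unfolding L_def using SC by blast
  have Lop: "openin X (L U m)" if "U \<in> \<U>" for U m
    unfolding L_def using opS[OF that] by (auto intro: openin_diff)
  define \<T> where "\<T> = (\<Union>U\<in>\<U>. range (L (rep (C U))))"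
  have "cover_of (topspace X) \<T>"
    unfolding cover_of_def
  proof
    have "L (rep (C U)) m \<subseteq> topspace X" if "U \<in> \<U>" for U m
      by (rule openin_subset[OF Lop]) (use rep[OF that] in simp)
    then show "\<Union>\<T> \<subseteq> topspace X" unfolding \<T>_def by blast
    show "topspace X \<subseteq> \<Union>\<T>"
    proof
      fix x assume "x \<in> topspace X"
      then obtain V where V: "V \<in> \<U>" "x \<in> V" using point by blast
      define U where "U = rep (C V)"
      have U: "U \<in> \<U>" "C U = C V" using rep[OF V(1)] by (simp_all add: U_def)
      have "V \<subseteq> C V" using SC[of 0 V] by (simp add: S0)
      then have "\<exists>n. x \<in> S n U" using V(2) U(2) unfolding C_def[of U] by blast
      define n where "n = (LEAST n. x \<in> S n U)"
      have n: "x \<in> S n U" and least: "\<And>k. k < n \<Longrightarrow> x \<notin> S k U"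
        unfolding n_def using LeastI_ex[OF \<open>\<exists>n. x \<in> S n U\<close>] not_less_Least by blast+
      have "\<exists>m. x \<in> L U m"
      proof (cases n)
        case 0
        then have "x \<in> L U 0" unfolding L_def using n Ssuc[OF U(1), of 0] by auto
        then show ?thesis ..
      next
        case (Suc k)
        have "x \<notin> X closure_of S (k - 1) U" if "k \<noteq> 0"
          using clS[of "k - 1" U] least[of k] Suc that by auto
        then have "x \<in> L U k" unfolding L_def using n Suc by simp
        then show ?thesis ..
      qed
      then show "x \<in> \<Union>\<T>" unfolding \<T>_def U_def using V(1) by blast
    qed
  qed
  moreover have "\<forall>T\<in>\<T>. openin X T" unfolding \<T>_def using Lop rep by blast
  moreover have "star_finite \<T>"
    unfolding star_finite_def
  proof
    fix T assume "T \<in> \<T>"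
    then obtain U m where U: "U \<in> \<U>" "T = L (rep (C U)) m" unfolding \<T>_def by blast
    have "{T'\<in>\<T>. T' \<inter> T \<noteq> {}} \<subseteq> L (rep (C U)) ` {..Suc m}"
    proof
      fix T' assume "T' \<in> {T'\<in>\<T>. T' \<inter> T \<noteq> {}}"
      then obtain V m' x where V: "V \<in> \<U>" "T' = L (rep (C V)) m'" "x \<in> T'" "x \<in> T"
        unfolding \<T>_def by blast
      have "x \<in> C (rep (C U))" "x \<in> C (rep (C V))" using V U(2) LC by blast+
      then have eq: "C U = C V" using Ceq[OF _ _] rep U(1) V(1) by metis
      have "m' \<le> Suc m"
      proof (rule ccontr)
        assume m': "\<not> m' \<le> Suc m"
        have "rep (C U) \<in> \<U>" using rep U(1) by blast
        then have "S (Suc m) (rep (C U)) \<subseteq> S (m' - 1) (rep (C U))" using m' by (intro Smono) auto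
        moreover have "S (m' - 1) (rep (C U)) \<subseteq> X closure_of S (m' - 1) (rep (C U))"
          using closure_of_subset[OF openin_subset[OF opS]] rep U(1) by blast
        moreover have "x \<in> S (Suc m) (rep (C U))" using V(4) U(2) unfolding L_def by simp
        moreover have "x \<notin> X closure_of S (m' - 1) (rep (C U))"
          using V(2,3) eq m' unfolding L_def by simp
        ultimately show False by blast
      qed
      then show "T' \<in> L (rep (C U)) ` {..Suc m}" using V(2) eq by simp
    qed
    then show "finite {T'\<in>\<T>. T' \<inter> T \<noteq> {}}" by (rule finite_subset) simp
  qed
  moreover have "\<forall>T\<in>\<T>. \<exists>n. \<exists>U\<in>\<U>. T \<subseteq> (star \<U> ^^ n) U"
  proof
    fix T assume "T \<in> \<T>"
    then obtain U m where U: "U \<in> \<U>" "T = L (rep (C U)) m" unfolding \<T>_def by blast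
    have "T \<subseteq> (star \<U> ^^ Suc m) (rep (C U))" unfolding U(2) L_def S_def by blast
    then show "\<exists>n. \<exists>U\<in>\<U>. T \<subseteq> (star \<U> ^^ n) U" using rep[OF U(1)] by blast
  qed
  ultimately show ?thesis by blast
qed

text \<open>The uniform cover by the open balls of radius \<open>1 / Suc n\<close>.\<close>

definition ball_cover :: "'a metric \<Rightarrow> nat \<Rightarrow> 'a set set"
  where "ball_cover m n = (\<lambda>x. mball_of m x (1 / Suc n)) ` mspace m"

lemma self_in_mball_of: "x \<in> mspace m \<Longrightarrow> r > 0 \<Longrightarrow> x \<in> mball_of m x r"
  by (simp add: mdist_refl)

lemma ball_cover_in_metric_uniformity: "ball_cover m n \<in> metric_uniformity m"
proof -
  have "cover_of (mspace m) (ball_cover m n)"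
    unfolding cover_of_def ball_cover_def
    using self_in_mball_of[of _ m "1 / Suc n"] by (auto simp del: in_mball_of) auto
  then show ?thesis
    unfolding metric_uniformity_def
    by (auto simp: ball_cover_def refines_refl intro!: exI[of _ "1 / Suc n"])
qed

lemma ball_cover_subset_mball_of:
  assumes B: "B \<in> ball_cover m n" "x \<in> B" and n: "1 / Suc n < r / 2"
  shows "B \<subseteq> mball_of m x r"
proof -
  obtain y where y: "y \<in> mspace m" "B = mball_of m y (1 / Suc n)" using B unfolding ball_cover_def by blast
  show ?thesis
    unfolding y(2) by (rule mball_of_subset) (use B(2) y n in \<open>auto simp: mdist_commute\<close>)
qed

lemma mball_of_radius:
  assumes "openin (mtopology_of m) W" "x \<in> W"
  shows "\<exists>n r. mball_of m x r \<subseteq> W \<and> 1 / Suc n < r / 2 \<and> 0 < r"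
proof -
  have "\<exists>r>0. mball_of m x r \<subseteq> W" using assms by (simp add: openin_mtopology_of)
  then obtain r where r: "r > 0" "mball_of m x r \<subseteq> W" by blast
  have "r / 2 > 0" using r by simp
  then obtain n where "1 / Suc n < r / 2" using nat_approx_posE by blast
  then show ?thesis using r by blast
qed

lemma star_countable_open_base_if_star_countable_base:
  assumes "star_countable_base m"
  shows "\<exists>\<U>. open_cover_base (mtopology_of m) \<U> \<and> (\<forall>n. star_countable (\<U> n))"
proof -
  let ?X = "mtopology_of m"
  have "\<forall>n. \<exists>\<V>. \<V> \<in> metric_uniformity m \<and> star_countable \<V> \<and> refines \<V> (ball_cover m n)"
    using assms ball_cover_in_metric_uniformity[of m]
    unfolding star_countable_base_def uniformity_base_def by blast
  from choice[OF this] obtain \<V> where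
    \<V>: "\<forall>n. \<V> n \<in> metric_uniformity m \<and> star_countable (\<V> n) \<and> refines (\<V> n) (ball_cover m n)" ..
  define \<U> where "\<U> n = (\<lambda>V. ?X interior_of V) ` \<V> n" for n
  have pt: "\<exists>V\<in>\<V> n. x \<in> ?X interior_of V" if x: "x \<in> mspace m" for x n
  proof -
    obtain \<epsilon> where \<epsilon>: "\<epsilon> > 0" "refines ((\<lambda>x. mball_of m x \<epsilon>) ` mspace m) (\<V> n)"
      using \<V> unfolding metric_uniformity_def by blast
    then obtain V where "V \<in> \<V> n" "mball_of m x \<epsilon> \<subseteq> V" using x unfolding refines_def by blast
    moreover have "mball_of m x \<epsilon> \<subseteq> ?X interior_of V"
      by (rule interior_of_maximal[OF \<open>mball_of m x \<epsilon> \<subseteq> V\<close> openin_mball_of])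
    ultimately show ?thesis using self_in_mball_of[OF x \<epsilon>(1)] by blast
  qed
  have "open_cover_base ?X \<U>"
    unfolding open_cover_base_def
  proof (intro conjI allI impI ballI)
    fix n
    show "cover_of (topspace ?X) (\<U> n)"
      unfolding cover_of_def \<U>_def using pt[of _ n] interior_of_subset_topspace[of ?X] by fastforce
    show "openin ?X U" if "U \<in> \<U> n" for U using that unfolding \<U>_def by auto
  next
    fix W x assume W: "openin ?X W \<and> x \<in> W"
    then obtain n r where nr: "mball_of m x r \<subseteq> W" "1 / Suc n < r / 2"
      using mball_of_radius[of m W x] by blast
    have "x \<in> mspace m" using W openin_subset[of "mtopology_of m" W] by auto
    then obtain V where V: "V \<in> \<V> n" "x \<in> ?X interior_of V" using pt by blast
    then obtain B where B: "B \<in> ball_cover m n" "V \<subseteq> B" using \<V> unfolding refines_def by blast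
    have VI: "?X interior_of V \<subseteq> V" by (rule interior_of_subset)
    then have "B \<subseteq> mball_of m x r" using ball_cover_subset_mball_of[OF B(1) _ nr(2)] B(2) V(2) by blast
    then have "?X interior_of V \<subseteq> W" using VI B(2) nr(1) by blast
    then show "\<exists>n. \<exists>U\<in>\<U> n. x \<in> U \<and> U \<subseteq> W" using V unfolding \<U>_def by blast
  qed
  moreover have "star_countable (\<U> n)" for n
    unfolding star_countable_def
  proof
    fix U assume "U \<in> \<U> n"
    then obtain V where V: "V \<in> \<V> n" "U = ?X interior_of V" unfolding \<U>_def by blast
    have "{U'\<in>\<U> n. U' \<inter> U \<noteq> {}} \<subseteq> (\<lambda>V. ?X interior_of V) ` {V'\<in>\<V> n. V' \<inter> V \<noteq> {}}"
    proof
      fix U' assume "U' \<in> {U'\<in>\<U> n. U' \<inter> U \<noteq> {}}"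
      then obtain V' where V': "V' \<in> \<V> n" "U' = ?X interior_of V'" "U' \<inter> U \<noteq> {}" unfolding \<U>_def by blast
      then have "V' \<inter> V \<noteq> {}" using V(2) interior_of_subset[of ?X] by blast
      then show "U' \<in> (\<lambda>V. ?X interior_of V) ` {V'\<in>\<V> n. V' \<inter> V \<noteq> {}}" using V' by blast
    qed
    moreover have "countable {V'\<in>\<V> n. V' \<inter> V \<noteq> {}}" using \<V> V(1) unfolding star_countable_def by blast
    ultimately show "countable {U'\<in>\<U> n. U' \<inter> U \<noteq> {}}" by (meson countable_image countable_subset)
  qed
  ultimately show ?thesis by blast
qed

lemma mcomplete_of_if_Bourbaki_complete:
  assumes bc: "Bourbaki_complete m"
  shows "mcomplete_of m"
proof -
  interpret Metric_space "mspace m" "mdist m" by simp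
  have "\<exists>x. limitin mtopology \<sigma> x sequentially" if \<sigma>: "MCauchy \<sigma>" for \<sigma>
  proof -
    have M: "\<And>k. \<sigma> k \<in> mspace m" and
      cauchy: "\<And>\<epsilon>. \<epsilon> > 0 \<Longrightarrow> \<exists>N. \<forall>k l. N \<le> k \<longrightarrow> N \<le> l \<longrightarrow> mdist m (\<sigma> k) (\<sigma> l) < \<epsilon>"
      using \<sigma> unfolding MCauchy_def by blast+
    define \<F> where "\<F> = filtermap \<sigma> sequentially"
    have "filter_on (mspace m) \<F>"
      unfolding filter_on_def \<F>_def by (simp add: filtermap_bot_iff eventually_filtermap M)
    moreover have "Bourbaki_Cauchy m \<F>"
      unfolding Bourbaki_Cauchy_def
    proof
      fix \<U> assume "\<U> \<in> metric_uniformity m"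
      then obtain \<epsilon> where \<epsilon>: "\<epsilon> > 0" "refines ((\<lambda>x. mball_of m x \<epsilon>) ` mspace m) \<U>"
        unfolding metric_uniformity_def by blast
      obtain N where N: "\<And>k l. N \<le> k \<Longrightarrow> N \<le> l \<Longrightarrow> mdist m (\<sigma> k) (\<sigma> l) < \<epsilon>" using cauchy[OF \<epsilon>(1)] by blast
      obtain U where U: "U \<in> \<U>" "mball_of m (\<sigma> N) \<epsilon> \<subseteq> U" using \<epsilon>(2) M unfolding refines_def by blast
      have "\<sigma> k \<in> U" if "N \<le> k" for k
        using U(2) N[of N k] M that by auto
      then have "eventually (\<lambda>x. x \<in> U) \<F>"
        unfolding \<F>_def eventually_filtermap eventually_sequentially by blast
      moreover have "U \<subseteq> (star \<U> ^^ 0) U" by simp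
      ultimately show "\<exists>n. \<exists>U\<in>\<U>. \<exists>F. eventually (\<lambda>x. x \<in> F) \<F> \<and> F \<subseteq> (star \<U> ^^ n) U"
        using U(1) by blast
    qed
    ultimately obtain x where x: "cluster_point (mtopology_of m) \<F> x"
      using bc unfolding Bourbaki_complete_def by blast
    then have xm: "x \<in> mspace m" unfolding cluster_point_def by simp
    have "limitin mtopology \<sigma> x sequentially"
      unfolding limitin_metric eventually_sequentially
    proof (intro conjI allI impI)
      fix \<epsilon> :: real assume "\<epsilon> > 0"
      then have "\<epsilon> / 2 > 0" by simp
      then obtain N where N: "\<And>k l. N \<le> k \<Longrightarrow> N \<le> l \<Longrightarrow> mdist m (\<sigma> k) (\<sigma> l) < \<epsilon> / 2" using cauchy by blast
      have "eventually (\<lambda>y. y \<in> \<sigma> ` {N..}) \<F>"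
        unfolding \<F>_def eventually_filtermap eventually_sequentially by (intro exI[of _ N]) simp
      then have "x \<in> mtopology_of m closure_of (\<sigma> ` {N..})" using x unfolding cluster_point_def by blast
      moreover have "x \<in> mball_of m x (\<epsilon> / 2)" using self_in_mball_of[OF xm \<open>\<epsilon> / 2 > 0\<close>] .
      ultimately have "\<exists>y. y \<in> \<sigma> ` {N..} \<and> y \<in> mball_of m x (\<epsilon> / 2)"
        using openin_mball_of[of m x "\<epsilon> / 2"] unfolding in_closure_of by blast
      then obtain k where k: "N \<le> k" "mdist m x (\<sigma> k) < \<epsilon> / 2" by auto
      have "mdist m (\<sigma> l) x < \<epsilon>" if "N \<le> l" for l
      proof -
        have "mdist m (\<sigma> l) x \<le> mdist m (\<sigma> l) (\<sigma> k) + mdist m (\<sigma> k) x"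
          using M xm by (intro mdist_triangle)
        then show ?thesis using N[OF that k(1)] k(2) mdist_commute[of m x "\<sigma> k"] by linarith
      qed
      then show "\<exists>N. \<forall>l\<ge>N. \<sigma> l \<in> mspace m \<and> mdist m (\<sigma> l) x < \<epsilon>" using M by blast
    qed (rule xm)
    then show ?thesis ..
  qed
  then show ?thesis unfolding mcomplete_of_def mcomplete_def by blast
qed

lemma star_countable_open_base_if_Bourbaki_complete:
  assumes bc: "Bourbaki_complete m"
  shows "\<exists>\<U>. open_cover_base (mtopology_of m) \<U> \<and> (\<forall>n. star_countable (\<U> n))"
proof -
  let ?X = "mtopology_of m"
  have "\<forall>n. \<exists>\<T>. cover_of (topspace ?X) \<T> \<and> (\<forall>T\<in>\<T>. openin ?X T) \<and> star_finite \<T> \<and>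
      (\<forall>T\<in>\<T>. \<exists>k. \<exists>U\<in>ball_cover m n. T \<subseteq> (star (ball_cover m n) ^^ k) U)"
  proof
    fix n
    show "\<exists>\<T>. cover_of (topspace ?X) \<T> \<and> (\<forall>T\<in>\<T>. openin ?X T) \<and> star_finite \<T> \<and>
      (\<forall>T\<in>\<T>. \<exists>k. \<exists>U\<in>ball_cover m n. T \<subseteq> (star (ball_cover m n) ^^ k) U)"
      by (rule star_finite_star_layers)
        (use ball_cover_in_metric_uniformity[of m n] in
          \<open>auto simp: metric_uniformity_def ball_cover_def openin_mball_of\<close>)
  qed
  from choice[OF this] obtain \<T> where
    "\<forall>n. cover_of (topspace ?X) (\<T> n) \<and> (\<forall>T\<in>\<T> n. openin ?X T) \<and> star_finite (\<T> n) \<and>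
      (\<forall>T\<in>\<T> n. \<exists>k. \<exists>U\<in>ball_cover m n. T \<subseteq> (star (ball_cover m n) ^^ k) U)" ..
  then have cov: "\<And>n. cover_of (topspace ?X) (\<T> n)" and op: "\<And>n T. T \<in> \<T> n \<Longrightarrow> openin ?X T"
    and sf: "\<And>n. star_finite (\<T> n)"
    and layer: "\<And>n T. T \<in> \<T> n \<Longrightarrow> \<exists>k. \<exists>U\<in>ball_cover m n. T \<subseteq> (star (ball_cover m n) ^^ k) U"
    by simp_all
  \<comment> \<open>A member \<open>M\<close> of a meet is split by the balls of a finite family covering it, if there is one, and kept
    otherwise.\<close>
  define fin where "fin n M F \<longleftrightarrow> finite F \<and> F \<subseteq> ball_cover m n \<and> M \<subseteq> \<Union>F" for n and M :: "'a set" and F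
  define pieces where "pieces n M = (if Ex (fin n M) then (\<lambda>B. M \<inter> B) ` (SOME F. fin n M F) else {M})" for n M
  have pieces: "\<exists>F. fin n M F \<and> pieces n M = (\<lambda>B. M \<inter> B) ` F" if "Ex (fin n M)" for n M
    using that someI_ex[OF that] unfolding pieces_def by auto
  have piece_cases: "(\<exists>F. fin n M F \<and> pieces n M = (\<lambda>B. M \<inter> B) ` F) \<or> pieces n M = {M}" for n M
    using pieces[of n M] by (cases "Ex (fin n M)") (auto simp: pieces_def)
  have piece_Union: "\<Union>(pieces n M) = M" for n M
    using piece_cases[of n M]
  proof
    assume "\<exists>F. fin n M F \<and> pieces n M = (\<lambda>B. M \<inter> B) ` F"
    then obtain F where F: "M \<subseteq> \<Union>F" "pieces n M = (\<lambda>B. M \<inter> B) ` F" unfolding fin_def by blast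
    show ?thesis unfolding F(2) using F(1) by blast
  qed simp
  have piece_finite: "finite (pieces n M)" for n M
    using piece_cases[of n M] unfolding fin_def by auto
  have ball_open: "openin ?X B" if "B \<in> ball_cover m n" for B n
    using that unfolding ball_cover_def by (auto simp: openin_mball_of)
  have piece_open: "openin ?X V" if V: "V \<in> pieces n M" and M: "openin ?X M" for V n M
    using piece_cases[of n M]
  proof
    assume "\<exists>F. fin n M F \<and> pieces n M = (\<lambda>B. M \<inter> B) ` F"
    then obtain B where "B \<in> ball_cover m n" "V = M \<inter> B" using V unfolding fin_def by blast
    then show ?thesis using M ball_open by (auto intro: openin_Int)
  qed (use V M in simp)
  define \<V> where "\<V> N n = (\<Union>M\<in>cover_meet \<T> N. pieces n M)" for N n
  have \<V>sf: "star_countable (\<V> N n)" for N n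
    unfolding star_countable_def
  proof
    fix V assume "V \<in> \<V> N n"
    then obtain M where M: "M \<in> cover_meet \<T> N" "V \<in> pieces n M" unfolding \<V>_def by blast
    have "finite {M'\<in>cover_meet \<T> N. M' \<inter> M \<noteq> {}}"
      using star_finite_cover_meet[of \<T>, OF sf] M(1) unfolding star_finite_def by blast
    then have "finite (\<Union>M'\<in>{M'\<in>cover_meet \<T> N. M' \<inter> M \<noteq> {}}. pieces n M')" using piece_finite by blast
    moreover have "{V'\<in>\<V> N n. V' \<inter> V \<noteq> {}} \<subseteq> (\<Union>M'\<in>{M'\<in>cover_meet \<T> N. M' \<inter> M \<noteq> {}}. pieces n M')"
    proof
      fix V' assume "V' \<in> {V'\<in>\<V> N n. V' \<inter> V \<noteq> {}}"
      then obtain M' where M': "M' \<in> cover_meet \<T> N" "V' \<in> pieces n M'" "V' \<inter> V \<noteq> {}"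
        unfolding \<V>_def by blast
      then have "M' \<inter> M \<noteq> {}" using piece_Union M(2) by blast
      then show "V' \<in> (\<Union>M'\<in>{M'\<in>cover_meet \<T> N. M' \<inter> M \<noteq> {}}. pieces n M')" using M' by blast
    qed
    ultimately show "countable {V'\<in>\<V> N n. V' \<inter> V \<noteq> {}}" by (meson countable_finite finite_subset)
  qed
  have \<V>cov: "cover_of (topspace ?X) (\<V> N n)" for N n
  proof -
    have "\<Union>(\<V> N n) = (\<Union>M\<in>cover_meet \<T> N. \<Union>(pieces n M))" unfolding \<V>_def by blast
    also have "\<dots> = \<Union>(cover_meet \<T> N)" by (simp add: piece_Union)
    finally have "\<Union>(\<V> N n) = \<Union>(cover_meet \<T> N)" .
    then show ?thesis using cover_of_cover_meet[of _ \<T>, OF cov] unfolding cover_of_def by simp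
  qed
  have \<V>op: "openin ?X V" if V: "V \<in> \<V> N n" for V N n
  proof -
    obtain M where M: "M \<in> cover_meet \<T> N" "V \<in> pieces n M" using V unfolding \<V>_def by blast
    show ?thesis by (rule piece_open[OF M(2) openin_cover_meet[OF op M(1)]])
  qed
  \<comment> \<open>Bourbaki-completeness enters here: otherwise the sets \<open>E N - \<Union>F\<close> below generate a filter without
    cluster points.\<close>
  have key: "\<exists>N. \<exists>M\<in>cover_meet \<T> N. x \<in> M \<and> Ex (fin n M)" if x: "x \<in> mspace m" for x n
  proof (rule ccontr)
    assume contra: "\<not> ?thesis"
    have "\<exists>T. T \<in> \<T> i \<and> x \<in> T" for i
    proof -
      have "x \<in> \<Union>(\<T> i)" using cov[of i] x unfolding cover_of_def by simp
      then show ?thesis by blast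
    qed
    then have "\<forall>i. \<exists>T. T \<in> \<T> i \<and> x \<in> T" ..
    from choice[OF this] obtain T where T: "\<forall>i. T i \<in> \<T> i \<and> x \<in> T i" ..
    define E where "E N = (\<Inter>k\<le>N. T k)" for N
    have EM: "E N \<in> cover_meet \<T> N" "x \<in> E N" for N unfolding E_def using T by (auto intro: cover_meetI)
    have nofin: "\<not> fin n (E N) F" for N F using contra EM by blast
    have Edec: "E N \<subseteq> E N'" if "N' \<le> N" for N N' unfolding E_def using that by fastforce
    define I where "I = (UNIV :: nat set) \<times> {F. finite F \<and> F \<subseteq> ball_cover m n}"
    define \<F> where "\<F> = (INF i\<in>I. principal (E (fst i) - \<Union>(snd i)))"
    have ev: "eventually P \<F> \<longleftrightarrow> (\<exists>i\<in>I. eventually P (principal (E (fst i) - \<Union>(snd i))))" for P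
      unfolding \<F>_def
    proof (rule eventually_INF_base)
      show "I \<noteq> {}" unfolding I_def by blast
      fix a b assume "a \<in> I" "b \<in> I"
      then show "\<exists>c\<in>I. principal (E (fst c) - \<Union>(snd c)) \<le>
          inf (principal (E (fst a) - \<Union>(snd a))) (principal (E (fst b) - \<Union>(snd b)))"
        using Edec[of "fst a" "max (fst a) (fst b)"] Edec[of "fst b" "max (fst a) (fst b)"]
        by (intro bexI[of _ "(max (fst a) (fst b), snd a \<union> snd b)"]) (auto simp: I_def)
    qed
    have evE: "eventually (\<lambda>y. y \<in> E N - \<Union>F) \<F>" if "finite F" "F \<subseteq> ball_cover m n" for N F
      unfolding ev eventually_principal I_def using that by (intro bexI[of _ "(N, F)"]) auto
    have "filter_on (mspace m) \<F>"
      unfolding filter_on_def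
    proof
      show "\<F> \<noteq> bot"
      proof
        assume "\<F> = bot"
        then have "eventually (\<lambda>_. False) \<F>" by simp
        then obtain i where i: "i \<in> I" "\<forall>y\<in>E (fst i) - \<Union>(snd i). False"
          unfolding ev eventually_principal by (elim bexE)
        then have "E (fst i) \<subseteq> \<Union>(snd i)" by blast
        then show False using nofin[of "fst i" "snd i"] i(1) unfolding fin_def I_def by auto
      qed
      have "E 0 \<subseteq> mspace m"
        using openin_subset[OF openin_cover_meet[OF op EM(1)]] by simp
      then show "eventually (\<lambda>y. y \<in> mspace m) \<F>"
        using evE[of "{}" 0] by (auto elim!: eventually_mono)
    qed
    moreover have "Bourbaki_Cauchy m \<F>"
      unfolding Bourbaki_Cauchy_def
    proof
      fix \<U> assume "\<U> \<in> metric_uniformity m"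
      then obtain \<epsilon> where \<epsilon>: "\<epsilon> > 0" "refines ((\<lambda>x. mball_of m x \<epsilon>) ` mspace m) \<U>"
        unfolding metric_uniformity_def by blast
      obtain i where i: "1 / Suc i < \<epsilon>" using nat_approx_posE[OF \<epsilon>(1)] by blast
      have ref: "refines (ball_cover m i) \<U>"
        unfolding refines_def
      proof
        fix B assume "B \<in> ball_cover m i"
        then obtain y where y: "y \<in> mspace m" "B = mball_of m y (1 / Suc i)" unfolding ball_cover_def by blast
        then obtain U where "U \<in> \<U>" "mball_of m y \<epsilon> \<subseteq> U" using \<epsilon>(2) unfolding refines_def by blast
        moreover have "B \<subseteq> mball_of m y \<epsilon>" using y i by auto
        ultimately show "\<exists>U\<in>\<U>. B \<subseteq> U" by blast
      qed
      obtain k B where B: "B \<in> ball_cover m i" "T i \<subseteq> (star (ball_cover m i) ^^ k) B"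
        using layer T by blast
      obtain U where U: "U \<in> \<U>" "B \<subseteq> U" using ref B(1) unfolding refines_def by blast
      have "E i \<subseteq> (star \<U> ^^ k) U"
        using B(2) star_pow_mono[OF ref U(2), of k] unfolding E_def by blast
      moreover have "eventually (\<lambda>y. y \<in> E i) \<F>" using evE[of "{}" i] by simp
      ultimately show "\<exists>n. \<exists>U\<in>\<U>. \<exists>F. eventually (\<lambda>x. x \<in> F) \<F> \<and> F \<subseteq> (star \<U> ^^ n) U"
        using U(1) by blast
    qed
    ultimately obtain z where z: "cluster_point ?X \<F> z"
      using bc unfolding Bourbaki_complete_def by blast
    then have zm: "z \<in> mspace m" unfolding cluster_point_def by simp
    define B where "B = mball_of m z (1 / Suc n)"
    have B: "B \<in> ball_cover m n" "z \<in> B"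
      unfolding B_def ball_cover_def using zm self_in_mball_of[OF zm, of "1 / Suc n"] by auto
    have "eventually (\<lambda>y. y \<in> E 0 - \<Union>{B}) \<F>" by (rule evE) (use B in auto)
    then have "z \<in> ?X closure_of (E 0 - \<Union>{B})" using z unfolding cluster_point_def by blast
    then show False using ball_open[OF B(1)] B(2) unfolding in_closure_of by blast
  qed
  define \<U> where "\<U> k = \<V> (fst (prod_decode k)) (snd (prod_decode k))" for k
  have "open_cover_base ?X \<U>"
    unfolding open_cover_base_def
  proof (intro conjI allI impI ballI)
    show "cover_of (topspace ?X) (\<U> n)" for n unfolding \<U>_def by (rule \<V>cov)
    show "openin ?X U" if "U \<in> \<U> n" for U n using that \<V>op unfolding \<U>_def by blast
  next
    fix W x assume W: "openin ?X W \<and> x \<in> W"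
    then obtain n r where nr: "mball_of m x r \<subseteq> W" "1 / Suc n < r / 2"
      using mball_of_radius[of m W x] by blast
    have "x \<in> mspace m" using W openin_subset[of "mtopology_of m" W] by auto
    then obtain N M where M: "M \<in> cover_meet \<T> N" "x \<in> M" "Ex (fin n M)" using key by blast
    obtain F where F: "fin n M F" "pieces n M = (\<lambda>B. M \<inter> B) ` F" using pieces[OF M(3)] by blast
    then obtain B where B: "B \<in> F" "B \<in> ball_cover m n" "x \<in> B" using M(2) unfolding fin_def by blast
    have "M \<inter> B \<in> \<U> (prod_encode (N, n))" unfolding \<U>_def \<V>_def using M(1) F(2) B(1) by auto
    moreover have "M \<inter> B \<subseteq> W" using ball_cover_subset_mball_of[OF B(2,3) nr(2)] nr(1) by blast
    ultimately show "\<exists>n. \<exists>U\<in>\<U> n. x \<in> U \<and> U \<subseteq> W" using M(2) B(3) by blast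
  qed
  moreover have "star_countable (\<U> n)" for n unfolding \<U>_def by (rule \<V>sf)
  ultimately show ?thesis by blast
qed

section \<open>Subspaces of countable products\<close>

lemma star_countable_preimage:
  assumes "star_countable \<U>"
  shows "star_countable ((\<lambda>U. {x\<in>T. h x \<in> U}) ` \<U>)"
  unfolding star_countable_def
proof
  fix A assume "A \<in> (\<lambda>U. {x\<in>T. h x \<in> U}) ` \<U>"
  then obtain U where U: "U \<in> \<U>" "A = {x\<in>T. h x \<in> U}" by blast
  have "{B \<in> (\<lambda>U. {x\<in>T. h x \<in> U}) ` \<U>. B \<inter> A \<noteq> {}} \<subseteq>
      (\<lambda>U. {x\<in>T. h x \<in> U}) ` {V\<in>\<U>. V \<inter> U \<noteq> {}}"
    unfolding U(2) by blast
  moreover have "countable {V\<in>\<U>. V \<inter> U \<noteq> {}}" using assms U(1) unfolding star_countable_def by blast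
  ultimately show "countable {B \<in> (\<lambda>U. {x\<in>T. h x \<in> U}) ` \<U>. B \<inter> A \<noteq> {}}"
    by (meson countable_image countable_subset)
qed

text \<open>The preimages of the covers of the factors, arranged in one sequence \<open>\<W>\<close>, have members forming a
  subbase of \<open>X\<close>, so their meets form a base.\<close>

lemma star_countable_open_base_if_embedded_in_product:
  fixes Y :: "nat \<Rightarrow> 'b topology"
  assumes e: "embedding_map X (product_topology Y I) e"
    and Y: "\<And>i. i \<in> I \<Longrightarrow> \<exists>\<U>. open_cover_base (Y i) \<U> \<and> (\<forall>n. star_countable (\<U> n))"
  shows "\<exists>\<U>. open_cover_base X \<U> \<and> (\<forall>n. star_countable (\<U> n))"
proof -
  from bchoice[of I "\<lambda>i \<U>. open_cover_base (Y i) \<U> \<and> (\<forall>n. star_countable (\<U> n))"] Y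
  obtain \<V> where "\<forall>i\<in>I. open_cover_base (Y i) (\<V> i) \<and> (\<forall>n. star_countable (\<V> i n))" by blast
  then have base: "\<And>i. i \<in> I \<Longrightarrow> open_cover_base (Y i) (\<V> i)"
    and sc: "\<And>i n. i \<in> I \<Longrightarrow> star_countable (\<V> i n)" by simp_all
  have econt: "continuous_map X (product_topology Y I) e" by (rule embedding_map_imp_continuous_map[OF e])
  have coord: "continuous_map X (Y i) (\<lambda>x. e x i)" if "i \<in> I" for i
    using continuous_map_compose[OF econt continuous_map_product_projection[OF that]] by (simp add: o_def)
  have etop: "e x \<in> topspace (product_topology Y I)" if "x \<in> topspace X" for x
    using econt that by (auto simp only: continuous_map_def)
  define pre where "pre i U = {x\<in>topspace X. e x i \<in> U}" for i U
  define \<W> where "\<W> k = (let i = fst (prod_decode k); n = snd (prod_decode k) in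
      if i \<in> I then pre i ` \<V> i n else {topspace X})" for k
  have \<W>in: "\<W> (prod_encode (i, n)) = pre i ` \<V> i n" if "i \<in> I" for i n
    unfolding \<W>_def using that by simp
  have \<W>sc: "star_countable (\<W> k)" for k
  proof (cases "fst (prod_decode k) \<in> I")
    case True
    then show ?thesis unfolding \<W>_def Let_def pre_def using star_countable_preimage[OF sc[OF True]] by simp
  next
    case False
    have "finite {V\<in>{topspace X}. V \<inter> U \<noteq> {}}" for U by simp
    then show ?thesis using False unfolding \<W>_def Let_def star_countable_def by (simp add: countable_finite)
  qed
  have \<W>cov: "cover_of (topspace X) (\<W> k)" for k
  proof (cases "fst (prod_decode k) \<in> I")
    case True
    define i where "i = fst (prod_decode k)"
    have "\<Union>(\<V> i (snd (prod_decode k))) = topspace (Y i)"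
      using base[of i] True unfolding open_cover_base_def cover_of_def i_def by simp
    moreover have "e x i \<in> topspace (Y i)" if "x \<in> topspace X" for x
      using coord[of i] True that unfolding continuous_map_def i_def by auto
    ultimately have "\<exists>U\<in>\<V> i (snd (prod_decode k)). e x i \<in> U" if "x \<in> topspace X" for x
      using that by blast
    then show ?thesis unfolding cover_of_def \<W>_def Let_def pre_def using True by (auto simp: i_def)
  qed (simp add: \<W>_def Let_def cover_of_def)
  have \<W>op: "openin X U" if U: "U \<in> \<W> k" for U k
  proof (cases "fst (prod_decode k) \<in> I")
    case True
    then obtain V where V: "V \<in> \<V> (fst (prod_decode k)) (snd (prod_decode k))" "U = pre (fst (prod_decode k)) V"
      using U unfolding \<W>_def Let_def by auto
    have "openin (Y (fst (prod_decode k))) V"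
      using base[OF True] V(1) unfolding open_cover_base_def by blast
    then show ?thesis
      unfolding V(2) pre_def by (rule openin_continuous_map_preimage[OF coord[OF True]])
  qed (use U in \<open>simp add: \<W>_def Let_def\<close>)
  have "open_cover_base X (cover_meet \<W>)"
    unfolding open_cover_base_def
  proof (intro conjI allI impI ballI)
    show "cover_of (topspace X) (cover_meet \<W> n)" for n by (rule cover_of_cover_meet[OF \<W>cov])
    show "openin X U" if "U \<in> cover_meet \<W> n" for U n by (rule openin_cover_meet[OF \<W>op that])
  next
    fix W x assume W: "openin X W \<and> x \<in> W"
    then have x: "x \<in> topspace X" using openin_subset[of X W] by blast
    from W have "openin X W" ..
    from embedding_map_openin[OF e this] obtain V where
      V: "openin (product_topology Y I) V" "\<And>x. x \<in> topspace X \<Longrightarrow> e x \<in> V \<longleftrightarrow> x \<in> W" by metis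
    have "e x \<in> V" using V(2)[OF x] W by simp
    with V(1) have "\<exists>U. finite {i \<in> I. U i \<noteq> topspace (Y i)} \<and> (\<forall>i\<in>I. openin (Y i) (U i)) \<and>
        e x \<in> Pi\<^sub>E I U \<and> Pi\<^sub>E I U \<subseteq> V"
      unfolding openin_product_topology_alt by blast
    then obtain U where U: "finite {i \<in> I. U i \<noteq> topspace (Y i)}" "\<And>i. i \<in> I \<Longrightarrow> openin (Y i) (U i)"
      "e x \<in> Pi\<^sub>E I U" "Pi\<^sub>E I U \<subseteq> V" by auto
    define J where "J = {i \<in> I. U i \<noteq> topspace (Y i)}"
    have "\<forall>i\<in>I. \<exists>p. snd p \<in> \<V> i (fst p) \<and> e x i \<in> snd p \<and> snd p \<subseteq> U i"
    proof
      fix i assume i: "i \<in> I"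
      have "openin (Y i) (U i) \<and> e x i \<in> U i" using U(2,3) i by (auto simp: PiE_iff)
      then have "\<exists>n. \<exists>A\<in>\<V> i n. e x i \<in> A \<and> A \<subseteq> U i"
        using base[OF i] unfolding open_cover_base_def by simp
      then obtain n A where "A \<in> \<V> i n" "e x i \<in> A" "A \<subseteq> U i" by blast
      then show "\<exists>p. snd p \<in> \<V> i (fst p) \<and> e x i \<in> snd p \<and> snd p \<subseteq> U i"
        by (intro exI[of _ "(n, A)"]) simp
    qed
    from bchoice[OF this] obtain p where
      p: "\<forall>i\<in>I. snd (p i) \<in> \<V> i (fst (p i)) \<and> e x i \<in> snd (p i) \<and> snd (p i) \<subseteq> U i" ..
    define c where "c i = prod_encode (i, fst (p i))" for i
    have "finite (c ` J)" using U(1) unfolding J_def by blast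
    then obtain N where N: "\<And>i. i \<in> J \<Longrightarrow> c i \<le> N"
      unfolding finite_nat_set_iff_bounded_le by blast
    have "\<exists>A. A \<in> \<W> k \<and> x \<in> A" for k
    proof -
      have "x \<in> \<Union>(\<W> k)" using \<W>cov[of k] x unfolding cover_of_def by simp
      then show ?thesis by blast
    qed
    then obtain A where A: "\<And>k. A k \<in> \<W> k" "\<And>k. x \<in> A k" by metis
    define B where "B k = (if k \<in> c ` J then pre (fst (prod_decode k)) (snd (p (fst (prod_decode k)))) else A k)" for k
    have Bc: "B (c i) = pre i (snd (p i))" if "i \<in> J" for i
      using that unfolding B_def c_def by simp
    have B: "B k \<in> \<W> k \<and> x \<in> B k" for k
    proof (cases "k \<in> c ` J")
      case True
      then obtain i where i: "i \<in> J" "k = c i" by blast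
      have "i \<in> I" using i(1) unfolding J_def by simp
      have "x \<in> pre i (snd (p i))" unfolding pre_def using p \<open>i \<in> I\<close> x by simp
      moreover have "pre i (snd (p i)) \<in> \<W> (c i)"
        unfolding c_def \<W>in[OF \<open>i \<in> I\<close>] using p \<open>i \<in> I\<close> by simp
      ultimately show ?thesis unfolding i(2) Bc[OF i(1)] by simp
    qed (use A in \<open>simp add: B_def\<close>)
    have "(\<Inter>k\<le>N. B k) \<in> cover_meet \<W> N" using B by (intro cover_meetI) simp
    moreover have "x \<in> (\<Inter>k\<le>N. B k)" using B by simp
    moreover have "(\<Inter>k\<le>N. B k) \<subseteq> W"
    proof
      fix y assume y: "y \<in> (\<Inter>k\<le>N. B k)"
      have "B 0 \<subseteq> topspace X" by (rule openin_subset[OF \<W>op]) (use B in blast)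
      then have yX: "y \<in> topspace X" using y by blast
      have "e y i \<in> U i" if i: "i \<in> I" for i
      proof (cases "i \<in> J")
        case True
        have "y \<in> B (c i)" using y N[OF True] by blast
        then have "e y i \<in> snd (p i)" unfolding Bc[OF True] pre_def by simp
        then show ?thesis using p i by blast
      next
        case False
        then show ?thesis using etop[OF yX] i unfolding J_def by (auto simp: PiE_iff)
      qed
      then have "e y \<in> Pi\<^sub>E I U" using etop[OF yX] by (auto simp: PiE_iff)
      then show "y \<in> W" using U(4) V(2)[OF yX] by blast
    qed
    ultimately show "\<exists>n. \<exists>U\<in>cover_meet \<W> n. x \<in> U \<and> U \<subseteq> W" by blast
  qed
  moreover have "star_countable (cover_meet \<W> n)" for n by (rule star_countable_cover_meet[OF \<W>sc])
  ultimately show ?thesis by blast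
qed

section \<open>Complete metrics with star-finite uniform covers\<close>

lemma star_pow_finite:
  assumes sf: "star_finite \<V>" and V: "V \<in> \<V>"
  shows "\<exists>F. finite F \<and> F \<subseteq> \<V> \<and> (star \<V> ^^ k) V \<subseteq> \<Union>F"
proof (induction k)
  case 0
  show ?case by (rule exI[of _ "{V}"]) (use V in simp)
next
  case (Suc k)
  then obtain F where F: "finite F" "F \<subseteq> \<V>" "(star \<V> ^^ k) V \<subseteq> \<Union>F" by blast
  let ?G = "\<Union>U\<in>F. {W\<in>\<V>. W \<inter> U \<noteq> {}}"
  have "finite ?G" using F(1,2) sf unfolding star_finite_def by blast
  moreover have "star \<V> ((star \<V> ^^ k) V) \<subseteq> \<Union>?G"
  proof
    fix x assume "x \<in> star \<V> ((star \<V> ^^ k) V)"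
    then obtain W y where W: "W \<in> \<V>" "x \<in> W" "y \<in> W" "y \<in> (star \<V> ^^ k) V" unfolding star_def by blast
    then obtain U where "U \<in> F" "y \<in> U" using F(3) by blast
    then show "x \<in> \<Union>?G" using W by blast
  qed
  ultimately show ?case by (intro exI[of _ ?G]) auto
qed

text \<open>A Bourbaki-Cauchy filter contains finite unions of arbitrarily small sets. Call a set positive if it
  meets every member of the filter: if a positive set is covered, up to the complement of a member of the filter,
  by finitely many sets, then its intersection with one of them is positive. This yields a decreasing
  sequence of positive sets of vanishing diameter, which converges to a cluster point.\<close>

lemma Bourbaki_complete_if_star_finite_base:
  assumes compl: "mcomplete_of m" and sfb: "star_finite_base m"
  shows "Bourbaki_complete m"
  unfolding Bourbaki_complete_def
proof (intro allI impI)
  fix \<F> assume F: "filter_on (mspace m) \<F> \<and> Bourbaki_Cauchy m \<F>"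
  have small: "\<exists>B\<in>ball_cover m n. \<exists>\<^sub>F y in \<F>. y \<in> P \<inter> B" if P: "\<exists>\<^sub>F y in \<F>. y \<in> P" for P n
  proof -
    obtain \<V> where \<V>: "\<V> \<in> metric_uniformity m" "star_finite \<V>" "refines \<V> (ball_cover m n)"
      using sfb ball_cover_in_metric_uniformity[of m n]
      unfolding star_finite_base_def uniformity_base_def by blast
    obtain k U E where U: "U \<in> \<V>" "eventually (\<lambda>x. x \<in> E) \<F>" "E \<subseteq> (star \<V> ^^ k) U"
      using F \<V>(1) unfolding Bourbaki_Cauchy_def by blast
    from star_pow_finite[OF \<V>(2) U(1), of k] obtain A where
      "finite A \<and> A \<subseteq> \<V> \<and> (star \<V> ^^ k) U \<subseteq> \<Union>A" ..
    then have A: "finite A" "A \<subseteq> \<V>" "(star \<V> ^^ k) U \<subseteq> \<Union>A" by simp_all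
    have "E \<subseteq> \<Union>A" using U(3) A(3) by (rule subset_trans)
    have "\<exists>\<^sub>F y in \<F>. y \<in> P \<and> y \<in> E" by (rule frequently_eventually_frequently[OF P U(2)])
    then have "\<exists>\<^sub>F y in \<F>. \<exists>V\<in>A. y \<in> P \<inter> V"
      by (rule frequently_elim1) (use \<open>E \<subseteq> \<Union>A\<close> in blast)
    from frequently_bex_finite[OF A(1) this]
    obtain V where V: "V \<in> A" "\<exists>\<^sub>F y in \<F>. y \<in> P \<inter> V" by blast
    then obtain B where B: "B \<in> ball_cover m n" "V \<subseteq> B" using A(2) \<V>(3) unfolding refines_def by blast
    have "\<exists>\<^sub>F y in \<F>. y \<in> P \<inter> B" by (rule frequently_elim1[OF V(2)]) (use B(2) in blast)
    then show ?thesis using B(1) by blast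
  qed
  define Good where "Good n P \<longleftrightarrow> (\<exists>\<^sub>F y in \<F>. y \<in> P) \<and> P \<subseteq> mspace m \<and> (\<exists>B\<in>ball_cover m n. P \<subseteq> B)" for n P
  have step: "\<exists>P'. Good n P' \<and> P' \<subseteq> P" if P: "\<exists>\<^sub>F y in \<F>. y \<in> P" "P \<subseteq> mspace m" for n P
  proof -
    obtain B where "B \<in> ball_cover m n" "\<exists>\<^sub>F y in \<F>. y \<in> P \<inter> B" using small[OF P(1)] by blast
    then show ?thesis unfolding Good_def using P(2) by (intro exI[of _ "P \<inter> B"]) blast
  qed
  have "\<exists>P. \<forall>n. Good n (P n) \<and> P (Suc n) \<subseteq> P n"
  proof (rule dependent_nat_choice)
    have "\<exists>\<^sub>F y in \<F>. y \<in> mspace m"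
      using F unfolding filter_on_def by (auto intro: eventually_frequently)
    then show "\<exists>P. Good 0 P" using step[of "mspace m" 0] by blast
    show "\<exists>P'. Good (Suc n) P' \<and> P' \<subseteq> P" if "Good n P" for n P
      using step[of P "Suc n"] that unfolding Good_def by blast
  qed
  then obtain P where P: "\<forall>n. Good n (P n) \<and> P (Suc n) \<subseteq> P n" ..
  have Pdec: "P k \<subseteq> P n" if "n \<le> k" for n k
    using lift_Suc_antimono_le[of P, OF _ that] P by blast
  have Pm: "P n \<subseteq> mspace m" and Pfreq: "\<exists>\<^sub>F y in \<F>. y \<in> P n" for n using P unfolding Good_def by blast+
  have Pdist: "mdist m x y < 2 / Suc n" if "x \<in> P n" "y \<in> P n" for x y n
  proof -
    obtain B where B: "B \<in> ball_cover m n" "P n \<subseteq> B" using P unfolding Good_def by blast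
    then obtain z where z: "z \<in> mspace m" "B = mball_of m z (1 / Suc n)" unfolding ball_cover_def by blast
    have "x \<in> mball_of m z (1 / Suc n)" "y \<in> mball_of m z (1 / Suc n)" using B(2) that z(2) by blast+
    then have "mdist m z x < 1 / Suc n" "mdist m z y < 1 / Suc n" "x \<in> mspace m" "y \<in> mspace m" by simp_all
    moreover have "mdist m x y \<le> mdist m x z + mdist m z y" using z(1) calculation(3,4) by (intro mdist_triangle)
    moreover have "2 / real (Suc n) = 1 / Suc n + 1 / Suc n" by simp
    ultimately show ?thesis using mdist_commute[of m x z] by linarith
  qed
  have "\<exists>x. x \<in> P n" for n using frequently_ex[OF Pfreq] .
  then obtain x where x: "\<And>n. x n \<in> P n" by metis
  have xm: "x n \<in> mspace m" for n using x Pm by blast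
  have "\<exists>N. \<forall>k\<ge>N. \<forall>l\<ge>N. mdist m (x k) (x l) < \<epsilon>" if \<epsilon>: "\<epsilon> > 0" for \<epsilon> :: real
  proof -
    have "\<epsilon> / 2 > 0" using \<epsilon> by simp
    then obtain N where N: "1 / Suc N < \<epsilon> / 2" using nat_approx_posE by blast
    have "mdist m (x k) (x l) < \<epsilon>" if "k \<ge> N" "l \<ge> N" for k l
    proof -
      have "x k \<in> P N" "x l \<in> P N" using x Pdec that by blast+
      then have "mdist m (x k) (x l) < 2 / Suc N" by (rule Pdist)
      then show ?thesis using N by simp
    qed
    then show ?thesis by blast
  qed
  from mcomplete_of_limit[OF compl xm this] obtain l where
    l: "l \<in> mspace m" "\<forall>\<epsilon>>0. \<exists>N. \<forall>k\<ge>N. mdist m (x k) l < \<epsilon>" by blast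
  have "cluster_point (mtopology_of m) \<F> l"
    unfolding cluster_point_def
  proof (intro conjI allI impI)
    fix E assume E: "eventually (\<lambda>y. y \<in> E) \<F>"
    show "l \<in> mtopology_of m closure_of E"
      unfolding in_closure_of
    proof (intro conjI allI impI)
      fix W assume W: "l \<in> W \<and> openin (mtopology_of m) W"
      then have "\<exists>r>0. mball_of m l r \<subseteq> W" by (simp add: openin_mtopology_of)
      then obtain r where r: "r > 0" "mball_of m l r \<subseteq> W" by blast
      have "r / 4 > 0" using r(1) by simp
      then obtain n where n: "1 / Suc n < r / 4" using nat_approx_posE by blast
      have "\<exists>N. \<forall>k\<ge>N. mdist m (x k) l < r / 2" using l(2)[rule_format, OF half_gt_zero[OF r(1)]] .
      then obtain N where N: "\<forall>k\<ge>N. mdist m (x k) l < r / 2" ..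
      define k where "k = max n N"
      have "\<exists>\<^sub>F y in \<F>. y \<in> P n \<and> y \<in> E" by (rule frequently_eventually_frequently[OF Pfreq E])
      then obtain y where y: "y \<in> P n" "y \<in> E" using frequently_ex by blast
      have "x k \<in> P n" using x Pdec[of n k] unfolding k_def by auto
      then have "mdist m (x k) y < 2 / Suc n" using y(1) by (rule Pdist)
      moreover have "2 / real (Suc n) = 2 * (1 / Suc n)" by simp
      ultimately have "mdist m (x k) y < r / 2" using n by linarith
      moreover have "mdist m (x k) l < r / 2" using N unfolding k_def by simp
      moreover have ym: "y \<in> mspace m" using y(1) Pm by blast
      moreover have "mdist m l y \<le> mdist m l (x k) + mdist m (x k) y"
        using l(1) xm ym by (intro mdist_triangle)
      ultimately have "y \<in> mball_of m l r" using l(1) mdist_commute[of m l "x k"] by simp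
      then show "\<exists>y. y \<in> E \<and> y \<in> W" using r(2) y(2) by blast
    qed (use l(1) in simp)
  qed (use l(1) in simp)
  then show "\<exists>x. cluster_point (mtopology_of m) \<F> x" ..
qed

lemma strongly_metrizable_if_star_finite_base:
  assumes "star_finite_base m"
  shows "strongly_metrizable (mtopology_of m)"
proof -
  let ?X = "mtopology_of m"
  have "\<forall>n. \<exists>\<V>. \<V> \<in> metric_uniformity m \<and> star_finite \<V> \<and> (\<forall>V\<in>\<V>. openin ?X V) \<and> refines \<V> (ball_cover m n)"
    using assms ball_cover_in_metric_uniformity[of m]
    unfolding star_finite_base_def uniformity_base_def by blast
  from choice[OF this] obtain \<V> where \<V>: "\<forall>n. \<V> n \<in> metric_uniformity m \<and> star_finite (\<V> n) \<and>
      (\<forall>V\<in>\<V> n. openin ?X V) \<and> refines (\<V> n) (ball_cover m n)" ..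
  have cov: "cover_of (topspace ?X) (\<V> n)" for n
    using \<V> unfolding metric_uniformity_def by simp
  have "open_cover_base ?X \<V>"
    unfolding open_cover_base_def
  proof (intro conjI allI impI ballI)
    show "cover_of (topspace ?X) (\<V> n)" for n by (rule cov)
    show "openin ?X U" if "U \<in> \<V> n" for U n using \<V> that by simp
  next
    fix W x assume W: "openin ?X W \<and> x \<in> W"
    then obtain n r where nr: "mball_of m x r \<subseteq> W" "1 / Suc n < r / 2"
      using mball_of_radius[of m W x] by blast
    have "x \<in> \<Union>(\<V> n)" using W openin_subset[of ?X W] cov[of n] unfolding cover_of_def by blast
    then obtain V where V: "V \<in> \<V> n" "x \<in> V" by blast
    then obtain B where B: "B \<in> ball_cover m n" "V \<subseteq> B" using \<V> unfolding refines_def by blast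
    then have "B \<subseteq> mball_of m x r" using ball_cover_subset_mball_of[OF B(1) _ nr(2)] V(2) by blast
    then show "\<exists>n. \<exists>U\<in>\<V> n. x \<in> U \<and> U \<subseteq> W" using V B(2) nr(1) by blast
  qed
  then show ?thesis unfolding strongly_metrizable_iff using \<V> by blast
qed

lemma star_countable_base_if_star_finite_base:
  assumes "star_finite_base m"
  shows "star_countable_base m"
  using assms star_finite_imp_star_countable
  unfolding star_finite_base_def star_countable_base_def uniformity_base_def by blast

section \<open>The complete metric of a closed subspace of the product\<close>

text \<open>The metric pulled back along \<open>h\<close> is the supremum of the distances of the \<open>n\<close>-th coordinates, weighted by
  \<open>1 / Suc n\<close>. The discrete and the real coordinate of index \<open>n\<close> are treated together, by a distance
  bounded by 1.\<close>

definition coord_dist :: "('a \<Rightarrow> (nat \<Rightarrow> 'd) \<times> (nat \<Rightarrow> real)) \<Rightarrow> nat \<Rightarrow> 'a \<Rightarrow> 'a \<Rightarrow> real"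
  where "coord_dist h n x y =
    (if fst (h x) n = fst (h y) n then min 1 \<bar>snd (h x) n - snd (h y) n\<bar> else 1)"

definition Baire_dist :: "('a \<Rightarrow> (nat \<Rightarrow> 'd) \<times> (nat \<Rightarrow> real)) \<Rightarrow> 'a \<Rightarrow> 'a \<Rightarrow> real"
  where "Baire_dist h x y = (SUP n. coord_dist h n x y / Suc n)"

lemma coord_dist_bounds: "0 \<le> coord_dist h n x y" "coord_dist h n x y \<le> 1"
  by (auto simp: coord_dist_def)

lemma coord_dist_eq_0_iff:
  "coord_dist h n x y = 0 \<longleftrightarrow> fst (h x) n = fst (h y) n \<and> snd (h x) n = snd (h y) n"
  by (auto simp: coord_dist_def min_def)

lemma coord_dist_lessD:
  "coord_dist h n x y < min 1 r \<Longrightarrow> fst (h x) n = fst (h y) n \<and> \<bar>snd (h x) n - snd (h y) n\<bar> < r"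
  by (auto simp: coord_dist_def min_def split: if_splits)

lemma coord_dist_le:
  "fst (h x) n = fst (h y) n \<Longrightarrow> coord_dist h n x y \<le> \<bar>snd (h x) n - snd (h y) n\<bar>"
  by (simp add: coord_dist_def)

lemma coord_dist_commute: "coord_dist h n x y = coord_dist h n y x"
  by (simp add: coord_dist_def abs_minus_commute eq_commute)

lemma coord_dist_triangle: "coord_dist h n x z \<le> coord_dist h n x y + coord_dist h n y z"
  by (auto simp: coord_dist_def min_def)

lemma coord_dist_le_Baire_dist: "coord_dist h n x y / Suc n \<le> Baire_dist h x y"
  unfolding Baire_dist_def
proof (rule cSUP_upper)
  have "coord_dist h n x y / Suc n \<le> 1" for n
    using coord_dist_bounds(2)[of h n x y] by (simp add: divide_le_eq)
  then show "bdd_above (range (\<lambda>n. coord_dist h n x y / Suc n))" by (intro bdd_aboveI[of _ 1]) auto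
qed simp

lemma coord_dist_less:
  assumes "Baire_dist h x y < r / Suc n"
  shows "coord_dist h n x y < r"
proof -
  have "coord_dist h n x y / Suc n < r / Suc n"
    using coord_dist_le_Baire_dist[of h n x y] assms by linarith
  then show ?thesis by (simp add: divide_less_cancel)
qed

lemma Baire_dist_le:
  assumes "\<And>n. n \<le> N \<Longrightarrow> coord_dist h n x y \<le> r" and N: "1 / Suc N \<le> r"
  shows "Baire_dist h x y \<le> r"
  unfolding Baire_dist_def
proof (rule cSUP_least)
  fix n
  show "coord_dist h n x y / Suc n \<le> r"
  proof (cases "n \<le> N")
    case True
    have "coord_dist h n x y / Suc n \<le> coord_dist h n x y"
      using coord_dist_bounds(1)[of h n x y] by (simp add: divide_le_eq mult_le_cancel_left1)
    then show ?thesis using assms(1)[OF True] by linarith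
  next
    case False
    have "coord_dist h n x y / Suc n \<le> 1 / Suc n"
      using coord_dist_bounds(2)[of h n x y] by (simp add: divide_right_mono)
    also have "\<dots> \<le> 1 / Suc N" using False by (simp add: frac_le)
    finally show ?thesis using N by linarith
  qed
qed simp

lemma Metric_space_Baire_dist:
  assumes inj: "inj_on h M"
  shows "Metric_space M (Baire_dist h)"
proof
  show nn: "0 \<le> Baire_dist h x y" for x y
    using coord_dist_le_Baire_dist[of h 0 x y] coord_dist_bounds(1)[of h 0 x y] by simp
  show "Baire_dist h x y = Baire_dist h y x" for x y
    unfolding Baire_dist_def by (simp add: coord_dist_commute[of h _ x y])
  show "Baire_dist h x y = 0 \<longleftrightarrow> x = y" if "x \<in> M" "y \<in> M" for x y
  proof
    assume d: "Baire_dist h x y = 0"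
    have "coord_dist h n x y = 0" for n
      using coord_dist_le_Baire_dist[of h n x y] coord_dist_bounds(1)[of h n x y] d
      by (simp add: divide_le_eq)
    then have "fst (h x) n = fst (h y) n \<and> snd (h x) n = snd (h y) n" for n
      unfolding coord_dist_eq_0_iff by blast
    then have "h x = h y" by (simp add: prod_eq_iff fun_eq_iff)
    then show "x = y" using inj that by (simp add: inj_on_def)
  next
    assume "x = y"
    then have "Baire_dist h x y = (SUP n::nat. 0)" unfolding Baire_dist_def coord_dist_def by simp
    then show "Baire_dist h x y = 0" by simp
  qed
  show "Baire_dist h x z \<le> Baire_dist h x y + Baire_dist h y z" for x y z
    unfolding Baire_dist_def[of h x z]
  proof (rule cSUP_least)
    fix n
    have "coord_dist h n x z / Suc n \<le> (coord_dist h n x y + coord_dist h n y z) / Suc n"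
      by (rule divide_right_mono[OF coord_dist_triangle]) simp
    also have "\<dots> = coord_dist h n x y / Suc n + coord_dist h n y z / Suc n"
      by (rule add_divide_distrib)
    finally show "coord_dist h n x z / Suc n \<le> Baire_dist h x y + Baire_dist h y z"
      using coord_dist_le_Baire_dist[of h n x y] coord_dist_le_Baire_dist[of h n y z] by linarith
  qed simp
qed

lemma embedding_map_Baire_coords:
  assumes e: "embedding_map X (Baire_cube D) h"
  shows "continuous_map X (discrete_topology D) (\<lambda>x. fst (h x) n)"
    "continuous_map X euclideanreal (\<lambda>x. snd (h x) n)"
  using embedding_map_imp_continuous_map[OF e] unfolding continuous_map_Baire_cube by simp_all

lemma openin_coord_ball:
  assumes e: "embedding_map X (Baire_cube D) h"
  shows "openin X {y\<in>topspace X. fst (h y) n = c \<and> \<bar>snd (h y) n - t\<bar> < r}"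
proof -
  have "openin X {y\<in>topspace X. fst (h y) n \<in> D \<inter> {c}}"
    by (rule openin_continuous_map_preimage[OF embedding_map_Baire_coords(1)[OF e]]) simp
  moreover have "openin X {y\<in>topspace X. snd (h y) n \<in> ball t r}"
    by (rule openin_continuous_map_preimage[OF embedding_map_Baire_coords(2)[OF e]]) simp
  ultimately have "openin X ({y\<in>topspace X. fst (h y) n \<in> D \<inter> {c}} \<inter> {y\<in>topspace X. snd (h y) n \<in> ball t r})"
    by (rule openin_Int)
  moreover have "fst (h y) n \<in> D" if "y \<in> topspace X" for y
    using embedding_map_Baire_coords(1)[OF e, of n] that by (auto simp: continuous_map_def)
  then have "{y\<in>topspace X. fst (h y) n \<in> D \<inter> {c}} \<inter> {y\<in>topspace X. snd (h y) n \<in> ball t r} =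
      {y\<in>topspace X. fst (h y) n = c \<and> \<bar>snd (h y) n - t\<bar> < r}"
    by (auto simp: dist_real_def abs_minus_commute)
  ultimately show ?thesis by simp
qed

lemma mtopology_of_Baire_dist:
  assumes e: "embedding_map X (Baire_cube D) h" and m: "m = metric (topspace X, Baire_dist h)"
  shows "mspace m = topspace X" "mdist m = Baire_dist h" "mtopology_of m = X"
proof -
  have "inj_on h (topspace X)"
    using e by (simp add: embedding_map_def homeomorphic_map_def)
  then interpret Metric_space "topspace X" "Baire_dist h" by (rule Metric_space_Baire_dist)
  show space: "mspace m = topspace X" and dist: "mdist m = Baire_dist h" unfolding m by simp_all
  have ball_iff: "y \<in> mball_of m x r \<longleftrightarrow> x \<in> topspace X \<and> y \<in> topspace X \<and> Baire_dist h x y < r" for x y r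
    by (simp add: space dist)
  have "openin (mtopology_of m) U \<longleftrightarrow> openin X U" for U
  proof
    assume U: "openin (mtopology_of m) U"
    show "openin X U"
    proof (subst openin_subopen, intro ballI)
      fix x assume x: "x \<in> U"
      obtain n r where r: "mball_of m x r \<subseteq> U" "1 / Suc n < r / 2" "0 < r"
        using mball_of_radius[OF U x] by blast
      have xX: "x \<in> topspace X" using U x openin_subset[OF U] space by auto
      let ?B = "\<lambda>k. {y\<in>topspace X. fst (h y) k = fst (h x) k \<and> \<bar>snd (h y) k - snd (h x) k\<bar> < r / 2}"
      have "openin X (topspace X \<inter> \<Inter>(?B ` {..n}))"
        by (rule openin_Int_Inter) (auto intro: openin_coord_ball[OF e] simp del: less_divide_eq_numeral1)
      moreover have "x \<in> topspace X \<inter> \<Inter>(?B ` {..n})" using xX r(3) by simp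
      moreover have "topspace X \<inter> \<Inter>(?B ` {..n}) \<subseteq> U"
      proof
        fix y assume y: "y \<in> topspace X \<inter> \<Inter>(?B ` {..n})"
        have "coord_dist h k x y \<le> r / 2" if "k \<le> n" for k
        proof -
          have "fst (h y) k = fst (h x) k" "\<bar>snd (h y) k - snd (h x) k\<bar> < r / 2" using y that by auto
          then show ?thesis using coord_dist_le[of h x k y] abs_minus_commute[of "snd (h x) k"] by simp
        qed
        then have "Baire_dist h x y \<le> r / 2" by (rule Baire_dist_le[where N = n]) (use r(2) in linarith)+
        then have "y \<in> mball_of m x r" unfolding ball_iff using y xX r(3) by auto
        then show "y \<in> U" using r(1) by blast
      qed
      ultimately show "\<exists>T. openin X T \<and> x \<in> T \<and> T \<subseteq> U" by blast
    qed
  next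
    assume U: "openin X U"
    have top: "topspace (mtopology_of m) = topspace X" by (simp add: space)
    have near: "fst (h x) n = fst (h y) n \<and> \<bar>snd (h x) n - snd (h y) n\<bar> < r"
      if "y \<in> mball_of m x (min 1 r / Suc n)" for x y n r
    proof -
      have "coord_dist h n x y < min 1 r" by (rule coord_dist_less) (use that ball_iff in blast)
      then show ?thesis by (rule coord_dist_lessD)
    qed
    have "continuous_map (mtopology_of m) (Baire_cube D) h"
      unfolding continuous_map_Baire_cube
    proof (intro conjI allI)
      fix n
      have mapsto: "fst (h x) n \<in> D" if "x \<in> topspace X" for x
        using embedding_map_Baire_coords(1)[OF e, of n] that by (auto simp: continuous_map_def)
      have "openin (mtopology_of m) {x \<in> topspace X. fst (h x) n \<in> A}" for A
        unfolding openin_mtopology_of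
      proof (intro conjI ballI)
        fix x assume x: "x \<in> {x \<in> topspace X. fst (h x) n \<in> A}"
        have "mball_of m x (min 1 1 / Suc n) \<subseteq> {x \<in> topspace X. fst (h x) n \<in> A}"
        proof
          fix y assume y: "y \<in> mball_of m x (min 1 1 / Suc n)"
          then have "fst (h x) n = fst (h y) n" using near by blast
          moreover have "y \<in> topspace X" using y unfolding ball_iff by blast
          ultimately show "y \<in> {x \<in> topspace X. fst (h x) n \<in> A}" using x by simp
        qed
        then show "\<exists>r>0. mball_of m x r \<subseteq> {x \<in> topspace X. fst (h x) n \<in> A}"
          by (intro exI[of _ "min 1 1 / real (Suc n)"]) simp
      qed (auto simp: space)
      then show "continuous_map (mtopology_of m) (discrete_topology D) (\<lambda>x. fst (h x) n)"
        unfolding continuous_map_def top using mapsto by auto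
      have "openin (mtopology_of m) {x \<in> topspace X. snd (h x) n \<in> A}" if A: "open A" for A
        unfolding openin_mtopology_of
      proof (intro conjI ballI)
        fix x assume x: "x \<in> {x \<in> topspace X. snd (h x) n \<in> A}"
        then obtain r where r: "r > 0" "ball (snd (h x) n) r \<subseteq> A" using A open_contains_ball by blast
        have "mball_of m x (min 1 r / Suc n) \<subseteq> {x \<in> topspace X. snd (h x) n \<in> A}"
        proof
          fix y assume y: "y \<in> mball_of m x (min 1 r / Suc n)"
          then have "\<bar>snd (h x) n - snd (h y) n\<bar> < r" using near by blast
          then have "snd (h y) n \<in> A" using r(2) by (auto simp: dist_real_def subset_iff)
          moreover have "y \<in> topspace X" using y unfolding ball_iff by blast
          ultimately show "y \<in> {x \<in> topspace X. snd (h x) n \<in> A}" by simp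
        qed
        then show "\<exists>r>0. mball_of m x r \<subseteq> {x \<in> topspace X. snd (h x) n \<in> A}"
          using r(1) by (intro exI[of _ "min 1 r / real (Suc n)"]) simp
      qed (auto simp: space)
      then show "continuous_map (mtopology_of m) euclideanreal (\<lambda>x. snd (h x) n)"
        unfolding continuous_map_def top by auto
    qed
    moreover obtain V where V: "openin (Baire_cube D) V" "\<And>x. x \<in> topspace X \<Longrightarrow> h x \<in> V \<longleftrightarrow> x \<in> U"
      using embedding_map_openin[OF e U] by metis
    ultimately have "openin (mtopology_of m) {x \<in> topspace (mtopology_of m). h x \<in> V}"
      by (intro openin_continuous_map_preimage)
    moreover have "{x \<in> topspace (mtopology_of m). h x \<in> V} = U"
      using V(2) openin_subset[OF U] unfolding top by blast
    ultimately show "openin (mtopology_of m) U" by simp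
  qed
  then show "mtopology_of m = X" by (simp add: topology_eq)
qed

lemma mcomplete_of_Baire_dist:
  assumes e: "embedding_map X (Baire_cube D) h" and m: "m = metric (topspace X, Baire_dist h)"
    and cl: "closedin (Baire_cube D) (h ` topspace X)"
  shows "mcomplete_of m"
proof -
  have "inj_on h (topspace X)"
    using e by (simp add: embedding_map_def homeomorphic_map_def)
  then interpret Metric_space "topspace X" "Baire_dist h" by (rule Metric_space_Baire_dist)
  have "\<exists>x. limitin mtopology \<sigma> x sequentially" if \<sigma>: "MCauchy \<sigma>" for \<sigma>
  proof -
    have M: "\<And>k. \<sigma> k \<in> topspace X" and
      cauchy: "\<And>\<epsilon>. \<epsilon> > 0 \<Longrightarrow> \<exists>N. \<forall>k l. N \<le> k \<longrightarrow> N \<le> l \<longrightarrow> Baire_dist h (\<sigma> k) (\<sigma> l) < \<epsilon>"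
      using \<sigma> unfolding MCauchy_def by blast+
    have close: "\<exists>N. \<forall>k l. N \<le> k \<longrightarrow> N \<le> l \<longrightarrow> fst (h (\<sigma> k)) n = fst (h (\<sigma> l)) n \<and>
        \<bar>snd (h (\<sigma> k)) n - snd (h (\<sigma> l)) n\<bar> < r" if r: "r > 0" for n r
    proof -
      have "min 1 r / Suc n > 0" using r by simp
      from cauchy[OF this] obtain N where
        N: "\<forall>k l. N \<le> k \<longrightarrow> N \<le> l \<longrightarrow> Baire_dist h (\<sigma> k) (\<sigma> l) < min 1 r / Suc n" ..
      have less: "coord_dist h n (\<sigma> k) (\<sigma> l) < min 1 r" if "N \<le> k" "N \<le> l" for k l
        by (rule coord_dist_less) (use N that in blast)
      have "fst (h (\<sigma> k)) n = fst (h (\<sigma> l)) n \<and> \<bar>snd (h (\<sigma> k)) n - snd (h (\<sigma> l)) n\<bar> < r"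
        if "N \<le> k" "N \<le> l" for k l
        by (rule coord_dist_lessD) (use that in \<open>rule less\<close>)
      then show ?thesis by (intro exI[of _ N] allI impI)
    qed
    have "\<forall>n. \<exists>a. \<exists>N. \<forall>k\<ge>N. fst (h (\<sigma> k)) n = a"
    proof
      fix n
      obtain N where N: "\<forall>k l. N \<le> k \<longrightarrow> N \<le> l \<longrightarrow> fst (h (\<sigma> k)) n = fst (h (\<sigma> l)) n \<and>
        \<bar>snd (h (\<sigma> k)) n - snd (h (\<sigma> l)) n\<bar> < 1"
        using close[OF zero_less_one, of n] by (elim exE)
      then show "\<exists>a. \<exists>N. \<forall>k\<ge>N. fst (h (\<sigma> k)) n = a"
        by (intro exI[of _ "fst (h (\<sigma> N)) n"] exI[of _ N]) blast
    qed
    from choice[OF this] obtain a where a: "\<forall>n. \<exists>N. \<forall>k\<ge>N. fst (h (\<sigma> k)) n = a n" ..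
    have "Cauchy (\<lambda>k. snd (h (\<sigma> k)) n)" for n
      unfolding Cauchy_def dist_real_def using close[of _ n] by meson
    then have "\<forall>n. \<exists>b. (\<lambda>k. snd (h (\<sigma> k)) n) \<longlonglongrightarrow> b"
      by (simp add: Cauchy_convergent_iff convergent_def)
    then obtain b where b: "\<And>n. (\<lambda>k. snd (h (\<sigma> k)) n) \<longlonglongrightarrow> b n" by metis
    have hD: "fst (h (\<sigma> k)) n \<in> D" for k n
      using embedding_map_Baire_coords(1)[OF e, of n] M by (auto simp: continuous_map_def)
    have aD: "a n \<in> D" for n using a[rule_format, of n] hD by (metis order_refl)
    have eva: "eventually (\<lambda>k. fst (h (\<sigma> k)) n = a n) sequentially" for n
        using a[rule_format, of n] unfolding eventually_sequentially .
    have "limitin (Baire_cube D) (\<lambda>k. h (\<sigma> k)) (a, b) sequentially"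
    proof -
      have "limitin (discrete_topology D) (\<lambda>k. fst (h (\<sigma> k)) n) (a n) sequentially" for n
        unfolding limitin_def using aD[of n] eventually_mono[OF eva[of n]] by auto
      moreover have "limitin euclideanreal (\<lambda>k. snd (h (\<sigma> k)) n) (b n) sequentially" for n
        using b[of n] by (simp add: limitin_canonical_iff)
      ultimately show ?thesis
        using hD by (simp add: limitin_pairwise limitin_componentwise o_def PiE_iff)
    qed
    then have "(a, b) \<in> h ` topspace X"
      by (rule limitin_closedin[OF _ cl]) (use M in auto)
    then obtain x where x: "x \<in> topspace X" "h x = (a, b)" by auto
    have "limitin mtopology \<sigma> x sequentially"
      unfolding limitin_metric
    proof (intro conjI allI impI)
      fix \<epsilon> :: real assume \<epsilon>: "\<epsilon> > 0"
      have "\<epsilon> / 2 > 0" using \<epsilon> by simp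
      then obtain N where N: "1 / Suc N < \<epsilon> / 2" using nat_approx_posE by blast
      have "eventually (\<lambda>k. coord_dist h n (\<sigma> k) x \<le> \<epsilon> / 2) sequentially" for n
        using eva[of n] tendstoD[OF b[of n] \<open>\<epsilon> / 2 > 0\<close>]
      proof eventually_elim
        case (elim k)
        then have "coord_dist h n (\<sigma> k) x \<le> \<bar>snd (h (\<sigma> k)) n - b n\<bar>"
          using coord_dist_le[of h "\<sigma> k" n x] x(2) by simp
        then show ?case using elim(2) by (simp add: dist_real_def)
      qed
      then have "eventually (\<lambda>k. \<forall>n\<in>{..N}. coord_dist h n (\<sigma> k) x \<le> \<epsilon> / 2) sequentially"
        by (intro eventually_ball_finite) auto
      then show "eventually (\<lambda>k. \<sigma> k \<in> topspace X \<and> Baire_dist h (\<sigma> k) x < \<epsilon>) sequentially"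
      proof eventually_elim
        case (elim k)
        have "Baire_dist h (\<sigma> k) x \<le> \<epsilon> / 2" by (rule Baire_dist_le[where N = N]) (use elim N in auto)
        then show ?case using M \<epsilon> by simp
      qed
    qed (rule x(1))
    then show ?thesis ..
  qed
  then have "mcomplete" unfolding mcomplete_def by blast
  then show ?thesis unfolding mcomplete_of_def m by simp
qed

lemma star_finite_subset: "star_finite \<U> \<Longrightarrow> \<V> \<subseteq> \<U> \<Longrightarrow> star_finite \<V>"
  unfolding star_finite_def by (blast intro: finite_subset[of "{V \<in> \<V>. V \<inter> U \<noteq> {}}" "{V \<in> \<U>. V \<inter> U \<noteq> {}}" for U])

text \<open>The \<open>n\<close>-th discrete coordinate partitions the space, and the intervals of radius \<open>\<delta>\<close> around the
  multiples of \<open>\<delta>\<close> form a star-finite cover by the \<open>n\<close>-th real coordinate. The meets of finitely many of these covers are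
  uniform and arbitrarily fine.\<close>

lemma star_finite_base_Baire_dist:
  assumes e: "embedding_map X (Baire_cube D) h" and m: "m = metric (topspace X, Baire_dist h)"
  shows "star_finite_base m"
proof -
  note mX = mtopology_of_Baire_dist[OF e m]
  define A where "A \<delta> n c a = {y\<in>topspace X. fst (h y) n = c \<and> \<bar>snd (h y) n - of_int a * \<delta>\<bar> < \<delta>}"
    for \<delta> n c and a :: int
  define \<W> where "\<W> \<delta> n = (\<lambda>(c, a). A \<delta> n c a) ` UNIV" for \<delta> n
  have Wop: "openin X U" if U: "U \<in> \<W> \<delta> n" for U \<delta> n
  proof -
    obtain c a where "U = A \<delta> n c a" using U unfolding \<W>_def by auto
    then show ?thesis unfolding A_def using openin_coord_ball[OF e] by simp
  qed
  have grid: "\<exists>a::int. \<bar>t - of_int a * \<delta>\<bar> \<le> \<delta> / 2" if "\<delta> > 0" for t \<delta> :: real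
  proof -
    have "\<bar>of_int (round (t / \<delta>)) - t / \<delta>\<bar> \<le> 1 / 2" by (rule of_int_round_abs_le)
    then have "\<bar>of_int (round (t / \<delta>)) - t / \<delta>\<bar> * \<delta> \<le> 1 / 2 * \<delta>"
      using that by (intro mult_right_mono) auto
    moreover have "\<bar>of_int (round (t / \<delta>)) - t / \<delta>\<bar> * \<delta> = \<bar>(of_int (round (t / \<delta>)) - t / \<delta>) * \<delta>\<bar>"
      using that by (simp add: abs_mult)
    moreover have "(of_int (round (t / \<delta>)) - t / \<delta>) * \<delta> = of_int (round (t / \<delta>)) * \<delta> - t"
      using that by (simp add: field_simps)
    ultimately show ?thesis by (intro exI[of _ "round (t / \<delta>)"]) (simp add: abs_minus_commute)
  qed
  have Wsf: "star_finite (\<W> \<delta> n)" if \<delta>: "\<delta> > 0" for \<delta> n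
    unfolding star_finite_def
  proof
    fix U assume "U \<in> \<W> \<delta> n"
    then obtain c a where U: "U = A \<delta> n c a" unfolding \<W>_def by auto
    have "{V \<in> \<W> \<delta> n. V \<inter> U \<noteq> {}} \<subseteq> A \<delta> n c ` {a - 2..a + 2}"
    proof
      fix V assume "V \<in> {V \<in> \<W> \<delta> n. V \<inter> U \<noteq> {}}"
      then obtain c' a' y where V: "V = A \<delta> n c' a'" "y \<in> V" "y \<in> U" unfolding \<W>_def by auto
      have c: "c' = c" using V U unfolding A_def by auto
      have "\<bar>snd (h y) n - of_int a * \<delta>\<bar> < \<delta>" "\<bar>snd (h y) n - of_int a' * \<delta>\<bar> < \<delta>"
        using V U unfolding A_def by auto
      then have "\<bar>of_int a' * \<delta> - of_int a * \<delta>\<bar> < 2 * \<delta>" by linarith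
      then have "\<bar>of_int (a' - a)\<bar> * \<delta> < 2 * \<delta>"
        using \<delta> by (simp add: left_diff_distrib[symmetric] abs_mult)
      then have "\<bar>of_int (a' - a)\<bar> < (2::real)" using \<delta> by simp
      then have "\<bar>a' - a\<bar> < 2" by linarith
      then show "V \<in> A \<delta> n c ` {a - 2..a + 2}" unfolding V(1) c by (intro imageI) auto
    qed
    then show "finite {V \<in> \<W> \<delta> n. V \<inter> U \<noteq> {}}" by (rule finite_subset) simp
  qed
  show ?thesis
    unfolding star_finite_base_def uniformity_base_def
  proof (intro conjI ballI)
    fix \<U> assume "\<U> \<in> metric_uniformity m"
    then obtain \<epsilon> where \<epsilon>: "\<epsilon> > 0" "refines ((\<lambda>x. mball_of m x \<epsilon>) ` mspace m) \<U>"
      unfolding metric_uniformity_def by blast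
    have "\<epsilon> / 2 > 0" using \<epsilon>(1) by simp
    then obtain N where N: "1 / Suc N < \<epsilon> / 2" using nat_approx_posE by blast
    define \<delta> where "\<delta> = \<epsilon> / 4"
    have \<delta>: "\<delta> > 0" using \<epsilon>(1) by (simp add: \<delta>_def)
    \<comment> \<open>The empty set is removed because it refines no member of \<open>\<U>\<close> when \<open>\<U>\<close> is empty.\<close>
    define \<V> where "\<V> = cover_meet (\<W> \<delta>) N - {{}}"
    have Vop: "openin X V" if "V \<in> \<V>" for V
      using openin_cover_meet[of "\<W> \<delta>" X V N] Wop that unfolding \<V>_def by blast
    have "star_finite \<V>"
      by (rule star_finite_subset[OF star_finite_cover_meet[of "\<W> \<delta>" N, OF Wsf[OF \<delta>]]]) (simp add: \<V>_def)
    moreover have leb: "\<exists>V\<in>\<V>. mball_of m x (min 1 (\<delta> / 2) / Suc N) \<subseteq> V" if x: "x \<in> topspace X" for x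
    proof -
      have "\<forall>n. \<exists>a::int. \<bar>snd (h x) n - of_int a * \<delta>\<bar> \<le> \<delta> / 2" using grid[OF \<delta>] by simp
      from choice[OF this] obtain a :: "nat \<Rightarrow> int" where
        a: "\<forall>n. \<bar>snd (h x) n - of_int (a n) * \<delta>\<bar> \<le> \<delta> / 2" ..
      let ?V = "\<Inter>n\<le>N. A \<delta> n (fst (h x) n) (a n)"
      have sub: "mball_of m x (min 1 (\<delta> / 2) / Suc N) \<subseteq> ?V"
      proof
        fix y assume y: "y \<in> mball_of m x (min 1 (\<delta> / 2) / Suc N)"
        have "y \<in> A \<delta> n (fst (h x) n) (a n)" if n: "n \<le> N" for n
        proof -
          have "Baire_dist h x y < min 1 (\<delta> / 2) / Suc N" using y by (simp add: mX)
          also have "\<dots> \<le> min 1 (\<delta> / 2) / Suc n" using n \<delta> by (simp add: frac_le)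
          finally have "coord_dist h n x y < min 1 (\<delta> / 2)" by (rule coord_dist_less)
          then have "fst (h x) n = fst (h y) n" "\<bar>snd (h x) n - snd (h y) n\<bar> < \<delta> / 2"
            using coord_dist_lessD[of h n x y "\<delta> / 2"] by blast+
          moreover have "\<bar>snd (h x) n - of_int (a n) * \<delta>\<bar> \<le> \<delta> / 2" using a by simp
          ultimately have "fst (h y) n = fst (h x) n" "\<bar>snd (h y) n - of_int (a n) * \<delta>\<bar> < \<delta>"
            by (simp, linarith)
          moreover have "y \<in> topspace X" using y by (simp add: mX)
          ultimately show ?thesis unfolding A_def by simp
        qed
        then show "y \<in> ?V" by blast
      qed
      have "min 1 (\<delta> / 2) / Suc N > 0" using \<delta> by simp
      then have "x \<in> ?V" using sub self_in_mball_of[of x m] x mX(1) by blast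
      moreover have "?V \<in> cover_meet (\<W> \<delta>) N" by (intro cover_meetI) (auto simp: \<W>_def)
      ultimately show ?thesis using sub unfolding \<V>_def by blast
    qed
    moreover have "\<V> \<in> metric_uniformity m"
    proof -
      have r: "min 1 (\<delta> / 2) / Suc N > 0" using \<delta> by simp
      have "topspace X \<subseteq> \<Union>\<V>"
      proof
        fix x assume x: "x \<in> topspace X"
        then obtain V where "V \<in> \<V>" "mball_of m x (min 1 (\<delta> / 2) / Suc N) \<subseteq> V" using leb by blast
        then show "x \<in> \<Union>\<V>" using self_in_mball_of[OF _ r, of x m] x mX(1) by blast
      qed
      moreover have "\<Union>\<V> \<subseteq> topspace X" using openin_subset[OF Vop] by (intro Union_least)
      ultimately have "cover_of (mspace m) \<V>" unfolding cover_of_def mX(1) by blast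
      moreover have "refines ((\<lambda>x. mball_of m x (min 1 (\<delta> / 2) / Suc N)) ` mspace m) \<V>"
        unfolding refines_def mX(1) using leb by simp
      ultimately show ?thesis unfolding metric_uniformity_def using r by blast
    qed
    moreover have "refines \<V> \<U>"
      unfolding refines_def
    proof
      fix V assume V: "V \<in> \<V>"
      then obtain x where x: "x \<in> V" unfolding \<V>_def by blast
      then have xX: "x \<in> topspace X" using openin_subset[OF Vop[OF V]] by blast
      have "V \<in> cover_meet (\<W> \<delta>) N" using V unfolding \<V>_def by simp
      then obtain B where B: "B \<in> (\<Pi>\<^sub>E k\<in>{..N}. \<W> \<delta> k)" "V = (\<Inter>k\<le>N. B k)"
        unfolding cover_meet_def by blast
      have "V \<subseteq> mball_of m x \<epsilon>"
      proof
        fix y assume y: "y \<in> V"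
        have "coord_dist h n x y \<le> \<epsilon> / 2" if n: "n \<le> N" for n
        proof -
          have "B n \<in> \<W> \<delta> n" using B(1) n by (simp add: PiE_iff)
          then obtain c a where "B n = A \<delta> n c a" unfolding \<W>_def by auto
          moreover have "x \<in> B n" "y \<in> B n" using x y n unfolding B(2) by blast+
          ultimately have "x \<in> A \<delta> n c a" "y \<in> A \<delta> n c a" by simp_all
          then have "fst (h x) n = fst (h y) n" "\<bar>snd (h x) n - of_int a * \<delta>\<bar> < \<delta>"
            "\<bar>snd (h y) n - of_int a * \<delta>\<bar> < \<delta>" unfolding A_def by auto
          then have "fst (h x) n = fst (h y) n" "\<bar>snd (h x) n - snd (h y) n\<bar> \<le> \<epsilon> / 2"
            unfolding \<delta>_def by (simp, linarith)
          then show ?thesis using coord_dist_le[of h x n y] by linarith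
        qed
        then have "Baire_dist h x y \<le> \<epsilon> / 2" by (rule Baire_dist_le[where N = N]) (use N in linarith)+
        then have "Baire_dist h x y < \<epsilon>" using \<epsilon>(1) by linarith
        moreover have "y \<in> topspace X" using y openin_subset[OF Vop[OF V]] by blast
        ultimately show "y \<in> mball_of m x \<epsilon>" using xX by (simp add: mX)
      qed
      moreover have "\<exists>U\<in>\<U>. mball_of m x \<epsilon> \<subseteq> U" using \<epsilon>(2) xX unfolding refines_def mX(1) by blast
      ultimately show "\<exists>U\<in>\<U>. V \<subseteq> U" by blast
    qed
    ultimately show "\<exists>\<V>\<in>{\<V>\<in>metric_uniformity m. star_finite \<V> \<and> (\<forall>V\<in>\<V>. openin (mtopology_of m) V)}.
        refines \<V> \<U>"
      unfolding mX(3) using Vop by blast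
  qed blast
qed

lemma complete_star_finite_metric_if_closed_in_Baire_cube:
  assumes S: "closedin (Baire_cube D) S" "X homeomorphic_space subtopology (Baire_cube D) S"
  shows "\<exists>m. mtopology_of m = X \<and> mcomplete_of m \<and> star_finite_base m"
proof -
  obtain h where h: "homeomorphic_map X (subtopology (Baire_cube D) S) h"
    using S(2) unfolding homeomorphic_space by blast
  have "h ` topspace X = topspace (Baire_cube D) \<inter> S"
    using homeomorphic_imp_surjective_map[OF h] by simp
  also have "\<dots> = S" using closedin_subset[OF S(1)] by (rule Int_absorb1)
  finally have im: "h ` topspace X = S" .
  have e: "embedding_map X (Baire_cube D) h" unfolding embedding_map_def im by (rule h)
  define m where "m = metric (topspace X, Baire_dist h)"
  have "mcomplete_of m" by (rule mcomplete_of_Baire_dist[OF e m_def]) (simp only: im S(1))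
  then show ?thesis
    using mtopology_of_Baire_dist(3)[OF e m_def] star_finite_base_Baire_dist[OF e m_def] by blast
qed

section \<open>The product as a product of locally compact metric spaces\<close>

text \<open>The metric of a space is carried over along an injection into another type.\<close>

lemma metric_copy:
  fixes j :: "'r::metric_space \<Rightarrow> 'c"
  assumes j: "inj j"
  shows "\<exists>m. homeomorphic_maps euclidean (mtopology_of m) j (inv j)"
proof -
  interpret Metric_space "range j" "\<lambda>x y. dist (inv j x) (inv j y)"
  proof
    show "dist (inv j x) (inv j y) = 0 \<longleftrightarrow> x = y" if "x \<in> range j" "y \<in> range j" for x y
      using that j by auto
  qed (auto simp: dist_commute dist_triangle)
  have "homeomorphic_maps euclidean mtopology j (inv j)"
    unfolding homeomorphic_maps_def continuous_map_def
  proof (intro conjI allI impI ballI)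
    fix U assume U: "openin mtopology U"
    have "open {t. j t \<in> U}"
      unfolding open_contains_ball
    proof
      fix t assume "t \<in> {t. j t \<in> U}"
      then obtain r where r: "r > 0" "mball (j t) r \<subseteq> U" using U unfolding openin_mtopology by blast
      have "ball t r \<subseteq> {t. j t \<in> U}" using r(2) j by (auto simp: subset_iff)
      then show "\<exists>r>0. ball t r \<subseteq> {t. j t \<in> U}" using r(1) by blast
    qed
    then show "openin euclidean {x \<in> topspace euclidean. j x \<in> U}" by simp
  next
    fix A :: "'r set" assume "openin euclidean A"
    then have A: "open A" by simp
    have "openin mtopology {x \<in> range j. inv j x \<in> A}"
      unfolding openin_mtopology
    proof (intro conjI allI impI)
      fix x assume x: "x \<in> {x \<in> range j. inv j x \<in> A}"
      then obtain r where r: "r > 0" "ball (inv j x) r \<subseteq> A" using A open_contains_ball by blast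
      then have "mball x r \<subseteq> {x \<in> range j. inv j x \<in> A}" by (auto simp: subset_iff)
      then show "\<exists>r>0. mball x r \<subseteq> {x \<in> range j. inv j x \<in> A}" using r(1) by blast
    qed auto
    then show "openin mtopology {x \<in> topspace mtopology. inv j x \<in> A}" by simp
  qed (use j in auto)
  then show ?thesis using mtopology_of by metis
qed

text \<open>The discrete coordinates become the factors of even index, the real ones those of odd index.\<close>

lemma Baire_cube_homeomorphic_product:
  fixes D :: "'a set"
  shows "\<exists>(Y :: nat \<Rightarrow> ('b + 'a + real) metric) h.
    (\<forall>i. locally_compact_space (mtopology_of (Y i))) \<and>
    homeomorphic_map (Baire_cube D) (product_topology (\<lambda>i. mtopology_of (Y i)) UNIV) h"
proof -
  define c :: "'a \<Rightarrow> 'b + 'a + real" where "c x = Inr (Inl x)" for x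
  define j :: "real \<Rightarrow> 'b + 'a + real" where "j t = Inr (Inr t)" for t
  have c: "inj c" and j: "inj j" by (simp_all add: inj_def c_def j_def)
  obtain R where R: "homeomorphic_maps euclideanreal (mtopology_of R) j (inv j)"
    using metric_copy[OF j] by blast
  define Q where "Q = metric (c ` D, discrete_metric.dd)"
  have Q: "mtopology_of Q = discrete_topology (c ` D)"
    unfolding Q_def by (simp add: Metric_space.mtopology_of[OF metric_M_dd] discrete_metric.mtopology_discrete_metric)
  define Y where "Y i = (if even i then Q else R)" for i :: nat
  let ?P = "product_topology (\<lambda>i. mtopology_of (Y i)) UNIV"
  have "locally_compact_space (mtopology_of (Y i))" for i
  proof (cases "even i")
    case False
    have "euclideanreal homeomorphic_space mtopology_of R"
      by (rule homeomorphic_maps_imp_homeomorphic_space[OF R])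
    then show ?thesis
      using False homeomorphic_locally_compact_space locally_compact_space_euclidean
      unfolding Y_def by fastforce
  qed (simp add: Y_def Q locally_compact_space_discrete_topology)
  moreover
  define f where "f z i = (if even i then c (fst z (i div 2)) else j (snd z (i div 2)))"
    for z :: "(nat \<Rightarrow> 'a) \<times> (nat \<Rightarrow> real)" and i :: nat
  define g where "g w = (\<lambda>n. inv c (w (2 * n)), \<lambda>n. inv j (w (2 * n + 1)))"
    for w :: "nat \<Rightarrow> 'b + 'a + real"
  have jR: "continuous_map euclideanreal (mtopology_of R) j" "continuous_map (mtopology_of R) euclideanreal (inv j)"
    "\<And>y. y \<in> mspace R \<Longrightarrow> j (inv j y) = y"
    using R by (auto simp: homeomorphic_maps_def)
  have "continuous_map (Baire_cube D) (mtopology_of (Y i)) (\<lambda>z. f z i)" for i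
  proof (cases "even i")
    case True
    have "continuous_map (discrete_topology D) (discrete_topology (c ` D)) c" by simp
    from continuous_map_compose[OF continuous_map_Baire_cube_coords(1) this, of "i div 2"]
    show ?thesis using True by (simp add: f_def Y_def Q o_def)
  next
    case False
    from continuous_map_compose[OF continuous_map_Baire_cube_coords(2) jR(1), of D "i div 2"]
    show ?thesis using False by (simp add: f_def Y_def o_def)
  qed
  then have 1: "continuous_map (Baire_cube D) ?P f" unfolding continuous_map_componentwise_UNIV by blast
  have proj: "continuous_map ?P (mtopology_of (Y i)) (\<lambda>w. w i)" for i
    by (rule continuous_map_product_projection) simp
  have 2: "continuous_map ?P (Baire_cube D) g"
    unfolding continuous_map_Baire_cube
  proof (intro conjI allI)
    fix n
    have even: "continuous_map ?P (discrete_topology (c ` D)) (\<lambda>w. w (2 * n))"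
      using proj[of "2 * n"] by (simp add: Y_def Q)
    have "continuous_map (discrete_topology (c ` D)) (discrete_topology D) (inv c)"
      by (auto simp: inv_f_f[OF c])
    from continuous_map_compose[OF even this]
    show "continuous_map ?P (discrete_topology D) (\<lambda>w. fst (g w) n)" by (simp add: g_def o_def)
    have odd: "continuous_map ?P (mtopology_of R) (\<lambda>w. w (2 * n + 1))"
      using proj[of "2 * n + 1"] by (simp add: Y_def)
    from continuous_map_compose[OF odd jR(2)]
    show "continuous_map ?P euclideanreal (\<lambda>w. snd (g w) n)" by (simp add: g_def o_def)
  qed
  have 3: "g (f z) = z" for z
    using c j by (simp add: f_def g_def prod_eq_iff)
  have 4: "f (g w) = w" if w: "w \<in> topspace ?P" for w
  proof
    fix i
    have wi: "w i \<in> mspace (Y i)" using w by (auto simp: PiE_iff)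
    show "f (g w) i = w i"
    proof (cases "even i")
      case True
      have "mspace Q = c ` D" using Q by (metis topspace_discrete_topology topspace_mtopology_of)
      then have "c (inv c (w i)) = w i" using wi True by (auto simp: Y_def f_inv_into_f)
      then show ?thesis using True by (simp add: f_def g_def)
    next
      case False
      then show ?thesis using wi jR(3) by (simp add: f_def g_def Y_def)
    qed
  qed
  have "homeomorphic_maps (Baire_cube D) ?P f g"
    unfolding homeomorphic_maps_def using 1 2 3 4 by blast
  ultimately show ?thesis unfolding homeomorphic_map_maps by blast
qed

section \<open>The equivalence\<close>

lemma embedding_map_if_homeomorphic_subtopology:
  assumes S: "S \<subseteq> topspace Y" and X: "X homeomorphic_space subtopology Y S"
  obtains e where "embedding_map X Y e" "e ` topspace X = S"
proof -
  from X[unfolded homeomorphic_space] obtain e where e: "homeomorphic_map X (subtopology Y S) e" ..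
  have "e ` topspace X = S"
    using homeomorphic_imp_surjective_map[OF e] S by auto
  then show thesis using that e unfolding embedding_map_def by simp
qed

lemma closed_in_Baire_cube_if_closed_in_product:
  fixes Y :: "nat \<Rightarrow> 'c metric"
  assumes lc: "\<And>i. i \<in> I \<Longrightarrow> locally_compact_space (mtopology_of (Y i))"
    and S: "closedin (product_topology (\<lambda>i. mtopology_of (Y i)) I) S"
    and X: "X homeomorphic_space subtopology (product_topology (\<lambda>i. mtopology_of (Y i)) I) S"
    and D: "\<And>P. open_partition X P \<Longrightarrow> P \<lesssim> D"
  shows "\<exists>S. closedin (Baire_cube D) S \<and> X homeomorphic_space subtopology (Baire_cube D) S"
proof -
  let ?P = "product_topology (\<lambda>i. mtopology_of (Y i)) I"
  have "completely_metrizable_space (mtopology_of (Y i))" if "i \<in> I" for i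
    by (rule locally_compact_imp_completely_metrizable_space[OF metrizable_space_mtopology_of lc[OF that]])
  then have "completely_metrizable_space ?P"
    by (simp add: completely_metrizable_space_product_topology)
  then have compl: "completely_metrizable_space X"
    using homeomorphic_completely_metrizable_space[OF X] completely_metrizable_space_closedin[OF _ S] by blast
  obtain e where e: "embedding_map X ?P e"
    using embedding_map_if_homeomorphic_subtopology[OF closedin_subset[OF S] X] by blast
  from star_countable_open_base_if_embedded_in_product[OF e star_countable_open_base_if_locally_compact[OF lc]]
  obtain \<U> where "open_cover_base X \<U> \<and> (\<forall>n. star_countable (\<U> n))" by blast
  then have "open_cover_base X \<U>" "\<And>n. star_countable (\<U> n)" by simp_all
  then show ?thesis by (rule closed_in_Baire_cube_if_completely_metrizable[OF compl _ _ D])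
qed

lemma completely_metrizable_space_mtopology_of:
  "mcomplete_of m \<Longrightarrow> completely_metrizable_space (mtopology_of m)"
  unfolding mcomplete_of_def mtopology_of_def
  by (rule Metric_space.completely_metrizable_space_mtopology[OF Metric_space_mspace_mdist])

lemma closed_in_Baire_cube_if_mcomplete_of:
  assumes "mcomplete_of m" and base: "\<exists>\<U>. open_cover_base (mtopology_of m) \<U> \<and> (\<forall>n. star_countable (\<U> n))"
    and D: "\<And>P. open_partition (mtopology_of m) P \<Longrightarrow> P \<lesssim> D"
  shows "\<exists>S. closedin (Baire_cube D) S \<and> mtopology_of m homeomorphic_space subtopology (Baire_cube D) S"
proof -
  from base obtain \<U> where "open_cover_base (mtopology_of m) \<U> \<and> (\<forall>n. star_countable (\<U> n))" ..
  then have "open_cover_base (mtopology_of m) \<U>" "\<And>n. star_countable (\<U> n)" by simp_all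
  then show ?thesis
    by (rule closed_in_Baire_cube_if_completely_metrizable
        [OF completely_metrizable_space_mtopology_of[OF assms(1)] _ _ D])
qed

lemma all_equivalent_six:
  assumes "P2 \<Longrightarrow> P1" "P2 \<Longrightarrow> P5" "P2 \<Longrightarrow> P6" "P3 \<Longrightarrow> P2" "P3 \<Longrightarrow> P4"
    and "P1 \<Longrightarrow> P3" "P4 \<Longrightarrow> P3" "P5 \<Longrightarrow> P3" "P6 \<Longrightarrow> P3"
  shows "all_equivalent [P1, P2, P3, P4, P5, P6]"
proof -
  have "P1 \<longleftrightarrow> P3" "P2 \<longleftrightarrow> P3" "P4 \<longleftrightarrow> P3" "P5 \<longleftrightarrow> P3" "P6 \<longleftrightarrow> P3"
    using assms by iprover+
  then show ?thesis by (simp add: all_equivalent_def)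
qed

(* HOL cannot quantify over types inside a formula. The locally compact factors in the fourth
   condition live on an arbitrary type 'b, enlarged by 'a + real so that there is always room
   for the factors needed to represent X. *)

theorem theorem2p2p8:
  fixes X :: "'a topology"
  assumes "completely_regular_space X" and "Hausdorff_space X"
  shows "all_equivalent
    [ \<exists>d :: 'a metric. mtopology_of d = X \<and> Bourbaki_complete d,

      \<exists>d :: 'a metric. mtopology_of d = X \<and> mcomplete_of d \<and> star_finite_base d,

      \<exists>D :: 'a set. has_cellularity X D \<and>
        (let P = prod_topology (product_topology (\<lambda>_::nat. discrete_topology D) UNIV)
                               (product_topology (\<lambda>_::nat. euclideanreal) UNIV)
         in \<exists>S. closedin P S \<and> X homeomorphic_space subtopology P S),

      \<exists>(I :: nat set) (Y :: nat \<Rightarrow> ('b + 'a + real) metric).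
        (\<forall>i\<in>I. locally_compact_space (mtopology_of (Y i))) \<and>
        (let P = product_topology (\<lambda>i. mtopology_of (Y i)) I
         in \<exists>S. closedin P S \<and> X homeomorphic_space subtopology P S),

      Cech_complete X \<and> strongly_metrizable X,

      \<exists>d :: 'a metric. mtopology_of d = X \<and> mcomplete_of d \<and> star_countable_base d ]"
proof -
  obtain D :: "'a set" where D: "has_cellularity X D"
    using ex_has_cellularity[of X] by blast
  then have part: "P \<lesssim> D" if "open_partition X P" for P
    using that unfolding has_cellularity_def by blast
  show ?thesis
    unfolding Let_def
  proof (rule all_equivalent_six, goal_cases)
    case 1
    then show ?case using Bourbaki_complete_if_star_finite_base by blast
  next
    case 2
    then obtain d :: "'a metric" where d: "mtopology_of d = X" "mcomplete_of d" "star_finite_base d" by blast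
    show ?case
      using Cech_complete_if_mcomplete_of[OF d(1,2) assms] strongly_metrizable_if_star_finite_base[OF d(3)] d(1)
      by simp
  next
    case 3
    then show ?case using star_countable_base_if_star_finite_base by blast
  next
    case 4
    then obtain D' :: "'a set" and S where "closedin (Baire_cube D') S" "X homeomorphic_space subtopology (Baire_cube D') S"
      by blast
    then show ?case by (rule complete_star_finite_metric_if_closed_in_Baire_cube)
  next
    case 5
    then obtain D' :: "'a set" and S where S: "closedin (Baire_cube D') S" "X homeomorphic_space subtopology (Baire_cube D') S"
      by blast
    obtain Y :: "nat \<Rightarrow> ('b + 'a + real) metric" and h where
      Y: "\<forall>i. locally_compact_space (mtopology_of (Y i))"
      "homeomorphic_map (Baire_cube D') (product_topology (\<lambda>i. mtopology_of (Y i)) UNIV) h"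
      using Baire_cube_homeomorphic_product by blast
    show ?case
      using Y(1) closedin_transport[OF Y(2) S] by (intro exI[of _ UNIV] exI[of _ Y]) simp
  next
    case 6
    then obtain d :: "'a metric" where d: "mtopology_of d = X" "Bourbaki_complete d" by blast
    show ?case
      by (intro exI[of _ D] conjI D closed_in_Baire_cube_if_mcomplete_of
          [OF mcomplete_of_if_Bourbaki_complete[OF d(2)] star_countable_open_base_if_Bourbaki_complete[OF d(2)],
            of D, unfolded d(1)] part)
  next
    case 7
    then obtain I and Y :: "nat \<Rightarrow> ('b + 'a + real) metric" and S where
      Y: "\<forall>i\<in>I. locally_compact_space (mtopology_of (Y i))"
      "closedin (product_topology (\<lambda>i. mtopology_of (Y i)) I) S"
      "X homeomorphic_space subtopology (product_topology (\<lambda>i. mtopology_of (Y i)) I) S"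
      by blast
    show ?case
      by (intro exI[of _ D] conjI D closed_in_Baire_cube_if_closed_in_product[OF _ Y(2,3) part])
        (use Y(1) in blast)
  next
    case 8
    then have "Cech_complete X" "strongly_metrizable X" by blast+
    then show ?case
      by (intro exI[of _ D] conjI D closed_in_Baire_cube_if_Cech_complete[OF assms _ _ part])
  next
    case 9
    then obtain d :: "'a metric" where d: "mtopology_of d = X" "mcomplete_of d" "star_countable_base d" by blast
    show ?case
      by (intro exI[of _ D] conjI D closed_in_Baire_cube_if_mcomplete_of
          [OF d(2) star_countable_open_base_if_star_countable_base[OF d(3)], of D, unfolded d(1)] part)
  qed
qed

end
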